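(* There exist finite positive values $\vartheta_e,\vartheta_k$ of the weight $\vartheta$, which do not depend on the cell size $\ell$, such that for every $\ell>0$: (a) For any $\vartheta>\vartheta_e$, the quadratic form $(\varepsilon,\eta)\mapsto e_\vartheta(\varepsilon,\eta)$ given by $$2e_\vartheta(\varepsilon,\eta):=\varepsilon_{ij}C^0_{ijkp}\varepsilon_{kp}+\ell\,\varepsilon_{ij}C^1_{ijkpm}\eta_{kpm}+\ell^2\,\eta_{ijn}A^2_{ijnkpm}(\vartheta)\,\eta_{kpm}$$ is positive definite on $S^2(\mathbb R^d)\times(S^2(\mathbb R^d)\otimes\mathbb R^d)$, and the bilinear form $\mathcal Q_\vartheta$ is positive ($\mathcal Q_\vartheta(U,U)\ge0$). (b) For any $\vartheta>\vartheta_k$, the quadratic form $(u,\gamma)\mapsto k_\vartheta(u,\gamma)$ given by $$2k_\vartheta(u,\gamma):=\rho^0\Big\{|u|^2+\ell\,u_iB^1_{ikp}\gamma_{kp}+\ell^2\,\gamma_{ip}J^2_{ipkm}(\vartheta)\,\gamma_{km}\Big\}$$ is positive definite on $\mathbb R^d\times(\mathbb R^d\otimes\mathbb R^d)$, and the bilinear form $\mathcal R_\vartheta$ is positive ($\mathcal R_\vartheta(U,U)\ge0$). Moreover, letting $\vartheta_0:=\max(\vartheta_e,\vartheta_k)$, for any $\vartheta>\vartheta_0$: (c) Writing the partial differential operators $\mathsf Q_\vartheta,\mathsf R_\vartheta$ as $d$-variate matrix-valued polynomials $\mathsf Q_\vartheta[\partial],\mathsf R_\vartheta[\partial]$ evaluated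 at $\partial=(\partial_1,\dots,\partial_d)$, both Fourier symbols $\mathsf Q_\vartheta(\mathrm i\xi),\mathsf R_\vartheta(\mathrm i\xi)\in\mathbb C^{d\times d}$ are positive definite Hermitian matrices for any $\xi\in\mathbb R^d$, $\xi\ne0$. (d) $\mathcal Q_\vartheta$ is $H^2(\mathbb R^d)$-coercive: there is $C=C(\vartheta)>0$ with $$\mathcal Q_\vartheta(U,U)\ge C\big(\|U\|^2_{H^2(\mathbb R^d)}-\|U\|^2_{L^2(\mathbb R^d)}\big)\ge0\quad\text{for all }U\in H^2(\mathbb R^d;\mathbb R^d).$$ (e) $\mathcal R_\vartheta$ is $H^1(\mathbb R^d)$-elliptic: there is $C=C(\vartheta)>0$ with $$\mathcal R_\vartheta(W,W)\ge C\|W\|^2_{H^1(\mathbb R^d)}\quad\text{for all }W\in H^1(\mathbb R^d;\mathbb R^d).$$ (The constants $C$ are for fixed cell, material and $\ell$. All tensors, operators and bilinear forms are defined in the context.)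
   Context: Let $d\in\{2,3\}$; repeated indices are summed; $\ell>0$ is the cell size (never a tensor index here). $S^2(\mathbb R^d)$ is the space of symmetric $d\times d$ tensors; $\eta\in S^2(\mathbb R^d)\otimes\mathbb R^d$ means $\eta_{ijn}=\eta_{jin}$. Cell and material. $v_1,\dots,v_d$ is a basis of $\mathbb R^d$ and $\mathcal Z=\{\sum_i n_iv_i:\ n_i\in\mathbb Z\}$. The (reference) periodicity cell $\mathcal Y\subset\mathbb R^d$ is a bounded open set (with Lebesgue-null boundary) whose translates $\mathcal Y+V$, $V\in\mathcal Z$, are pairwise disjoint and have closures covering $\mathbb R^d$. The elasticity tensor $C=(C_{ijkp})\in L^\infty(\mathcal Y)$ is real, has the symmetries $C_{ijkp}=C_{jikp}=C_{ijpk}=C_{kpij}$ and satisfies $\varepsilon_{ij}C_{ijkp}(y)\varepsilon_{kp}\ge\kappa_m|\varepsilon|^2$ for all symmetric $\varepsilon$ and some $\kappa_m>0$. The mass density $\rho\in L^\infty(\mathcal Y)$ satisfies $\rho\ge\rho_m>0$. Function spaces. $H^1_{per}(\mathcal Y;\mathbb R^d)$ is the closure in $H^1(\mathcal Y)$ of smooth $\mathcal Z$-periodic vector functions on $\mathbb R^d$; $H^1_\#(\mathcal Y)$ is its subspace of zero-mean functions. $\langle f\rangle:=|\mathcal Y|^{-1}\int_{\mathcal Y}f\,dy$, $f_{,s}=\partial f/\partial y_s$, and $A(w,v):=\int_{\mathcal Y}w_{i,j}C_{ijkp}v_{k,p}\,dy$. $\rho^0:=\langle\rho\rangle$, $\beta:=\rho/\rho^0$.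 Cell functions and effective tensors (each cell function is the unique element of $H^1_\#(\mathcal Y)$ satisfying the identity for all $v\in H^1_\#(\mathcal Y)$; superscripts are loading indices or labels): - $A(\chi^{1kl},v)=-\int_{\mathcal Y}C_{klrs}v_{r,s}\,dy$; $\ S^{0,kl}_{ij}:=C_{ijpq}\chi^{1kl}_{p,q}+C_{ijkl}$; $\ C^0_{ijkl}:=\langle S^{0,kl}_{ij}\rangle$. - $A(\chi^{2klm},v)=\int_{\mathcal Y}\{(S^{0,kl}_{mr}-C^0_{klmr})v_r-\chi^{1kl}_pC_{pmrs}v_{r,s}\}\,dy$; $\ S^{1,klm}_{ij}:=C_{ijpq}\chi^{2klm}_{p,q}+C_{ijpm}\chi^{1kl}_p$; $\ C^1_{ijklm}:=\langle S^{1,klm}_{ij}\rangle$. - $A(\chi^{3klmn},v)=\int_{\mathcal Y}\{(S^{1,klm}_{rn}-C^1_{rnklm})v_r-\chi^{2klm}_pC_{pnrs}v_{r,s}\}\,dy$; $\ C^2_{ijnklm}:=\langle C_{ijpq}(\chi^{3klmn}_{p,q}+\chi^{2klm}_p\delta_{qn})\rangle$. - $A(\zeta^{2n},v)=\int_{\mathcal Y}(\beta-1)v_n\,dy$; $\ \phi^1_{ikl}:=C_{ilpq}\zeta^{2k}_{p,q}+\beta\chi^{1kl}_i$; $\ B^1_{ikl}:=\langle\phi^1_{ikl}\rangle$; $\ \beta^2_{ik}:=\langle\beta\zeta^{2k}_i\rangle$ (here the 2 is a label). - $A(\zeta^{3kl},v)=\int_{\mathcal Y}(\phi^1_{rkl}-B^1_{rkl})v_r\,dy-\int_{\mathcal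 Y}\zeta^{2k}_aC_{alrs}v_{r,s}\,dy$; $\ \phi^2_{ilkm}:=C_{ilab}\zeta^{3km}_{a,b}+C_{ilam}\zeta^{2k}_a+\beta\chi^{2mkl}_i$; $\ B^2_{ilkm}:=\langle\phi^2_{ilkm}\rangle$. Known properties: $C^0$ has the minor and major symmetries and is elliptic on $S^2(\mathbb R^d)$; $C^1_{ijklm}=C^1_{jiklm}=C^1_{ijlkm}=-C^1_{klijm}$; $C^2_{ijnklm}=C^2_{jinklm}=C^2_{ijnlkm}=C^2_{klmijn}$; $B^1_{ikl}=-B^1_{kil}$; $B^2_{ilkm}=B^2_{kmil}$; $\beta^2$ is symmetric and positive semidefinite. Second-order tensors, for a real weight $\vartheta$: $$A^2_{ijnklm}(\vartheta):=\vartheta\,C^0_{ijkl}\delta_{nm}-C^2_{ijnklm}+\beta^2_{ba}C^0_{anij}C^0_{bmkl},$$ $$J^2_{ilkm}(\vartheta):=\vartheta\,\delta_{ik}\delta_{lm}-B^2_{ilkm}+\beta^2_{ia}C^0_{alkm}+\beta^2_{ka}C^0_{amil}.$$ Operators acting on $U:\mathbb R^d\to\mathbb R^d$: $$(\mathsf Q_\vartheta U)_i=-C^0_{ijkl}\partial_j\partial_lU_k-\ell C^1_{ijklm}\partial_j\partial_l\partial_mU_k+\ell^2A^2_{ijnklm}(\vartheta)\,\partial_j\partial_n\partial_l\partial_mU_k,$$ $$(\mathsf R_\vartheta U)_i=\rho^0\big(U_i+\ell B^1_{ikl}\partial_lU_k-\ell^2J^2_{ilkm}(\vartheta)\,\partial_l\partial_mU_k\big).$$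 Bilinear forms, with $\varepsilon_{ij}(U)=\frac12(\partial_jU_i+\partial_iU_j)$, $\eta_{ijn}(U)=\partial_n\varepsilon_{ij}(U)$: $$\mathcal Q_\vartheta(U,W)=\int_{\mathbb R^d}\big(\varepsilon_{ij}(W)C^0_{ijkl}\varepsilon_{kl}(U)+\ell\,\varepsilon_{ij}(W)C^1_{ijklm}\eta_{klm}(U)+\ell^2\eta_{ijn}(W)A^2_{ijnklm}(\vartheta)\eta_{klm}(U)\big)dx\quad(U,W\in H^2(\mathbb R^d;\mathbb R^d)),$$ $$\mathcal R_\vartheta(U,W)=\int_{\mathbb R^d}\rho^0\big(W_iU_i+\ell\,W_iB^1_{ikl}\partial_lU_k+\ell^2\partial_lW_i\,J^2_{ilkm}(\vartheta)\,\partial_mU_k\big)dx\quad(U,W\in H^1(\mathbb R^d;\mathbb R^d)).$$ Norms: $\|U\|_{H^1}^2=\|U\|_{L^2}^2+\|\nabla U\|_{L^2}^2$, $\|U\|_{H^2}^2=\|U\|_{H^1}^2+\|\nabla^2U\|_{L^2}^2$. *)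

theory Defs
  imports "HOL-Analysis.Analysis"
begin

section \<open>Sobolev spaces\<close>

definition pd :: "'d::finite \<Rightarrow> (real^'d \<Rightarrow> real) \<Rightarrow> real^'d \<Rightarrow> real" where
  "pd j f x = frechet_derivative f (at x) (axis j 1)"

primrec Ck :: "nat \<Rightarrow> (real^'d::finite \<Rightarrow> real) \<Rightarrow> bool" where
  "Ck 0 f \<longleftrightarrow> continuous_on UNIV f"
| "Ck (Suc k) f \<longleftrightarrow> (\<forall>x. f differentiable (at x)) \<and> (\<forall>j. Ck k (pd j f))"

definition smooth :: "(real^'d::finite \<Rightarrow> real) \<Rightarrow> bool" where
  "smooth f \<longleftrightarrow> (\<forall>k. Ck k f)"

definition vsmooth :: "(real^'d \<Rightarrow> real^'d::finite) \<Rightarrow> bool" where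
  "vsmooth U \<longleftrightarrow> (\<forall>i. smooth (\<lambda>x. U x $ i))"

definition test_fun :: "(real^'d::finite) set \<Rightarrow> (real^'d \<Rightarrow> real) \<Rightarrow> bool" where
  "test_fun \<Omega> \<phi> \<longleftrightarrow>
     smooth \<phi> \<and> compact (closure {x. \<phi> x \<noteq> 0}) \<and> closure {x. \<phi> x \<noteq> 0} \<subseteq> \<Omega>"

definition L2 :: "(real^'d::finite) set \<Rightarrow> (real^'d \<Rightarrow> real) \<Rightarrow> bool" where
  "L2 \<Omega> f \<longleftrightarrow> f \<in> borel_measurable (lebesgue_on \<Omega>) \<and> integrable (lebesgue_on \<Omega>) (\<lambda>x. (f x)\<^sup>2)"

definition Linf :: "(real^'d::finite) set \<Rightarrow> (real^'d \<Rightarrow> real) \<Rightarrow> bool" where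
  "Linf \<Omega> f \<longleftrightarrow> f \<in> borel_measurable (lebesgue_on \<Omega>) \<and> (\<exists>K. AE x in lebesgue_on \<Omega>. \<bar>f x\<bar> \<le> K)"

text \<open>Weak partial derivatives within \<open>L\<^sup>2(\<Omega>)\<close>; \<open>\<Omega>\<close> is always open.\<close>

definition has_weak_pd :: "(real^'d::finite) set \<Rightarrow> 'd \<Rightarrow> (real^'d \<Rightarrow> real) \<Rightarrow> (real^'d \<Rightarrow> real) \<Rightarrow> bool" where
  "has_weak_pd \<Omega> j f g \<longleftrightarrow> L2 \<Omega> f \<and> L2 \<Omega> g \<and>
     (\<forall>\<phi>. test_fun \<Omega> \<phi> \<longrightarrow>
        (LINT x|lebesgue_on \<Omega>. f x * pd j \<phi> x) = - (LINT x|lebesgue_on \<Omega>. g x * \<phi> x))"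

text \<open>The weak derivative is determined only almost everywhere; \<open>wpd\<close> selects a representative.\<close>

definition wpd :: "(real^'d::finite) set \<Rightarrow> 'd \<Rightarrow> (real^'d \<Rightarrow> real) \<Rightarrow> real^'d \<Rightarrow> real" where
  "wpd \<Omega> j f = (SOME g. has_weak_pd \<Omega> j f g)"

definition H1 :: "(real^'d::finite) set \<Rightarrow> (real^'d \<Rightarrow> real) \<Rightarrow> bool" where
  "H1 \<Omega> f \<longleftrightarrow> L2 \<Omega> f \<and> (\<forall>j. \<exists>g. has_weak_pd \<Omega> j f g)"

definition H2 :: "(real^'d::finite) set \<Rightarrow> (real^'d \<Rightarrow> real) \<Rightarrow> bool" where
  "H2 \<Omega> f \<longleftrightarrow> H1 \<Omega> f \<and> (\<forall>j. H1 \<Omega> (wpd \<Omega> j f))"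

definition vH1 :: "(real^'d) set \<Rightarrow> (real^'d \<Rightarrow> real^'d::finite) \<Rightarrow> bool" where
  "vH1 \<Omega> U \<longleftrightarrow> (\<forall>i. H1 \<Omega> (\<lambda>x. U x $ i))"

definition vH2 :: "(real^'d) set \<Rightarrow> (real^'d \<Rightarrow> real^'d::finite) \<Rightarrow> bool" where
  "vH2 \<Omega> U \<longleftrightarrow> (\<forall>i. H2 \<Omega> (\<lambda>x. U x $ i))"

text \<open>\<open>grad \<Omega> U i j\<close> is the derivative of the \<open>i\<close>-th component in direction \<open>j\<close>.\<close>

definition grad :: "(real^'d) set \<Rightarrow> (real^'d \<Rightarrow> real^'d::finite) \<Rightarrow> 'd \<Rightarrow> 'd \<Rightarrow> real^'d \<Rightarrow> real" where
  "grad \<Omega> U i j = wpd \<Omega> j (\<lambda>x. U x $ i)"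

definition L2_normsq :: "(real^'d) set \<Rightarrow> (real^'d \<Rightarrow> real^'d::finite) \<Rightarrow> real" where
  "L2_normsq \<Omega> U = (\<Sum>i\<in>UNIV. LINT x|lebesgue_on \<Omega>. (U x $ i)\<^sup>2)"

definition H1_normsq :: "(real^'d) set \<Rightarrow> (real^'d \<Rightarrow> real^'d::finite) \<Rightarrow> real" where
  "H1_normsq \<Omega> U = L2_normsq \<Omega> U + (\<Sum>(i,j)\<in>UNIV. LINT x|lebesgue_on \<Omega>. (grad \<Omega> U i j x)\<^sup>2)"

definition H2_normsq :: "(real^'d) set \<Rightarrow> (real^'d \<Rightarrow> real^'d::finite) \<Rightarrow> real" where
  "H2_normsq \<Omega> U = H1_normsq \<Omega> U +
     (\<Sum>(i,j,n)\<in>UNIV. LINT x|lebesgue_on \<Omega>. (wpd \<Omega> n (grad \<Omega> U i j) x)\<^sup>2)"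

section \<open>The periodic medium and its cell functions\<close>

text \<open>The first four fields describe the medium (\<open>stiff\<close> and \<open>dens\<close> only matter on \<open>cell\<close>),
  the remaining ones are the cell functions, with their superscripts as leading arguments.\<close>

record 'd cell_data =
  basis :: "'d \<Rightarrow> real^'d"
  cell  :: "(real^'d) set"
  stiff :: "real^'d \<Rightarrow> 'd \<Rightarrow> 'd \<Rightarrow> 'd \<Rightarrow> 'd \<Rightarrow> real"
  dens  :: "real^'d \<Rightarrow> real"
  chi1  :: "'d \<Rightarrow> 'd \<Rightarrow> real^'d \<Rightarrow> real^'d"
  chi2  :: "'d \<Rightarrow> 'd \<Rightarrow> 'd \<Rightarrow> real^'d \<Rightarrow> real^'d"
  chi3  :: "'d \<Rightarrow> 'd \<Rightarrow> 'd \<Rightarrow> 'd \<Rightarrow> real^'d \<Rightarrow> real^'d"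
  zeta2 :: "'d \<Rightarrow> real^'d \<Rightarrow> real^'d"
  zeta3 :: "'d \<Rightarrow> 'd \<Rightarrow> real^'d \<Rightarrow> real^'d"

definition lattice :: "('d::finite) cell_data \<Rightarrow> (real^'d) set" where
  "lattice M = range (\<lambda>n::'d \<Rightarrow> int. \<Sum>i\<in>UNIV. of_int (n i) *\<^sub>R basis M i)"

definition periodicity_cell :: "('d::finite) cell_data \<Rightarrow> bool" where
  "periodicity_cell M \<longleftrightarrow>
     inj (basis M) \<and> independent (range (basis M)) \<and> span (range (basis M)) = UNIV \<and>
     bounded (cell M) \<and> open (cell M) \<and> frontier (cell M) \<in> null_sets lebesgue \<and>
     (\<forall>V\<in>lattice M. \<forall>V'\<in>lattice M. V \<noteq> V' \<longrightarrow> (+) V ` cell M \<inter> (+) V' ` cell M = {}) \<and>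
     (\<Union>V\<in>lattice M. closure ((+) V ` cell M)) = UNIV"

definition elastic_medium :: "('d::finite) cell_data \<Rightarrow> bool" where
  "elastic_medium M \<longleftrightarrow>
     (\<forall>i j k p. Linf (cell M) (\<lambda>y. stiff M y i j k p)) \<and>
     (AE y in lebesgue_on (cell M). \<forall>i j k p.
        stiff M y i j k p = stiff M y j i k p \<and>
        stiff M y i j k p = stiff M y i j p k \<and>
        stiff M y i j k p = stiff M y k p i j) \<and>
     (\<exists>\<kappa>>0. AE y in lebesgue_on (cell M). \<forall>\<epsilon> :: 'd \<Rightarrow> 'd \<Rightarrow> real. (\<forall>i j. \<epsilon> i j = \<epsilon> j i) \<longrightarrow>
        (\<Sum>(i,j,k,p)\<in>UNIV. \<epsilon> i j * stiff M y i j k p * \<epsilon> k p) \<ge> \<kappa> * (\<Sum>(i,j)\<in>UNIV. (\<epsilon> i j)\<^sup>2)) \<and>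
     Linf (cell M) (dens M) \<and>
     (\<exists>\<rho>m>0. AE y in lebesgue_on (cell M). dens M y \<ge> \<rho>m)"

definition smooth_periodic :: "('d::finite) cell_data \<Rightarrow> (real^'d \<Rightarrow> real^'d) \<Rightarrow> bool" where
  "smooth_periodic M f \<longleftrightarrow> vsmooth f \<and> (\<forall>V\<in>lattice M. \<forall>x. f (x + V) = f x)"

definition H1_per :: "('d::finite) cell_data \<Rightarrow> (real^'d \<Rightarrow> real^'d) \<Rightarrow> bool" where
  "H1_per M w \<longleftrightarrow> vH1 (cell M) w \<and>
     (\<exists>\<Phi> :: nat \<Rightarrow> real^'d \<Rightarrow> real^'d. (\<forall>n. smooth_periodic M (\<Phi> n)) \<and>
        (\<lambda>n. H1_normsq (cell M) (\<lambda>y. \<Phi> n y - w y)) \<longlonglongrightarrow> 0)"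

definition H1_per0 :: "('d::finite) cell_data \<Rightarrow> (real^'d \<Rightarrow> real^'d) \<Rightarrow> bool" where
  "H1_per0 M w \<longleftrightarrow> H1_per M w \<and> (\<forall>i. (LINT y|lebesgue_on (cell M). w y $ i) = 0)"

definition avg :: "('d::finite) cell_data \<Rightarrow> (real^'d \<Rightarrow> real) \<Rightarrow> real" where
  "avg M f = (LINT y|lebesgue_on (cell M). f y) / measure lebesgue (cell M)"

abbreviation cgrad :: "('d::finite) cell_data \<Rightarrow> (real^'d \<Rightarrow> real^'d) \<Rightarrow> 'd \<Rightarrow> 'd \<Rightarrow> real^'d \<Rightarrow> real" where
  "cgrad M w i j y \<equiv> grad (cell M) w i j y"

definition A_form :: "('d::finite) cell_data \<Rightarrow> (real^'d \<Rightarrow> real^'d) \<Rightarrow> (real^'d \<Rightarrow> real^'d) \<Rightarrow> real" where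
  "A_form M w v = (LINT y|lebesgue_on (cell M).
     (\<Sum>(i,j,k,p)\<in>UNIV. cgrad M w i j y * stiff M y i j k p * cgrad M v k p y))"

definition cell_solution ::
  "('d::finite) cell_data \<Rightarrow> ((real^'d \<Rightarrow> real^'d) \<Rightarrow> real) \<Rightarrow> (real^'d \<Rightarrow> real^'d) \<Rightarrow> bool" where
  "cell_solution M F w \<longleftrightarrow> H1_per0 M w \<and> (\<forall>v. H1_per0 M v \<longrightarrow> A_form M w v = F v)"

definition rho0 :: "('d::finite) cell_data \<Rightarrow> real" where
  "rho0 M = avg M (dens M)"

definition beta :: "('d::finite) cell_data \<Rightarrow> real^'d \<Rightarrow> real" where
  "beta M y = dens M y / rho0 M"

text \<open>Effective tensors. The stress \<open>S0 M k l i j\<close> carries its loading indices \<open>k l\<close> first,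
  and so does \<open>S1 M k l m i j\<close>.\<close>

definition S0 :: "('d::finite) cell_data \<Rightarrow> 'd \<Rightarrow> 'd \<Rightarrow> 'd \<Rightarrow> 'd \<Rightarrow> real^'d \<Rightarrow> real" where
  "S0 M k l i j y =
     (\<Sum>(p,q)\<in>UNIV. stiff M y i j p q * cgrad M (chi1 M k l) p q y) + stiff M y i j k l"

definition C0 :: "('d::finite) cell_data \<Rightarrow> 'd \<Rightarrow> 'd \<Rightarrow> 'd \<Rightarrow> 'd \<Rightarrow> real" where
  "C0 M i j k l = avg M (S0 M k l i j)"

definition S1 :: "('d::finite) cell_data \<Rightarrow> 'd \<Rightarrow> 'd \<Rightarrow> 'd \<Rightarrow> 'd \<Rightarrow> 'd \<Rightarrow> real^'d \<Rightarrow> real" where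
  "S1 M k l m i j y =
     (\<Sum>(p,q)\<in>UNIV. stiff M y i j p q * cgrad M (chi2 M k l m) p q y)
     + (\<Sum>p\<in>UNIV. stiff M y i j p m * chi1 M k l y $ p)"

definition C1 :: "('d::finite) cell_data \<Rightarrow> 'd \<Rightarrow> 'd \<Rightarrow> 'd \<Rightarrow> 'd \<Rightarrow> 'd \<Rightarrow> real" where
  "C1 M i j k l m = avg M (S1 M k l m i j)"

definition C2 :: "('d::finite) cell_data \<Rightarrow> 'd \<Rightarrow> 'd \<Rightarrow> 'd \<Rightarrow> 'd \<Rightarrow> 'd \<Rightarrow> 'd \<Rightarrow> real" where
  "C2 M i j n k l m = avg M (\<lambda>y. \<Sum>(p,q)\<in>UNIV. stiff M y i j p q *
     (cgrad M (chi3 M k l m n) p q y + chi2 M k l m y $ p * of_bool (q = n)))"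

definition phi1 :: "('d::finite) cell_data \<Rightarrow> 'd \<Rightarrow> 'd \<Rightarrow> 'd \<Rightarrow> real^'d \<Rightarrow> real" where
  "phi1 M i k l y =
     (\<Sum>(p,q)\<in>UNIV. stiff M y i l p q * cgrad M (zeta2 M k) p q y) + beta M y * chi1 M k l y $ i"

definition B1 :: "('d::finite) cell_data \<Rightarrow> 'd \<Rightarrow> 'd \<Rightarrow> 'd \<Rightarrow> real" where
  "B1 M i k l = avg M (phi1 M i k l)"

definition beta2 :: "('d::finite) cell_data \<Rightarrow> 'd \<Rightarrow> 'd \<Rightarrow> real" where
  "beta2 M i k = avg M (\<lambda>y. beta M y * zeta2 M k y $ i)"

definition phi2 :: "('d::finite) cell_data \<Rightarrow> 'd \<Rightarrow> 'd \<Rightarrow> 'd \<Rightarrow> 'd \<Rightarrow> real^'d \<Rightarrow> real" where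
  "phi2 M i l k m y =
     (\<Sum>(a,b)\<in>UNIV. stiff M y i l a b * cgrad M (zeta3 M k m) a b y)
     + (\<Sum>a\<in>UNIV. stiff M y i l a m * zeta2 M k y $ a)
     + beta M y * chi2 M m k l y $ i"

definition B2 :: "('d::finite) cell_data \<Rightarrow> 'd \<Rightarrow> 'd \<Rightarrow> 'd \<Rightarrow> 'd \<Rightarrow> real" where
  "B2 M i l k m = avg M (phi2 M i l k m)"

text \<open>The variational problems determine the cell functions up to modification on null sets,
  which does not affect the effective tensors; \<open>cell_functions M\<close> says that the fields of \<open>M\<close>
  are representatives of them.\<close>

definition cell_functions :: "('d::finite) cell_data \<Rightarrow> bool" where
  "cell_functions M \<longleftrightarrow>
     (\<forall>k l. cell_solution M
        (\<lambda>v. - (LINT y|lebesgue_on (cell M). (\<Sum>(r,s)\<in>UNIV. stiff M y k l r s * cgrad M v r s y)))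
        (chi1 M k l)) \<and>
     (\<forall>k l m. cell_solution M
        (\<lambda>v. LINT y|lebesgue_on (cell M).
           (\<Sum>r\<in>UNIV. (S0 M k l m r y - C0 M k l m r) * v y $ r)
           - (\<Sum>(p,r,s)\<in>UNIV. chi1 M k l y $ p * stiff M y p m r s * cgrad M v r s y))
        (chi2 M k l m)) \<and>
     (\<forall>k l m n. cell_solution M
        (\<lambda>v. LINT y|lebesgue_on (cell M).
           (\<Sum>r\<in>UNIV. (S1 M k l m r n y - C1 M r n k l m) * v y $ r)
           - (\<Sum>(p,r,s)\<in>UNIV. chi2 M k l m y $ p * stiff M y p n r s * cgrad M v r s y))
        (chi3 M k l m n)) \<and>
     (\<forall>n. cell_solution M
        (\<lambda>v. LINT y|lebesgue_on (cell M). (beta M y - 1) * v y $ n)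
        (zeta2 M n)) \<and>
     (\<forall>k l. cell_solution M
        (\<lambda>v. (LINT y|lebesgue_on (cell M). (\<Sum>r\<in>UNIV. (phi1 M r k l y - B1 M r k l) * v y $ r))
           - (LINT y|lebesgue_on (cell M).
                (\<Sum>(a,r,s)\<in>UNIV. zeta2 M k y $ a * stiff M y a l r s * cgrad M v r s y)))
        (zeta3 M k l))"

definition A2 :: "('d::finite) cell_data \<Rightarrow> real \<Rightarrow> 'd \<Rightarrow> 'd \<Rightarrow> 'd \<Rightarrow> 'd \<Rightarrow> 'd \<Rightarrow> 'd \<Rightarrow> real" where
  "A2 M \<theta> i j n k l m = \<theta> * C0 M i j k l * of_bool (n = m) - C2 M i j n k l m
     + (\<Sum>(a,b)\<in>UNIV. beta2 M b a * C0 M a n i j * C0 M b m k l)"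

definition J2 :: "('d::finite) cell_data \<Rightarrow> real \<Rightarrow> 'd \<Rightarrow> 'd \<Rightarrow> 'd \<Rightarrow> 'd \<Rightarrow> real" where
  "J2 M \<theta> i l k m = \<theta> * of_bool (i = k) * of_bool (l = m) - B2 M i l k m
     + (\<Sum>a\<in>UNIV. beta2 M i a * C0 M a l k m) + (\<Sum>a\<in>UNIV. beta2 M k a * C0 M a m i l)"

section \<open>Quadratic and bilinear forms\<close>

definition e_form :: "('d::finite) cell_data \<Rightarrow> real \<Rightarrow> real \<Rightarrow> ('d \<Rightarrow> 'd \<Rightarrow> real) \<Rightarrow> ('d \<Rightarrow> 'd \<Rightarrow> 'd \<Rightarrow> real) \<Rightarrow> real" where
  "e_form M ell \<theta> \<epsilon> \<eta> = (1/2) *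
     ((\<Sum>(i,j,k,p)\<in>UNIV. \<epsilon> i j * C0 M i j k p * \<epsilon> k p)
      + ell * (\<Sum>(i,j,k,p,m)\<in>UNIV. \<epsilon> i j * C1 M i j k p m * \<eta> k p m)
      + ell\<^sup>2 * (\<Sum>(i,j,n,k,p,m)\<in>UNIV. \<eta> i j n * A2 M \<theta> i j n k p m * \<eta> k p m))"

definition k_form :: "('d::finite) cell_data \<Rightarrow> real \<Rightarrow> real \<Rightarrow> ('d \<Rightarrow> real) \<Rightarrow> ('d \<Rightarrow> 'd \<Rightarrow> real) \<Rightarrow> real" where
  "k_form M ell \<theta> u \<gamma> = (1/2) * rho0 M *
     ((\<Sum>i\<in>UNIV. (u i)\<^sup>2)
      + ell * (\<Sum>(i,k,p)\<in>UNIV. u i * B1 M i k p * \<gamma> k p)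
      + ell\<^sup>2 * (\<Sum>(i,p,k,m)\<in>UNIV. \<gamma> i p * J2 M \<theta> i p k m * \<gamma> k m))"

definition strain :: "(real^'d \<Rightarrow> real^'d::finite) \<Rightarrow> 'd \<Rightarrow> 'd \<Rightarrow> real^'d \<Rightarrow> real" where
  "strain U i j = (\<lambda>x. (grad UNIV U i j x + grad UNIV U j i x) / 2)"

definition strain_grad :: "(real^'d \<Rightarrow> real^'d::finite) \<Rightarrow> 'd \<Rightarrow> 'd \<Rightarrow> 'd \<Rightarrow> real^'d \<Rightarrow> real" where
  "strain_grad U i j n = wpd UNIV n (strain U i j)"

definition Q_form :: "('d::finite) cell_data \<Rightarrow> real \<Rightarrow> real \<Rightarrow> (real^'d \<Rightarrow> real^'d) \<Rightarrow> (real^'d \<Rightarrow> real^'d) \<Rightarrow> real" where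
  "Q_form M ell \<theta> U W = (LINT x|lebesgue.
     (\<Sum>(i,j,k,l)\<in>UNIV. strain W i j x * C0 M i j k l * strain U k l x)
     + ell * (\<Sum>(i,j,k,l,m)\<in>UNIV. strain W i j x * C1 M i j k l m * strain_grad U k l m x)
     + ell\<^sup>2 * (\<Sum>(i,j,n,k,l,m)\<in>UNIV.
               strain_grad W i j n x * A2 M \<theta> i j n k l m * strain_grad U k l m x))"

definition R_form :: "('d::finite) cell_data \<Rightarrow> real \<Rightarrow> real \<Rightarrow> (real^'d \<Rightarrow> real^'d) \<Rightarrow> (real^'d \<Rightarrow> real^'d) \<Rightarrow> real" where
  "R_form M ell \<theta> U W = (LINT x|lebesgue. rho0 M *
     ((\<Sum>i\<in>UNIV. W x $ i * U x $ i)
      + ell * (\<Sum>(i,k,l)\<in>UNIV. W x $ i * B1 M i k l * grad UNIV U k l x)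
      + ell\<^sup>2 * (\<Sum>(i,l,k,m)\<in>UNIV. grad UNIV W i l x * J2 M \<theta> i l k m * grad UNIV U k m x)))"

section \<open>Differential operators and their symbols\<close>

definition Q_op :: "('d::finite) cell_data \<Rightarrow> real \<Rightarrow> real \<Rightarrow> (real^'d \<Rightarrow> real^'d) \<Rightarrow> real^'d \<Rightarrow> real^'d" where
  "Q_op M ell \<theta> U x = (\<chi> i.
     - (\<Sum>(j,k,l)\<in>UNIV. C0 M i j k l * pd j (pd l (\<lambda>x. U x $ k)) x)
     - ell * (\<Sum>(j,k,l,m)\<in>UNIV. C1 M i j k l m * pd j (pd l (pd m (\<lambda>x. U x $ k))) x)
     + ell\<^sup>2 * (\<Sum>(j,n,k,l,m)\<in>UNIV.
               A2 M \<theta> i j n k l m * pd j (pd n (pd l (pd m (\<lambda>x. U x $ k)))) x))"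

definition R_op :: "('d::finite) cell_data \<Rightarrow> real \<Rightarrow> real \<Rightarrow> (real^'d \<Rightarrow> real^'d) \<Rightarrow> real^'d \<Rightarrow> real^'d" where
  "R_op M ell \<theta> U x = (\<chi> i. rho0 M *
     (U x $ i
      + ell * (\<Sum>(k,l)\<in>UNIV. B1 M i k l * pd l (\<lambda>x. U x $ k) x)
      - ell\<^sup>2 * (\<Sum>(k,l,m)\<in>UNIV. J2 M \<theta> i l k m * pd l (pd m (\<lambda>x. U x $ k)) x)))"

text \<open>A matrix-valued polynomial in the \<open>d\<close> indeterminates \<open>X\<^sub>j\<close> is given by a finitely supported
  family of matrix coefficients: \<open>P w\<close> multiplies the monomial \<open>X\<^sub>j \<cdots> X\<^sub>l\<close> if \<open>w = [j, \<dots>, l]\<close>.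
  Words that are permutations of each other denote the same monomial and their
  coefficients add up; this allows tensor coefficients to be used without symmetrization.\<close>

type_synonym 'd mpoly = "'d list \<Rightarrow> real^'d^'d"

definition mpoly_eval :: "('d::finite) mpoly \<Rightarrow> complex^'d \<Rightarrow> complex^'d^'d" where
  "mpoly_eval P z = (\<chi> i k. \<Sum>w | P w \<noteq> 0. of_real (P w $ i $ k) * (\<Prod>j\<leftarrow>w. z $ j))"

definition mpoly_op :: "('d::finite) mpoly \<Rightarrow> (real^'d \<Rightarrow> real^'d) \<Rightarrow> real^'d \<Rightarrow> real^'d" where
  "mpoly_op P U x = (\<Sum>w | P w \<noteq> 0. P w *v (\<chi> k. foldr pd w (\<lambda>x. U x $ k) x))"

fun Q_poly :: "('d::finite) cell_data \<Rightarrow> real \<Rightarrow> real \<Rightarrow> 'd mpoly" where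
  "Q_poly M ell \<theta> [j,l] = (\<chi> i k. - C0 M i j k l)"
| "Q_poly M ell \<theta> [j,l,m] = (\<chi> i k. - ell * C1 M i j k l m)"
| "Q_poly M ell \<theta> [j,n,l,m] = (\<chi> i k. ell\<^sup>2 * A2 M \<theta> i j n k l m)"
| "Q_poly M ell \<theta> _ = 0"

fun R_poly :: "('d::finite) cell_data \<Rightarrow> real \<Rightarrow> real \<Rightarrow> 'd mpoly" where
  "R_poly M ell \<theta> [] = (\<chi> i k. rho0 M * of_bool (i = k))"
| "R_poly M ell \<theta> [l] = (\<chi> i k. rho0 M * ell * B1 M i k l)"
| "R_poly M ell \<theta> [l,m] = (\<chi> i k. - rho0 M * ell\<^sup>2 * J2 M \<theta> i l k m)"
| "R_poly M ell \<theta> _ = 0"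

definition fourier_symbol :: "('d::finite) mpoly \<Rightarrow> real^'d \<Rightarrow> complex^'d^'d" where
  "fourier_symbol P \<xi> = mpoly_eval P (\<chi> j. \<i> * of_real (\<xi> $ j))"

definition hermitian_pos_def :: "complex^'d^'d::finite \<Rightarrow> bool" where
  "hermitian_pos_def H \<longleftrightarrow> (\<forall>i k. H $ i $ k = cnj (H $ k $ i)) \<and>
     (\<forall>z. z \<noteq> 0 \<longrightarrow> 0 < Re (\<Sum>(i,k)\<in>UNIV. cnj (z $ i) * H $ i $ k * z $ k))"

end

theory Submission
  imports Defs
begin

text \<open>
  Everything rests on two pointwise estimates, \<open>e_form_coercive\<close> and \<open>k_form_coercive\<close>: for large
  weights the quadratic forms are bounded below by multiples of \<open>|\<epsilon>|\<^sup>2 + ell\<^sup>2 |\<eta>|\<^sup>2\<close> and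
  \<open>|u|\<^sup>2 + ell\<^sup>2 |\<gamma>|\<^sup>2\<close>. The weight multiplies an elliptic form, that of \<open>C0\<close> or the
  identity; all other second-order contributions are bounded, and Young's inequality absorbs the
  coupling terms. The cell size occurs only in the products \<open>ell \<eta>\<close> and \<open>ell \<gamma>\<close>, so the
  thresholds do not depend on it. The ellipticity of \<open>C0\<close> on symmetric tensors (\<open>C0_elliptic\<close>)
  follows from that of the stiffness by Jensen's inequality, because the gradient of a periodic
  displacement has mean zero over the cell. This in turn comes from the invariance of cell integrals
  of periodic functions under translations (\<open>LINT_cell_translate\<close>).

  Integrated over the space, the estimates bound the bilinear forms from below. For the one that
  contains strains, the full gradient is recovered by Korn's inequality, and the second derivatives
  are combinations of strain gradients since weak derivatives commute. Both facts are instances of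
  the exchange identity \<open>\<integral> \<partial>\<^sub>j a \<partial>\<^sub>i b = \<integral> \<partial>\<^sub>i a \<partial>\<^sub>j b\<close> for functions in \<open>H\<^sup>1\<close>
  (\<open>LINT_weak_pd_exchange\<close>), which is obtained from difference quotients: for differences it is
  the translation invariance of the integral, and the quotients converge weakly because test functions
  are dense in \<open>L\<^sup>2\<close>.

  On a plane wave the Hermitian form of a Fourier symbol is the sum of two values of the real
  quadratic form, at the real and the imaginary part of the wave; this gives its positivity. The
  symbols are Hermitian because the tensors of even order are symmetric and \<open>C1\<close> and \<open>B1\<close>
  antisymmetric under the exchange of their two index groups. These symmetries result from testing the
  cell problems with each other's solutions. Only for \<open>B2\<close> this is not enough: its symmetry uses
  that the first cell function does not change when its two loading indices are interchanged. The
  strains of the two solutions agree by ellipticity, and the displacements then agree by Korn's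
  inequality and the Poincare-Wirtinger inequality for periodic fields (\<open>LINT_eq_if_same_strain\<close>).
\<close>

section \<open>Smooth functions and test functions\<close>

lemma pd_eqI: "(f has_derivative f') (at x) \<Longrightarrow> pd j f x = f' (axis j 1)"
  unfolding pd_def using frechet_derivative_at by metis

lemma pd_const [simp]: "pd j (\<lambda>x. c) = (\<lambda>x. 0)"
  by (rule ext, rule pd_eqI[of _ "\<lambda>_. 0", THEN trans]) auto

lemma pd_bounded_linear: "bounded_linear h \<Longrightarrow> pd j h = (\<lambda>x. h (axis j 1))"
  by (rule ext, rule pd_eqI) (rule bounded_linear_imp_has_derivative)

lemma pd_add:
  assumes "\<And>x. f differentiable (at x)" "\<And>x. g differentiable (at x)"
  shows "pd j (\<lambda>x. f x + g x) = (\<lambda>x. pd j f x + pd j g x)"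
proof
  fix x show "pd j (\<lambda>x. f x + g x) x = pd j f x + pd j g x"
    using has_derivative_add[OF assms[of x, unfolded frechet_derivative_works], THEN pd_eqI, of j]
    by (simp add: pd_def)
qed

lemma pd_mult:
  assumes "\<And>x. f differentiable (at x)" "\<And>x. g differentiable (at x)"
  shows "pd j (\<lambda>x. f x * g x) = (\<lambda>x. pd j f x * g x + f x * pd j g x)"
proof
  fix x show "pd j (\<lambda>x. f x * g x) x = pd j f x * g x + f x * pd j g x"
    using has_derivative_mult[OF assms[of x, unfolded frechet_derivative_works], THEN pd_eqI, of j]
    by (simp add: pd_def)
qed

lemma pd_compose_real:
  assumes "\<And>x. g differentiable (at x)" "\<And>t. (h has_real_derivative h' t) (at t)"
  shows "pd j (\<lambda>x. h (g x)) = (\<lambda>x. h' (g x) * pd j g x)"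
proof
  fix x
  have "((\<lambda>x. h (g x)) has_derivative (\<lambda>v. h' (g x) * frechet_derivative g (at x) v)) (at x)"
    using has_derivative_compose[OF assms(1)[of x, unfolded frechet_derivative_works]
        assms(2)[of "g x", unfolded has_field_derivative_def]] by simp
  from pd_eqI[OF this, of j] show "pd j (\<lambda>x. h (g x)) x = h' (g x) * pd j g x"
    by (simp add: pd_def)
qed

lemma pd_translate:
  assumes "\<And>x. f differentiable (at x)"
  shows "pd j (\<lambda>x. f (x + v)) = (\<lambda>x. pd j f (x + v))"
proof
  fix x
  have "((\<lambda>x. x + v) has_derivative (\<lambda>x. x)) (at x)"
    by (auto intro!: derivative_eq_intros)
  from has_derivative_compose[OF this assms[of "x + v", unfolded frechet_derivative_works]]
  have "((\<lambda>x. f (x + v)) has_derivative frechet_derivative f (at (x + v))) (at x)" .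
  from pd_eqI[OF this, of j] show "pd j (\<lambda>x. f (x + v)) x = pd j f (x + v)"
    by (simp add: pd_def)
qed

lemma differentiable_translate:
  assumes "\<And>x. f differentiable (at x)"
  shows "(\<lambda>x. f (x + v)) differentiable (at x)"
  using differentiable_chain_at[of "\<lambda>x. x + v" x f] assms by (simp add: o_def)

lemma Ck_Suc_imp_Ck: "Ck (Suc k) f \<Longrightarrow> Ck k f"
proof (induction k arbitrary: f)
  case 0
  then show ?case
    by (simp add: continuous_at_imp_continuous_on differentiable_imp_continuous_within)
next
  case (Suc k)
  then show ?case by (metis Ck.simps(2))
qed

lemma Ck_SucD:
  assumes "Ck (Suc k) f"
  shows "f differentiable (at x)" "Ck k (pd j f)" "Ck k f"
  using assms Ck_Suc_imp_Ck[OF assms] by auto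

lemma Ck_const: "Ck k (\<lambda>x. c)"
  by (induction k arbitrary: c) (auto intro: continuous_intros)

lemma Ck_bounded_linear: "bounded_linear h \<Longrightarrow> Ck k h"
  by (cases k) (auto simp: pd_bounded_linear Ck_const linear_continuous_on
      intro: bounded_linear_imp_differentiable)

lemma Ck_add: "Ck k f \<Longrightarrow> Ck k g \<Longrightarrow> Ck k (\<lambda>x. f x + g x)"
  by (induction k arbitrary: f g) (auto simp: pd_add intro: continuous_intros)

lemma Ck_mult: "Ck k f \<Longrightarrow> Ck k g \<Longrightarrow> Ck k (\<lambda>x. f x * g x)"
proof (induction k arbitrary: f g)
  case 0 then show ?case by (auto intro: continuous_intros)
next
  case (Suc k)
  note f = Ck_SucD[OF Suc.prems(1)] and g = Ck_SucD[OF Suc.prems(2)]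
  show ?case
    by (simp add: pd_mult f g Ck_add Suc.IH)
qed

lemma Ck_compose_real:
  assumes D: "\<And>m t. (D m has_real_derivative D (Suc m) t) (at t)"
  shows "Ck k g \<Longrightarrow> Ck k (\<lambda>x. D m (g x))"
proof (induction k arbitrary: m)
  case 0
  have "continuous_on UNIV (D m)"
    using DERIV_continuous[OF D[of m]] by (auto intro!: continuous_at_imp_continuous_on)
  then show ?case using 0 continuous_on_compose2[of UNIV "D m" UNIV g] by auto
next
  case (Suc k)
  note g = Ck_SucD[OF Suc.prems]
  have "(\<lambda>x. D m (g x)) differentiable (at x)" for x
    using differentiable_chain_at[of g x "D m"] g(1)[of x]
      D[of m "g x"] unfolding has_field_derivative_def differentiable_def o_def by blast
  then show ?case
    using pd_compose_real[OF g(1) D[of m]] by (simp add: g Suc.IH Ck_mult)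
qed

lemma Ck_translate: "Ck k f \<Longrightarrow> Ck k (\<lambda>x. f (x + v))"
proof (induction k arbitrary: f)
  case 0
  then have "continuous_on UNIV f" by simp
  then have "continuous_on UNIV (\<lambda>x. f (x + v))"
    by (rule continuous_on_compose2) (auto intro!: continuous_intros)
  then show ?case by simp
next
  case (Suc k)
  note f = Ck_SucD[OF Suc.prems]
  show ?case by (simp add: pd_translate[OF f(1)] differentiable_translate[OF f(1)] f Suc.IH)
qed

lemma Ck_prod: "finite I \<Longrightarrow> (\<And>i. i \<in> I \<Longrightarrow> Ck k (f i)) \<Longrightarrow> Ck k (\<lambda>x. \<Prod>i\<in>I. f i x)"
  by (induction I rule: finite_induct) (auto simp: Ck_const Ck_mult)

lemma smooth_const: "smooth (\<lambda>x. c)" by (simp add: smooth_def Ck_const)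
lemma smooth_add: "smooth f \<Longrightarrow> smooth g \<Longrightarrow> smooth (\<lambda>x. f x + g x)" by (simp add: smooth_def Ck_add)
lemma smooth_mult: "smooth f \<Longrightarrow> smooth g \<Longrightarrow> smooth (\<lambda>x. f x * g x)" by (simp add: smooth_def Ck_mult)
lemma smooth_diff: "smooth f \<Longrightarrow> smooth g \<Longrightarrow> smooth (\<lambda>x. f x - g x)"
  using smooth_add[of f "\<lambda>x. (-1) * g x"] smooth_mult[OF smooth_const, of g "-1"] by simp
lemma smooth_translate: "smooth f \<Longrightarrow> smooth (\<lambda>x. f (x + v))" by (simp add: smooth_def Ck_translate)
lemma smooth_pd: "smooth f \<Longrightarrow> smooth (pd j f)" unfolding smooth_def by (metis Ck.simps(2))
lemma smooth_differentiable: "smooth f \<Longrightarrow> f differentiable (at x)" unfolding smooth_def by (metis Ck.simps(2))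
lemma smooth_Ck: "smooth f \<Longrightarrow> Ck k f" by (simp add: smooth_def)
lemma smooth_continuous: "smooth f \<Longrightarrow> continuous_on UNIV f" unfolding smooth_def by (metis Ck.simps(1))

lemma smooth_real_polynomial:
  "real_polynomial_function (p :: real^'d::finite \<Rightarrow> real) \<Longrightarrow> smooth p"
  by (induction p rule: real_polynomial_function.induct)
    (auto simp: smooth_const smooth_add smooth_mult Ck_bounded_linear smooth_def Ck_const Ck_add Ck_mult)

text \<open>The derivatives of the function that is \<open>exp (- 1 / t)\<close> for positive \<open>t\<close> and vanishes
  otherwise: they are polynomials in \<open>1 / t\<close> times that function.\<close>

primrec flat_poly :: "nat \<Rightarrow> real poly" where
  "flat_poly 0 = 1"
| "flat_poly (Suc m) = [:0, 0, 1:] * (flat_poly m - pderiv (flat_poly m))"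

definition flat :: "nat \<Rightarrow> real \<Rightarrow> real" where
  "flat m t = (if t \<le> 0 then 0 else poly (flat_poly m) (1 / t) * exp (- (1 / t)))"

lemma tendsto_power_mult_poly_div_exp:
  "((\<lambda>u::real. u ^ k * poly p u * exp (- u)) \<longlongrightarrow> 0) at_top"
proof (induction p arbitrary: k)
  case 0 then show ?case by simp
next
  case (pCons a p)
  have "((\<lambda>u. a * (u ^ k / exp u) + u ^ Suc k * poly p u * exp (- u)) \<longlongrightarrow> a * 0 + 0) at_top"
    by (intro tendsto_intros tendsto_power_div_exp_0 pCons.IH)
  then show ?case by (simp add: algebra_simps exp_minus divide_inverse)
qed

text \<open>At the origin the difference quotient is again a polynomial in \<open>1 / t\<close> times
  \<open>exp (- 1 / t)\<close>, which the exponential forces to zero.\<close>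

lemma flat_has_derivative: "(flat m has_real_derivative flat (Suc m) t) (at t)"
proof -
  consider "t < 0" | "t > 0" | "t = 0" by linarith
  then show ?thesis
  proof cases
    case 1
    have "((\<lambda>_. 0) has_real_derivative flat (Suc m) t) (at t)" using 1 by (simp add: flat_def)
    then show ?thesis
      by (rule DERIV_cong_ev[THEN iffD1, rotated -1])
        (use 1 in \<open>auto simp: flat_def eventually_at_filter intro!: eventually_mono[OF eventually_nhds_in_open[of "{..<0}" t]]\<close>)
  next
    case 2
    have "((\<lambda>t. poly (flat_poly m) (1 / t) * exp (- (1 / t))) has_real_derivative flat (Suc m) t) (at t)"
      using 2 by (auto intro!: derivative_eq_intros simp: flat_def field_simps power2_eq_square)
    then show ?thesis
      by (rule DERIV_cong_ev[THEN iffD1, rotated -1])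
        (use 2 in \<open>auto simp: flat_def eventually_at_filter intro!: eventually_mono[OF eventually_nhds_in_open[of "{0<..}" t]]\<close>)
  next
    case 3
    have "((\<lambda>h. inverse h ^ 1 * poly (flat_poly m) (inverse h) * exp (- inverse h)) \<longlongrightarrow> 0) (at_right (0::real))"
      by (rule filterlim_compose[OF tendsto_power_mult_poly_div_exp filterlim_inverse_at_top_right])
    then have "((\<lambda>h. flat m h / h) \<longlongrightarrow> 0) (at_right 0)"
      by (rule tendsto_cong[THEN iffD1, rotated])
        (auto simp: flat_def eventually_at_filter divide_inverse)
    moreover have "((\<lambda>h. flat m h / h) \<longlongrightarrow> 0) (at_left 0)"
      by (rule tendsto_cong[THEN iffD1, OF _ tendsto_const])
        (auto simp: flat_def eventually_at_filter)
    ultimately show ?thesis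
      using 3 by (auto simp: DERIV_def filterlim_split_at flat_def[of m 0] flat_def[of "Suc m" 0])
  qed
qed

lemma flat_pos: "t > 0 \<Longrightarrow> flat 0 t > 0" and flat_zero: "t \<le> 0 \<Longrightarrow> flat 0 t = 0"
  by (auto simp: flat_def)

lemma flat_nonneg: "flat 0 t \<ge> 0" by (auto simp: flat_def)

text \<open>A smooth function that is positive exactly in the open box.\<close>

definition box_bump :: "real^'d \<Rightarrow> real^'d \<Rightarrow> real^'d::finite \<Rightarrow> real" where
  "box_bump a b x = (\<Prod>i\<in>UNIV. flat 0 (x $ i - a $ i) * flat 0 (b $ i - x $ i))"

text \<open>As \<open>n\<close> grows, these functions increase to the indicator function of the open box.\<close>

definition box_cutoff :: "real^'d \<Rightarrow> real^'d \<Rightarrow> nat \<Rightarrow> real^'d::finite \<Rightarrow> real" where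
  "box_cutoff a b n x = 1 - exp (- real n * box_bump a b x)"

lemma smooth_box_bump:
  fixes a b :: "real^'d::finite"
  shows "smooth (box_bump a b)"
proof -
  have "Ck k (\<lambda>x::real^'d. flat 0 (x $ i - a $ i))" "Ck k (\<lambda>x::real^'d. flat 0 (b $ i - x $ i))" for k i
  proof -
    have [simp]: "Ck k (\<lambda>x::real^'d. x $ i)" by (intro Ck_bounded_linear bounded_linear_vec_nth)
    have "Ck k (\<lambda>x::real^'d. x $ i + (- a $ i))" "Ck k (\<lambda>x::real^'d. b $ i + (-1) * x $ i)"
      by (intro Ck_add Ck_mult Ck_const; simp)+
    then show "Ck k (\<lambda>x::real^'d. flat 0 (x $ i - a $ i))" "Ck k (\<lambda>x::real^'d. flat 0 (b $ i - x $ i))"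
      using Ck_compose_real[of flat, OF flat_has_derivative, of k _ 0] by simp_all
  qed
  then show ?thesis
    unfolding smooth_def box_bump_def[abs_def] by (intro allI Ck_prod Ck_mult) auto
qed

lemma smooth_box_cutoff: "smooth (box_cutoff a b n)"
proof -
  have "smooth (\<lambda>x. - real n * box_bump a b x)"
    by (intro smooth_mult smooth_const smooth_box_bump)
  then have "smooth (\<lambda>x. exp (- real n * box_bump a b x))"
    unfolding smooth_def using Ck_compose_real[of "\<lambda>_. exp"] DERIV_exp by blast
  then show ?thesis
    unfolding box_cutoff_def[abs_def] by (intro smooth_diff smooth_const)
qed

lemma box_bump_nonneg: "box_bump a b x \<ge> 0"
  by (auto simp: box_bump_def intro!: prod_nonneg mult_nonneg_nonneg flat_nonneg)

lemma box_bump_pos: "x \<in> box a b \<Longrightarrow> box_bump a b x > 0"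
  by (auto simp: box_bump_def mem_box_cart intro!: prod_pos mult_pos_pos flat_pos)

lemma box_bump_zero: "x \<notin> box a b \<Longrightarrow> box_bump a b x = 0"
proof -
  assume "x \<notin> box a b"
  then obtain i where "x $ i \<le> a $ i \<or> b $ i \<le> x $ i"
    by (auto simp: mem_box_cart not_less)
  then have "flat 0 (x $ i - a $ i) * flat 0 (b $ i - x $ i) = 0"
    by (auto simp: flat_zero)
  then show ?thesis
    unfolding box_bump_def by (intro prod_zero) auto
qed

lemma box_cutoff_bounds: "0 \<le> box_cutoff a b n x" "box_cutoff a b n x \<le> 1"
  by (auto simp: box_cutoff_def box_bump_nonneg)

lemma box_cutoff_outside: "x \<notin> box a b \<Longrightarrow> box_cutoff a b n x = 0"
  by (simp add: box_cutoff_def box_bump_zero)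

lemma box_cutoff_tendsto: "(\<lambda>n. box_cutoff a b n x) \<longlonglongrightarrow> indicator (box a b) x"
proof (cases "x \<in> box a b")
  case True
  then have "exp (- box_bump a b x) < 1" using box_bump_pos by simp
  then have "(\<lambda>n. 1 - exp (- box_bump a b x) ^ n) \<longlonglongrightarrow> 1 - 0"
    by (intro tendsto_intros LIMSEQ_power_zero) auto
  then show ?thesis using True by (simp add: box_cutoff_def exp_of_nat_mult[symmetric] algebra_simps)
qed (simp add: box_cutoff_outside)

lemma test_fun_smooth_supported:
  assumes "smooth f" "{x. f x \<noteq> 0} \<subseteq> K" "compact K" "K \<subseteq> \<Omega>"
  shows "test_fun \<Omega> f"
proof -
  have "closure {x. f x \<noteq> 0} \<subseteq> K"
    using assms(2,3) by (simp add: closure_minimal compact_imp_closed)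
  then show ?thesis
    unfolding test_fun_def using assms
    by (auto simp: compact_eq_bounded_closed intro: bounded_subset)
qed

lemma test_fun_poly_cutoff:
  assumes "real_polynomial_function p" "cbox a b \<subseteq> \<Omega>"
  shows "test_fun \<Omega> (\<lambda>x. p x * box_cutoff a b n x)"
proof (rule test_fun_smooth_supported[where K = "cbox a b"])
  show "smooth (\<lambda>x. p x * box_cutoff a b n x)"
    by (intro smooth_mult smooth_real_polynomial smooth_box_cutoff assms(1))
  show "{x. p x * box_cutoff a b n x \<noteq> 0} \<subseteq> cbox a b"
    using box_cutoff_outside[of _ a b n] subsetD[OF box_subset_cbox[of a b]] by fastforce
qed (use assms in auto)

lemma test_fun_translate: "test_fun UNIV f \<Longrightarrow> test_fun UNIV (\<lambda>x. f (x + v))"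
proof -
  assume f: "test_fun UNIV f"
  let ?K = "closure {x. f x \<noteq> 0}"
  have "{x. f (x + v) \<noteq> 0} \<subseteq> (\<lambda>x. -v + x) ` ?K"
  proof safe
    fix x assume "f (x + v) \<noteq> 0"
    then have "x + v \<in> ?K" using closure_subset[of "{x. f x \<noteq> 0}"] by auto
    then show "x \<in> (\<lambda>x. -v + x) ` ?K" by (rule image_eqI[rotated]) simp
  qed
  then show ?thesis
    using f unfolding test_fun_def[of UNIV f]
    by (intro test_fun_smooth_supported[where K = "(\<lambda>x. -v + x) ` ?K"] smooth_translate compact_translation)
      blast+
qed

lemma pd_eq_0_outside:
  assumes "x \<notin> closure {x. f x \<noteq> 0}"
  shows "pd j f x = 0"
proof -
  have "((\<lambda>_. 0) has_derivative (\<lambda>_. 0)) (at x)" by simp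
  then have "(f has_derivative (\<lambda>_. 0)) (at x)"
    by (rule has_derivative_transform_within_open[where s = "- closure {x. f x \<noteq> 0}"])
     (use assms closure_subset[of "{x. f x \<noteq> 0}"] in auto)
  then show ?thesis by (rule pd_eqI[THEN trans]) simp
qed


lemma has_derivative_pd:
  assumes "f differentiable (at x)"
  shows "(f has_derivative (\<lambda>v. \<Sum>j\<in>UNIV. v $ j * pd j f x)) (at x)"
proof -
  have f: "(f has_derivative frechet_derivative f (at x)) (at x)"
    using assms by (simp add: frechet_derivative_works)
  then interpret bounded_linear "frechet_derivative f (at x)" by (rule has_derivative_bounded_linear)
  have "frechet_derivative f (at x) v = (\<Sum>j\<in>UNIV. v $ j * pd j f x)" for v
  proof -
    have "frechet_derivative f (at x) v = frechet_derivative f (at x) (\<Sum>j\<in>UNIV. v $ j *\<^sub>R axis j 1)"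
      by (simp add: basis_expansion[of v, unfolded scalar_mult_eq_scaleR])
    then show ?thesis by (simp add: sum scaleR pd_def)
  qed
  with f show ?thesis by (metis (no_types, lifting) ext)
qed

lemma has_real_derivative_along:
  assumes "\<And>x. f differentiable (at x)"
  shows "((\<lambda>t. f (y + t *\<^sub>R v)) has_real_derivative (\<Sum>j\<in>UNIV. v $ j * pd j f (y + t *\<^sub>R v))) (at t)"
proof -
  have "((\<lambda>t. f (y + t *\<^sub>R v)) has_derivative (\<lambda>h. \<Sum>j\<in>UNIV. (h *\<^sub>R v) $ j * pd j f (y + t *\<^sub>R v))) (at t)"
    by (rule has_derivative_compose[OF _ has_derivative_pd[OF assms]])
      (auto intro!: derivative_eq_intros)
  moreover have "(\<lambda>h. \<Sum>j\<in>UNIV. (h *\<^sub>R v) $ j * pd j f (y + t *\<^sub>R v)) =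
      (*) (\<Sum>j\<in>UNIV. v $ j * pd j f (y + t *\<^sub>R v))"
  proof
    fix h
    show "(\<Sum>j\<in>UNIV. (h *\<^sub>R v) $ j * pd j f (y + t *\<^sub>R v)) =
        (\<Sum>j\<in>UNIV. v $ j * pd j f (y + t *\<^sub>R v)) * h"
      unfolding sum_distrib_right by (intro sum.cong) auto
  qed
  ultimately show ?thesis
    by (simp add: has_field_derivative_def)
qed

section \<open>Square-integrable functions\<close>

lemma L2_measurable: "L2 \<Omega> f \<Longrightarrow> f \<in> borel_measurable (lebesgue_on \<Omega>)"
  by (simp add: L2_def)

lemma L2_integrable_square: "L2 \<Omega> f \<Longrightarrow> integrable (lebesgue_on \<Omega>) (\<lambda>x. (f x)\<^sup>2)"
  by (simp add: L2_def)

lemma abs_mult_le_squares: "\<bar>a * b\<bar> \<le> a\<^sup>2 + (b::real)\<^sup>2"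
proof -
  have "0 \<le> (\<bar>a\<bar> - \<bar>b\<bar>)\<^sup>2" by simp
  then have "2 * (\<bar>a\<bar> * \<bar>b\<bar>) \<le> a\<^sup>2 + b\<^sup>2" by (simp add: power2_diff)
  moreover have "0 \<le> \<bar>a\<bar> * \<bar>b\<bar>" by simp
  ultimately show ?thesis unfolding abs_mult by linarith
qed

lemma L2_integrable_mult:
  assumes "L2 \<Omega> f" "L2 \<Omega> g"
  shows "integrable (lebesgue_on \<Omega>) (\<lambda>x. f x * g x)"
proof (rule Bochner_Integration.integrable_bound)
  show "integrable (lebesgue_on \<Omega>) (\<lambda>x. (f x)\<^sup>2 + (g x)\<^sup>2)"
    using assms by (simp add: L2_def)
  show "(\<lambda>x. f x * g x) \<in> borel_measurable (lebesgue_on \<Omega>)"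
    by (intro borel_measurable_times L2_measurable assms)
  show "AE x in lebesgue_on \<Omega>. norm (f x * g x) \<le> norm ((f x)\<^sup>2 + (g x)\<^sup>2)"
    using abs_mult_le_squares by (auto intro: order_trans)
qed

lemma L2_add:
  assumes "L2 \<Omega> f" "L2 \<Omega> g" shows "L2 \<Omega> (\<lambda>x. f x + g x)"
proof -
  have "integrable (lebesgue_on \<Omega>) (\<lambda>x. (f x)\<^sup>2 + 2 * (f x * g x) + (g x)\<^sup>2)"
    using assms L2_integrable_mult[OF assms] by (simp add: L2_def)
  moreover have "(\<lambda>x. f x + g x) \<in> borel_measurable (lebesgue_on \<Omega>)"
    by (intro borel_measurable_add L2_measurable assms)
  ultimately show ?thesis by (simp add: L2_def power2_sum algebra_simps)
qed

lemma L2_cmult: "L2 \<Omega> f \<Longrightarrow> L2 \<Omega> (\<lambda>x. c * f x)"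
  by (auto simp: L2_def power_mult_distrib intro: borel_measurable_times)

lemma L2_divide: "L2 \<Omega> f \<Longrightarrow> L2 \<Omega> (\<lambda>x. f x / c)"
  using L2_cmult[of \<Omega> f "1 / c"] by simp

lemma L2_uminus: "L2 \<Omega> f \<Longrightarrow> L2 \<Omega> (\<lambda>x. - f x)"
  by (simp add: L2_def)

lemma L2_diff: "L2 \<Omega> f \<Longrightarrow> L2 \<Omega> g \<Longrightarrow> L2 \<Omega> (\<lambda>x. f x - g x)"
  using L2_add[of \<Omega> f "\<lambda>x. - g x"] L2_uminus by auto

lemma L2_zero: "L2 \<Omega> (\<lambda>x. 0)" by (simp add: L2_def)

lemma L2_sum: "(\<And>i. i \<in> I \<Longrightarrow> L2 \<Omega> (f i)) \<Longrightarrow> L2 \<Omega> (\<lambda>x. \<Sum>i\<in>I. f i x)"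
  by (induction I rule: infinite_finite_induct) (auto intro: L2_add L2_zero)

lemma L2_Linf_mult:
  assumes "Linf \<Omega> c" "L2 \<Omega> f"
  shows "L2 \<Omega> (\<lambda>x. c x * f x)"
proof -
  from assms obtain K where K: "AE x in lebesgue_on \<Omega>. \<bar>c x\<bar> \<le> K" by (auto simp: Linf_def)
  have m: "(\<lambda>x. c x * f x) \<in> borel_measurable (lebesgue_on \<Omega>)"
    using assms by (auto simp: Linf_def L2_def intro: borel_measurable_times)
  have "integrable (lebesgue_on \<Omega>) (\<lambda>x. (c x * f x)\<^sup>2)"
  proof (rule Bochner_Integration.integrable_bound)
    show "integrable (lebesgue_on \<Omega>) (\<lambda>x. K\<^sup>2 * (f x)\<^sup>2)" using assms by (simp add: L2_def)
    show "(\<lambda>x. (c x * f x)\<^sup>2) \<in> borel_measurable (lebesgue_on \<Omega>)" using m by simp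
    show "AE x in lebesgue_on \<Omega>. norm ((c x * f x)\<^sup>2) \<le> norm (K\<^sup>2 * (f x)\<^sup>2)"
      using K
    proof eventually_elim
      case (elim x)
      have "(c x)\<^sup>2 \<le> K\<^sup>2" using elim by (metis abs_ge_zero power2_abs power_mono)
      then show ?case by (simp add: power_mult_distrib mult_right_mono)
    qed
  qed
  then show ?thesis using m by (simp add: L2_def)
qed

lemma Linf_imp_L2:
  assumes "Linf \<Omega> c" "\<Omega> \<in> lmeasurable"
  shows "L2 \<Omega> c"
proof -
  interpret finite_measure "lebesgue_on \<Omega>" using assms(2) by (rule finite_measure_lebesgue_on)
  have "L2 \<Omega> (\<lambda>x. 1)" by (simp add: L2_def)
  from L2_Linf_mult[OF assms(1) this] show ?thesis by simp
qed

definition L2_norm :: "(real^'d::finite) set \<Rightarrow> (real^'d \<Rightarrow> real) \<Rightarrow> real" where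
  "L2_norm \<Omega> f = sqrt (LINT x|lebesgue_on \<Omega>. (f x)\<^sup>2)"

lemma L2_norm_nonneg [simp]: "L2_norm \<Omega> f \<ge> 0"
  by (simp add: L2_norm_def)

lemma L2_norm_square: "(L2_norm \<Omega> f)\<^sup>2 = (LINT x|lebesgue_on \<Omega>. (f x)\<^sup>2)"
  by (simp add: L2_norm_def)

text \<open>The quadratic polynomial \<open>t \<mapsto> \<integral> (f + t g)\<^sup>2\<close> is nonnegative.\<close>

lemma L2_Cauchy_Schwarz:
  assumes f: "L2 \<Omega> f" and g: "L2 \<Omega> g"
  shows "\<bar>LINT x|lebesgue_on \<Omega>. f x * g x\<bar> \<le> L2_norm \<Omega> f * L2_norm \<Omega> g"
proof -
  define A B C where "A = (LINT x|lebesgue_on \<Omega>. (f x)\<^sup>2)"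
    and "B = (LINT x|lebesgue_on \<Omega>. f x * g x)" and "C = (LINT x|lebesgue_on \<Omega>. (g x)\<^sup>2)"
  have pos: "A + 2 * t * B + t\<^sup>2 * C \<ge> 0" for t
  proof -
    have "0 \<le> (LINT x|lebesgue_on \<Omega>. (f x + t * g x)\<^sup>2)" by simp
    also have "\<dots> = (LINT x|lebesgue_on \<Omega>. (f x)\<^sup>2 + 2 * t * (f x * g x) + t\<^sup>2 * (g x)\<^sup>2)"
      by (simp add: power2_sum power_mult_distrib algebra_simps)
    also have "\<dots> = A + 2 * t * B + t\<^sup>2 * C"
      unfolding A_def B_def C_def
      using f g L2_integrable_mult[OF f g] by (simp add: L2_def)
    finally show ?thesis .
  qed
  have "B\<^sup>2 \<le> A * C"
  proof (cases "C = 0")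
    case True
    have "B = 0"
    proof (rule ccontr)
      assume "B \<noteq> 0"
      then show False using pos[of "- (A + 1) / (2 * B)"] True by (simp add: field_simps)
    qed
    then show ?thesis using True by simp
  next
    case False
    then have "C > 0" by (simp add: C_def less_le)
    then show ?thesis using pos[of "- B / C"] False by (simp add: field_simps power2_eq_square)
  qed
  then have "sqrt (B\<^sup>2) \<le> sqrt (A * C)" by (rule real_sqrt_le_mono)
  then show ?thesis by (simp add: L2_norm_def A_def B_def C_def real_sqrt_mult)
qed

lemma L2_pairing_tendsto:
  assumes "L2 \<Omega> f" "L2 \<Omega> g" "\<And>n. L2 \<Omega> (s n)"
    and "(\<lambda>n. LINT x|lebesgue_on \<Omega>. (f x - s n x)\<^sup>2) \<longlonglongrightarrow> 0"
  shows "(\<lambda>n. LINT x|lebesgue_on \<Omega>. s n x * g x) \<longlonglongrightarrow> (LINT x|lebesgue_on \<Omega>. f x * g x)"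
proof -
  have "(\<lambda>n. LINT x|lebesgue_on \<Omega>. (f x - s n x) * g x) \<longlonglongrightarrow> 0"
  proof (rule Lim_null_comparison)
    have "(\<lambda>n. L2_norm \<Omega> (\<lambda>x. f x - s n x)) \<longlonglongrightarrow> sqrt 0"
      unfolding L2_norm_def by (intro tendsto_real_sqrt assms(4))
    then show "(\<lambda>n. L2_norm \<Omega> (\<lambda>x. f x - s n x) * L2_norm \<Omega> g) \<longlonglongrightarrow> 0"
      by (intro tendsto_mult_left_zero) simp
    show "\<forall>\<^sub>F n in sequentially. norm (LINT x|lebesgue_on \<Omega>. (f x - s n x) * g x)
        \<le> L2_norm \<Omega> (\<lambda>x. f x - s n x) * L2_norm \<Omega> g"
      using L2_Cauchy_Schwarz[OF L2_diff[OF assms(1,3)] assms(2)] by simp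
  qed
  then have "(\<lambda>n. (LINT x|lebesgue_on \<Omega>. f x * g x) - (LINT x|lebesgue_on \<Omega>. (f x - s n x) * g x))
      \<longlonglongrightarrow> (LINT x|lebesgue_on \<Omega>. f x * g x) - 0"
    by (intro tendsto_intros)
  moreover have "(LINT x|lebesgue_on \<Omega>. f x * g x) - (LINT x|lebesgue_on \<Omega>. (f x - s n x) * g x)
      = (LINT x|lebesgue_on \<Omega>. s n x * g x)" for n
    using L2_integrable_mult[OF assms(1,2)] L2_integrable_mult[OF assms(3)[of n] assms(2)]
    by (simp add: left_diff_distrib)
  ultimately show ?thesis by simp
qed

lemma L2_dominated_tendsto:
  fixes w :: "real^'d::finite \<Rightarrow> real"
  assumes "f \<in> borel_measurable (lebesgue_on \<Omega>)" "\<And>n. s n \<in> borel_measurable (lebesgue_on \<Omega>)"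
    and "integrable (lebesgue_on \<Omega>) w"
    and "AE x in lebesgue_on \<Omega>. (\<lambda>n. s n x) \<longlonglongrightarrow> f x"
    and "\<And>n. AE x in lebesgue_on \<Omega>. (f x - s n x)\<^sup>2 \<le> w x"
  shows "(\<lambda>n. LINT x|lebesgue_on \<Omega>. (f x - s n x)\<^sup>2) \<longlonglongrightarrow> 0"
proof -
  have "(\<lambda>n. LINT x|lebesgue_on \<Omega>. (f x - s n x)\<^sup>2) \<longlonglongrightarrow> (LINT x|lebesgue_on \<Omega>. 0)"
  proof (rule integral_dominated_convergence[where w = w])
    show "AE x in lebesgue_on \<Omega>. (\<lambda>n. (f x - s n x)\<^sup>2) \<longlonglongrightarrow> 0"
      using assms(4)
    proof eventually_elim
      case (elim x)
      then have "(\<lambda>n. (f x - s n x)\<^sup>2) \<longlonglongrightarrow> (f x - f x)\<^sup>2" by (intro tendsto_intros)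
      then show ?case by simp
    qed
  qed (use assms in auto)
  then show ?thesis by simp
qed

lemma L2_eq_0_AE:
  assumes "L2 \<Omega> f" "(LINT x|lebesgue_on \<Omega>. (f x)\<^sup>2) = 0"
  shows "AE x in lebesgue_on \<Omega>. f x = 0"
  using integral_nonneg_eq_0_iff_AE[OF L2_integrable_square[OF assms(1)]] assms(2) by simp

lemma square_diff_triangle: "(a - c)\<^sup>2 \<le> 2 * (a - b)\<^sup>2 + 2 * (b - (c::real))\<^sup>2"
proof -
  have "0 \<le> ((a - b) - (b - c))\<^sup>2" by simp
  then show ?thesis by (simp add: power2_eq_square algebra_simps)
qed

lemma L2_dist_triangle:
  assumes "L2 \<Omega> f" "L2 \<Omega> g" "L2 \<Omega> h"
  shows "(LINT x|lebesgue_on \<Omega>. (f x - h x)\<^sup>2)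
     \<le> 2 * (LINT x|lebesgue_on \<Omega>. (f x - g x)\<^sup>2) + 2 * (LINT x|lebesgue_on \<Omega>. (g x - h x)\<^sup>2)"
proof -
  note i = L2_integrable_square[OF L2_diff[OF assms(1,2)]] L2_integrable_square[OF L2_diff[OF assms(2,3)]]
    L2_integrable_square[OF L2_diff[OF assms(1,3)]]
  have "(LINT x|lebesgue_on \<Omega>. (f x - h x)\<^sup>2)
     \<le> (LINT x|lebesgue_on \<Omega>. 2 * (f x - g x)\<^sup>2 + 2 * (g x - h x)\<^sup>2)"
    using i by (intro integral_mono) (auto simp: square_diff_triangle)
  also have "\<dots> = 2 * (LINT x|lebesgue_on \<Omega>. (f x - g x)\<^sup>2) + 2 * (LINT x|lebesgue_on \<Omega>. (g x - h x)\<^sup>2)"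
    using i by simp
  finally show ?thesis .
qed

text \<open>Korn's inequality holds with a constant as soon as the two derivatives in
  \<open>\<partial>\<^sub>j u\<^sub>i \<partial>\<^sub>i u\<^sub>j\<close> may be exchanged under the integral: the mixed products then add up to
  the square of the divergence.\<close>

lemma Korn_if_exchange:
  fixes G :: "'d::finite \<Rightarrow> 'd \<Rightarrow> real^'d \<Rightarrow> real"
  assumes L: "\<And>i j. L2 \<Omega> (G i j)"
    and exchange: "\<And>i j. (LINT y|lebesgue_on \<Omega>. G i j y * G j i y) = (LINT y|lebesgue_on \<Omega>. G i i y * G j j y)"
  shows "(\<Sum>i\<in>UNIV. \<Sum>j\<in>UNIV. LINT y|lebesgue_on \<Omega>. (G i j y)\<^sup>2)
    \<le> (\<Sum>i\<in>UNIV. \<Sum>j\<in>UNIV. LINT y|lebesgue_on \<Omega>. (G i j y + G j i y)\<^sup>2)"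
proof -
  note I = L2_integrable_mult[OF L L]
  have "0 \<le> (LINT y|lebesgue_on \<Omega>. (\<Sum>i\<in>UNIV. G i i y)\<^sup>2)" by simp
  also have "\<dots> = (LINT y|lebesgue_on \<Omega>. (\<Sum>i\<in>UNIV. \<Sum>j\<in>UNIV. G i i y * G j j y))"
    by (simp add: power2_eq_square sum_product)
  also have "\<dots> = (\<Sum>i\<in>UNIV. \<Sum>j\<in>UNIV. LINT y|lebesgue_on \<Omega>. G i j y * G j i y)"
    using I by (simp add: exchange)
  finally have div: "0 \<le> (\<Sum>i\<in>UNIV. \<Sum>j\<in>UNIV. LINT y|lebesgue_on \<Omega>. G i j y * G j i y)" .
  define N where "N = (\<Sum>i\<in>UNIV. \<Sum>j\<in>UNIV. LINT y|lebesgue_on \<Omega>. (G i j y)\<^sup>2)"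
  have N': "(\<Sum>i\<in>UNIV. \<Sum>j\<in>UNIV. LINT y|lebesgue_on \<Omega>. (G j i y)\<^sup>2) = N"
    unfolding N_def by (rule sum.swap)
  have "(LINT y|lebesgue_on \<Omega>. (G i j y + G j i y)\<^sup>2) = (LINT y|lebesgue_on \<Omega>. (G i j y)\<^sup>2)
      + 2 * (LINT y|lebesgue_on \<Omega>. G i j y * G j i y) + (LINT y|lebesgue_on \<Omega>. (G j i y)\<^sup>2)" for i j
  proof -
    have "(LINT y|lebesgue_on \<Omega>. (G i j y + G j i y)\<^sup>2) = (LINT y|lebesgue_on \<Omega>. (G i j y)\<^sup>2
      + 2 * (G i j y * G j i y) + (G j i y)\<^sup>2)"
      by (simp add: power2_sum algebra_simps)
    then show ?thesis using I L2_integrable_square[OF L] by simp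
  qed
  then have "(\<Sum>i\<in>UNIV. \<Sum>j\<in>UNIV. LINT y|lebesgue_on \<Omega>. (G i j y + G j i y)\<^sup>2)
      = N + 2 * (\<Sum>i\<in>UNIV. \<Sum>j\<in>UNIV. LINT y|lebesgue_on \<Omega>. G i j y * G j i y) + N"
    by (simp add: sum.distrib sum_distrib_left[symmetric] N') (simp add: N_def)
  moreover have "0 \<le> N" unfolding N_def by (intro sum_nonneg) simp
  ultimately show ?thesis unfolding N_def[symmetric] using div by linarith
qed

subsection \<open>Translations\<close>

lemma lebesgue_translation:
  fixes v :: "'a::euclidean_space"
  shows "(\<lambda>x. x + v) \<in> lebesgue \<rightarrow>\<^sub>M lebesgue" "distr lebesgue lebesgue (\<lambda>x. x + v) = lebesgue"
proof -
  have eq: "(\<lambda>x. v + (\<Sum>j\<in>Basis. (1 * (x \<bullet> j)) *\<^sub>R j)) = (\<lambda>x::'a. x + v)"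
    by (simp add: euclidean_representation add.commute)
  show "(\<lambda>x. x + v) \<in> lebesgue \<rightarrow>\<^sub>M lebesgue"
    using lebesgue_affine_measurable[of "\<lambda>_. 1" v] unfolding eq by simp
  show "distr lebesgue lebesgue (\<lambda>x. x + v) = lebesgue"
    using lebesgue_affine_euclidean[of "\<lambda>_. 1" v] unfolding eq by (simp add: density_1)
qed

lemma integral_lebesgue_translate:
  fixes f :: "'a::euclidean_space \<Rightarrow> real"
  assumes "f \<in> borel_measurable lebesgue"
  shows "(LINT x|lebesgue. f (x + v)) = (LINT x|lebesgue. f x)"
  using integral_distr[OF lebesgue_translation(1) assms, of v] by (simp add: lebesgue_translation(2))

lemma integrable_lebesgue_translate:
  fixes f :: "'a::euclidean_space \<Rightarrow> real"
  assumes "integrable lebesgue f"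
  shows "integrable lebesgue (\<lambda>x. f (x + v))"
  using integrable_distr[OF lebesgue_translation(1), of v f] assms by (simp add: lebesgue_translation(2))

lemma measurable_lebesgue_translate:
  "f \<in> borel_measurable lebesgue \<Longrightarrow> (\<lambda>x. f (x + v)) \<in> borel_measurable lebesgue"
  by (rule measurable_compose[OF lebesgue_translation(1)])

lemma L2_translate: "L2 UNIV f \<Longrightarrow> L2 UNIV (\<lambda>x. f (x + v))"
  using measurable_lebesgue_translate[of f v] integrable_lebesgue_translate[of "\<lambda>x. (f x)\<^sup>2" v]
  by (auto simp: L2_def lebesgue_on_UNIV_eq)

subsection \<open>Density of test functions and uniqueness of weak derivatives\<close>

lemma continuous_measurable_lebesgue_on:
  "continuous_on UNIV f \<Longrightarrow> f \<in> borel_measurable (lebesgue_on S)" for f :: "real^'d::finite \<Rightarrow> real"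
  by (intro measurable_restrict_space1 measurable_completion) (simp add: borel_measurable_continuous_onI)

lemma L2_continuous_bounded_set:
  fixes f :: "real^'d::finite \<Rightarrow> real"
  assumes "continuous_on UNIV f" "bounded S" "S \<in> sets lebesgue"
  shows "L2 S f"
proof -
  have "compact (f ` closure S)"
    using assms by (intro compact_continuous_image) (auto simp: compact_closure intro: continuous_on_subset)
  then have "bounded (f ` closure S)" by (rule compact_imp_bounded)
  then obtain B where B: "\<And>x. x \<in> closure S \<Longrightarrow> \<bar>f x\<bar> \<le> B"
    unfolding bounded_iff by auto
  have "Linf S f"
    unfolding Linf_def using B subsetD[OF closure_subset[of S]] continuous_measurable_lebesgue_on[OF assms(1)]
    by (auto intro!: exI[of _ B] AE_I2 simp: space_restrict_space)
  then show ?thesis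
    using assms bounded_set_imp_lmeasurable Linf_imp_L2 by blast
qed

lemma L2_restrict_iff:
  assumes "S \<in> sets lebesgue" "S \<subseteq> T" "T \<in> sets lebesgue"
  shows "L2 T (\<lambda>x. if x \<in> S then f x else 0) \<longleftrightarrow> L2 S f"
proof -
  have eq: "(\<lambda>x. (if x \<in> S then f x else 0)\<^sup>2) = (\<lambda>x. if x \<in> S then (f x)\<^sup>2 else 0)" by auto
  have eq2: "(\<lambda>x. if x \<in> T then if x \<in> S then (f x)\<^sup>2 else 0 else 0) = (\<lambda>x. if x \<in> S then (f x)\<^sup>2 else 0)"
    by (rule ext) (use assms(2) in auto)
  show ?thesis
    unfolding L2_def eq borel_measurable_if_lebesgue_on[OF assms(1,3,2)]
    using Lebesgue_Measure.integrable_restrict_UNIV[OF assms(1), of "\<lambda>x. (f x)\<^sup>2"]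
      Lebesgue_Measure.integrable_restrict_UNIV[OF assms(3), of "\<lambda>x. if x \<in> S then (f x)\<^sup>2 else 0"]
    by (simp add: eq2)
qed

lemma L2_subset:
  assumes "L2 T f" "S \<subseteq> T" "S \<in> sets lebesgue" "T \<in> sets lebesgue"
  shows "L2 S f"
proof -
  have "L2 T (\<lambda>x. indicator S x * f x)"
    by (rule L2_Linf_mult[OF _ assms(1)])
      (use assms in \<open>auto simp: Linf_def sets_restrict_space_iff intro!: exI[of _ 1] borel_measurable_indicator
         split: split_indicator\<close>)
  also have "(\<lambda>x. indicator S x * f x) = (\<lambda>x. if x \<in> S then f x else 0)" by auto
  finally show ?thesis using L2_restrict_iff[OF assms(3,2,4)] by simp
qed

definition clamp_real :: "real \<Rightarrow> real \<Rightarrow> real" where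
  "clamp_real k y = max (- k) (min k y)"

text \<open>A bounded measurable function is the limit almost everywhere of continuous functions, which
  may be clamped to the same bound, so that convergence is dominated; the Stone-Weierstrass theorem
  then replaces a continuous function by a polynomial.\<close>

lemma L2_cbox_approx_bounded:
  fixes f :: "real^'d::finite \<Rightarrow> real"
  assumes f: "f \<in> borel_measurable (lebesgue_on (cbox a b))" and k: "\<And>x. \<bar>f x\<bar> \<le> k" and e: "e > 0"
  shows "\<exists>p. real_polynomial_function p \<and> (LINT x|lebesgue_on (cbox a b). (f x - p x)\<^sup>2) < e"
proof -
  let ?M = "lebesgue_on (cbox a b)"
  interpret finite_measure ?M by (rule finite_measure_lebesgue_on) simp
  have f2: "L2 (cbox a b) f"
    using f k by (intro Linf_imp_L2) (auto simp: Linf_def)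
  have "f measurable_on cbox a b"
    using f by (simp add: measurable_on_iff_borel_measurable)
  then obtain N g where N: "negligible N" and g: "\<And>n. continuous_on UNIV (g n)"
    and lim: "\<And>x. x \<notin> N \<Longrightarrow> (\<lambda>n. g n x) \<longlonglongrightarrow> (if x \<in> cbox a b then f x else 0)"
    unfolding measurable_on_def by blast
  define h where "h n x = clamp_real k (g n x)" for n x
  have hc: "continuous_on UNIV (h n)" for n
    unfolding h_def clamp_real_def by (intro continuous_intros g)
  have k0: "k \<ge> 0" using k[of 0] by linarith
  have hb: "\<bar>h n x\<bar> \<le> k" for n x using k0 by (auto simp: h_def clamp_real_def)
  have "(\<lambda>n. LINT x|?M. (f x - h n x)\<^sup>2) \<longlonglongrightarrow> 0"
  proof (rule L2_dominated_tendsto[where w = "\<lambda>_. (2 * k)\<^sup>2"])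
    have "AE x in lebesgue. x \<notin> N"
      using N by (simp add: AE_not_in negligible_iff_null_sets)
    then have "AE x in lebesgue. x \<in> cbox a b \<longrightarrow> (\<lambda>n. h n x) \<longlonglongrightarrow> f x"
    proof eventually_elim
      case (elim x)
      show ?case
      proof
        assume "x \<in> cbox a b"
        then have "(\<lambda>n. h n x) \<longlonglongrightarrow> clamp_real k (f x)"
          unfolding h_def clamp_real_def using lim[OF elim] by (auto intro!: tendsto_intros)
        moreover have "clamp_real k (f x) = f x" using k[of x] by (auto simp: clamp_real_def)
        ultimately show "(\<lambda>n. h n x) \<longlonglongrightarrow> f x" by simp
      qed
    qed
    then show "AE x in ?M. (\<lambda>n. h n x) \<longlonglongrightarrow> f x"
      by (simp add: AE_restrict_space_iff)
    have "(f x - h n x)\<^sup>2 \<le> (2 * k)\<^sup>2" for n x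
      using k[of x] hb[of n x] k0 by (subst abs_le_square_iff[symmetric]) linarith
    then show "AE x in ?M. (f x - h n x)\<^sup>2 \<le> (2 * k)\<^sup>2" for n by simp
  qed (use f continuous_measurable_lebesgue_on[OF hc] in auto)
  then have "\<forall>\<^sub>F n in sequentially. (LINT x|?M. (f x - h n x)\<^sup>2) < e / 4"
    using e by (intro order_tendstoD) auto
  then obtain n where n: "(LINT x|?M. (f x - h n x)\<^sup>2) < e / 4"
    by (auto simp: eventually_sequentially)
  define m where "m = measure lebesgue (cbox a b) + 1"
  have m: "m > 0" by (simp add: m_def add_nonneg_pos)
  define \<delta> where "\<delta> = sqrt (e / (4 * m))"
  have "\<delta> > 0" using e m by (simp add: \<delta>_def)
  with Stone_Weierstrass_real_polynomial_function[of "cbox a b" "h n" \<delta>]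
  obtain p where p: "real_polynomial_function p" "\<And>x. x \<in> cbox a b \<Longrightarrow> \<bar>h n x - p x\<bar> < \<delta>"
    using hc[of n] continuous_on_subset by (metis compact_cbox subset_UNIV)
  have pL: "L2 (cbox a b) p"
    using smooth_continuous[OF smooth_real_polynomial[OF p(1)]] by (intro L2_continuous_bounded_set) auto
  have hL: "L2 (cbox a b) (h n)" using hc by (intro L2_continuous_bounded_set) auto
  have "(LINT x|?M. (h n x - p x)\<^sup>2) \<le> (LINT x|?M. \<delta>\<^sup>2)"
  proof (rule integral_mono_AE)
    show "integrable ?M (\<lambda>x. (h n x - p x)\<^sup>2)" by (intro L2_integrable_square L2_diff hL pL)
    have "(h n x - p x)\<^sup>2 \<le> \<delta>\<^sup>2" if "x \<in> cbox a b" for x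
      using p(2)[OF that] by (intro abs_le_square_iff[THEN iffD1]) auto
    then show "AE x in ?M. (h n x - p x)\<^sup>2 \<le> \<delta>\<^sup>2"
      by (intro AE_I2) (auto simp: space_restrict_space)
  qed simp
  also have "\<dots> = \<delta>\<^sup>2 * measure lebesgue (cbox a b)"
    by (simp add: space_restrict_space measure_restrict_space)
  also have "\<dots> \<le> \<delta>\<^sup>2 * m" by (intro mult_left_mono) (auto simp: m_def)
  also have "\<dots> = e / 4" using e m by (simp add: \<delta>_def)
  finally have "(LINT x|?M. (h n x - p x)\<^sup>2) \<le> e / 4" .
  with n L2_dist_triangle[OF f2 hL pL] e have "(LINT x|?M. (f x - p x)\<^sup>2) < e" by linarith
  with p(1) show ?thesis by blast
qed

lemma L2_cbox_approx_polynomial: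
  fixes f :: "real^'d::finite \<Rightarrow> real"
  assumes f: "L2 (cbox a b) f" and e: "e > 0"
  shows "\<exists>p. real_polynomial_function p \<and> (LINT x|lebesgue_on (cbox a b). (f x - p x)\<^sup>2) < e"
proof -
  let ?M = "lebesgue_on (cbox a b)"
  have m: "(\<lambda>x. clamp_real k (f x)) \<in> borel_measurable ?M" for k
    unfolding clamp_real_def using L2_measurable[OF f] by simp
  have "(\<lambda>n. LINT x|?M. (f x - clamp_real (real n) (f x))\<^sup>2) \<longlonglongrightarrow> 0"
  proof (rule L2_dominated_tendsto[where w = "\<lambda>x. (f x)\<^sup>2"])
    have "(\<lambda>n. clamp_real (real n) y) \<longlonglongrightarrow> y" for y
    proof (rule tendsto_eventually)
      obtain n where "\<bar>y\<bar> \<le> real n" using real_arch_simple by blast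
      then show "\<forall>\<^sub>F n in sequentially. clamp_real (real n) y = y"
        unfolding eventually_sequentially clamp_real_def by (intro exI[of _ n]) auto
    qed
    then show "AE x in ?M. (\<lambda>n. clamp_real (real n) (f x)) \<longlonglongrightarrow> f x" by simp
    have "(y - clamp_real (real n) y)\<^sup>2 \<le> y\<^sup>2" for n y
      by (subst abs_le_square_iff[symmetric]) (auto simp: clamp_real_def)
    then show "AE x in ?M. (f x - clamp_real (real n) (f x))\<^sup>2 \<le> (f x)\<^sup>2" for n by simp
  qed (use f m in \<open>auto simp: L2_def\<close>)
  then have "\<forall>\<^sub>F n in sequentially. (LINT x|?M. (f x - clamp_real (real n) (f x))\<^sup>2) < e / 4"
    using e by (intro order_tendstoD) auto
  then obtain n where n: "(LINT x|?M. (f x - clamp_real (real n) (f x))\<^sup>2) < e / 4"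
    by (auto simp: eventually_sequentially)
  have b: "\<bar>clamp_real (real n) y\<bar> \<le> real n" for y by (auto simp: clamp_real_def)
  from L2_cbox_approx_bounded[OF m[of "real n"] b, of "e / 4"] e obtain p
    where p: "real_polynomial_function p" "(LINT x|?M. (clamp_real (real n) (f x) - p x)\<^sup>2) < e / 4"
    by auto
  have "L2 (cbox a b) p"
    using smooth_continuous[OF smooth_real_polynomial[OF p(1)]] by (intro L2_continuous_bounded_set) auto
  moreover have "L2 (cbox a b) (\<lambda>x. clamp_real (real n) (f x))"
    using m b by (intro Linf_imp_L2) (auto simp: Linf_def)
  ultimately have "(LINT x|?M. (f x - p x)\<^sup>2) < e"
    using L2_dist_triangle[OF f, of "\<lambda>x. clamp_real (real n) (f x)" p] n p(2) e by linarith
  with p(1) show ?thesis by blast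
qed

text \<open>Polynomials become test functions when they are cut off smoothly near the boundary of the
  box. Keeping the support inside the box makes the approximation usable in every open set that
  contains the box.\<close>

lemma L2_cbox_approx_test_fun:
  fixes f :: "real^'d::finite \<Rightarrow> real"
  assumes f: "L2 (cbox a b) f" and sub: "cbox a b \<subseteq> \<Omega>" and e: "e > 0"
  shows "\<exists>\<phi>. test_fun \<Omega> \<phi> \<and> (\<forall>x. x \<notin> cbox a b \<longrightarrow> \<phi> x = 0)
           \<and> (LINT x|lebesgue_on (cbox a b). (f x - \<phi> x)\<^sup>2) < e"
proof -
  let ?M = "lebesgue_on (cbox a b)"
  from L2_cbox_approx_polynomial[OF f, of "e / 4"] e obtain p
    where p: "real_polynomial_function p" "(LINT x|?M. (f x - p x)\<^sup>2) < e / 4" by auto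
  have pc: "continuous_on UNIV p" using smooth_continuous[OF smooth_real_polynomial[OF p(1)]] .
  have pL: "L2 (cbox a b) p" using pc by (intro L2_continuous_bounded_set) auto
  have c: "continuous_on UNIV (\<lambda>x. p x * box_cutoff a b n x)" for n
    by (intro continuous_intros pc smooth_continuous[OF smooth_box_cutoff])
  have "(\<lambda>n. LINT x|?M. (p x - p x * box_cutoff a b n x)\<^sup>2) \<longlonglongrightarrow> 0"
  proof (rule L2_dominated_tendsto[where w = "\<lambda>x. (p x)\<^sup>2"])
    have "AE x in lebesgue. x \<notin> cbox a b - box a b"
      using null_sets_cbox_Diff_box[of a b] by (intro AE_not_in null_sets_completionI)
    then have "AE x in lebesgue. x \<in> cbox a b \<longrightarrow> (\<lambda>n. p x * box_cutoff a b n x) \<longlonglongrightarrow> p x"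
    proof eventually_elim
      case (elim x)
      show ?case
      proof
        assume "x \<in> cbox a b"
        with elim have "x \<in> box a b" by simp
        then have "(\<lambda>n. p x * box_cutoff a b n x) \<longlonglongrightarrow> p x * 1"
          using box_cutoff_tendsto[of a b x] by (intro tendsto_intros) simp
        then show "(\<lambda>n. p x * box_cutoff a b n x) \<longlonglongrightarrow> p x" by simp
      qed
    qed
    then show "AE x in ?M. (\<lambda>n. p x * box_cutoff a b n x) \<longlonglongrightarrow> p x"
      by (simp add: AE_restrict_space_iff)
    have "(p x - p x * box_cutoff a b n x)\<^sup>2 \<le> (p x)\<^sup>2" for n x
    proof -
      have "(p x)\<^sup>2 * (1 - box_cutoff a b n x)\<^sup>2 \<le> (p x)\<^sup>2 * 1"
        using box_cutoff_bounds[of a b n x] by (intro mult_left_mono power_le_one) auto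
      then show ?thesis by (simp add: algebra_simps power2_eq_square)
    qed
    then show "AE x in ?M. (p x - p x * box_cutoff a b n x)\<^sup>2 \<le> (p x)\<^sup>2" for n by simp
  qed (use pL continuous_measurable_lebesgue_on[OF c] in \<open>auto simp: L2_def\<close>)
  then have "\<forall>\<^sub>F n in sequentially. (LINT x|?M. (p x - p x * box_cutoff a b n x)\<^sup>2) < e / 4"
    using e by (intro order_tendstoD) auto
  then obtain n where n: "(LINT x|?M. (p x - p x * box_cutoff a b n x)\<^sup>2) < e / 4"
    by (auto simp: eventually_sequentially)
  have "L2 (cbox a b) (\<lambda>x. p x * box_cutoff a b n x)"
    using c by (intro L2_continuous_bounded_set) auto
  with L2_dist_triangle[OF f pL this] n p(2) e
  have "(LINT x|?M. (f x - p x * box_cutoff a b n x)\<^sup>2) < e" by linarith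
  moreover have "p x * box_cutoff a b n x = 0" if "x \<notin> cbox a b" for x
    using that subsetD[OF box_subset_cbox[of a b], of x] box_cutoff_outside[of x a b n] by auto
  ultimately show ?thesis
    using test_fun_poly_cutoff[OF p(1) sub] by blast
qed

lemma test_fun_continuous: "test_fun \<Omega> \<phi> \<Longrightarrow> continuous_on UNIV \<phi>"
  by (simp add: test_fun_def smooth_continuous)

lemma L2_continuous_compact_support:
  fixes \<phi> :: "real^'d::finite \<Rightarrow> real"
  assumes "continuous_on UNIV \<phi>" "compact K" "\<And>x. x \<notin> K \<Longrightarrow> \<phi> x = 0" "\<Omega> \<in> sets lebesgue"
  shows "L2 \<Omega> \<phi>"
proof -
  have K: "K \<in> sets lebesgue" using assms(2) by (simp add: borel_compact)
  have "L2 K \<phi>" using assms K by (intro L2_continuous_bounded_set) (auto intro: compact_imp_bounded)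
  then have "L2 UNIV (\<lambda>x. if x \<in> K then \<phi> x else 0)" using K by (subst L2_restrict_iff) auto
  also have "(\<lambda>x. if x \<in> K then \<phi> x else 0) = \<phi>" using assms(3) by auto
  finally have "L2 UNIV \<phi>" .
  then show ?thesis by (rule L2_subset) (use assms(4) in auto)
qed

lemma test_fun_L2:
  fixes \<phi> :: "real^'d::finite \<Rightarrow> real"
  assumes "test_fun \<Omega>' \<phi>" "\<Omega> \<in> sets lebesgue"
  shows "L2 \<Omega> \<phi>"
proof (rule L2_continuous_compact_support[where K = "closure {x. \<phi> x \<noteq> 0}"])
  show "\<phi> x = 0" if "x \<notin> closure {x. \<phi> x \<noteq> 0}" for x
    using that closure_subset[of "{x. \<phi> x \<noteq> 0}"] by auto
qed (use assms test_fun_continuous in \<open>auto simp: test_fun_def\<close>)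

lemma test_fun_pd: "test_fun \<Omega> \<phi> \<Longrightarrow> test_fun \<Omega> (pd j \<phi>)"
  using pd_eq_0_outside[of _ \<phi> j]
  by (intro test_fun_smooth_supported[where K = "closure {x. \<phi> x \<noteq> 0}"])
    (auto simp: test_fun_def smooth_pd)

lemma L2_UNIV_approx_test_fun:
  fixes f :: "real^'d::finite \<Rightarrow> real"
  assumes f: "L2 UNIV f" and e: "e > 0"
  shows "\<exists>\<phi>. test_fun UNIV \<phi> \<and> (LINT x|lebesgue. (f x - \<phi> x)\<^sup>2) < e"
proof -
  define K :: "nat \<Rightarrow> (real^'d) set" where "K n = cbox (\<chi> i. - real n) (\<chi> i. real n)" for n
  have fm: "f \<in> borel_measurable lebesgue" using f by (simp add: L2_def lebesgue_on_UNIV_eq)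
  have Km: "K n \<in> sets lebesgue" for n by (simp add: K_def)
  have fK: "L2 UNIV (\<lambda>x. if x \<in> K n then f x else 0)" for n
    using L2_subset[OF f _ Km] by (subst L2_restrict_iff[OF Km]) auto
  have "(\<lambda>n. LINT x|lebesgue_on UNIV. (f x - (if x \<in> K n then f x else 0))\<^sup>2) \<longlonglongrightarrow> 0"
  proof (rule L2_dominated_tendsto[where w = "\<lambda>x. (f x)\<^sup>2"])
    have "(\<lambda>n. if x \<in> K n then f x else 0) \<longlonglongrightarrow> f x" for x
    proof (rule tendsto_eventually)
      obtain n where n: "norm x \<le> real n" using real_arch_simple by blast
      have "x \<in> K m" if "m \<ge> n" for m
      proof -
        have "\<bar>x $ i\<bar> \<le> real m" for i
          using component_le_norm_cart[of x i] n that by linarith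
        then show ?thesis by (auto simp: K_def mem_box_cart abs_le_iff minus_le_iff)
      qed
      then show "\<forall>\<^sub>F n in sequentially. (if x \<in> K n then f x else 0) = f x"
        unfolding eventually_sequentially by (intro exI[of _ n]) auto
    qed
    then show "AE x in lebesgue_on UNIV. (\<lambda>n. if x \<in> K n then f x else 0) \<longlonglongrightarrow> f x" by simp
    show "AE x in lebesgue_on UNIV. (f x - (if x \<in> K n then f x else 0))\<^sup>2 \<le> (f x)\<^sup>2" for n by auto
  qed (use f fK in \<open>auto simp: L2_def\<close>)
  then have "\<forall>\<^sub>F n in sequentially. (LINT x|lebesgue. (f x - (if x \<in> K n then f x else 0))\<^sup>2) < e / 4"
    using e by (intro order_tendstoD) (auto simp: lebesgue_on_UNIV_eq)
  then obtain n where n: "(LINT x|lebesgue. (f x - (if x \<in> K n then f x else 0))\<^sup>2) < e / 4"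
    by (auto simp: eventually_sequentially)
  have "L2 (K n) f" using L2_subset[OF f _ Km] by auto
  from L2_cbox_approx_test_fun[OF this[unfolded K_def], of UNIV "e / 4"] e
  obtain \<phi> where \<phi>: "test_fun UNIV \<phi>" "\<And>x. x \<notin> K n \<Longrightarrow> \<phi> x = 0"
    "(LINT x|lebesgue_on (K n). (f x - \<phi> x)\<^sup>2) < e / 4"
    unfolding K_def by auto
  have "(LINT x|lebesgue. ((if x \<in> K n then f x else 0) - \<phi> x)\<^sup>2)
      = (LINT x|lebesgue. (if x \<in> K n then (f x - \<phi> x)\<^sup>2 else 0))"
    using \<phi>(2) by (intro Bochner_Integration.integral_cong) auto
  also have "\<dots> = (LINT x|lebesgue_on (K n). (f x - \<phi> x)\<^sup>2)"
    by (rule Lebesgue_Measure.integral_restrict_UNIV[OF Km])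
  finally have "(LINT x|lebesgue. ((if x \<in> K n then f x else 0) - \<phi> x)\<^sup>2) < e / 4" using \<phi>(3) by simp
  moreover have "L2 UNIV \<phi>" using test_fun_L2[OF \<phi>(1)] by simp
  ultimately have "(LINT x|lebesgue. (f x - \<phi> x)\<^sup>2) < e"
    using L2_dist_triangle[OF f fK, of \<phi> n] n e by (simp add: lebesgue_on_UNIV_eq)
  with \<phi>(1) show ?thesis by blast
qed

text \<open>On a closed box in \<open>\<Omega>\<close> the function can be approximated by test functions to which it is
  orthogonal, so its square integrates to zero there; countably many such boxes fill \<open>\<Omega>\<close>.\<close>

lemma AE_eq_0_if_orthogonal_to_test_funs:
  fixes g :: "real^'d::finite \<Rightarrow> real"
  assumes \<Omega>: "open \<Omega>" and g: "L2 \<Omega> g"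
    and orth: "\<And>\<phi>. test_fun \<Omega> \<phi> \<Longrightarrow> (LINT x|lebesgue_on \<Omega>. g x * \<phi> x) = 0"
  shows "AE x in lebesgue_on \<Omega>. g x = 0"
proof -
  have \<Omega>m: "\<Omega> \<in> sets lebesgue" using \<Omega> by (simp add: borel_open)
  have box: "AE x in lebesgue_on (cbox a b). g x = 0" if sub: "cbox a b \<subseteq> \<Omega>" for a b
  proof (rule L2_eq_0_AE)
    have gK: "L2 (cbox a b) g" using L2_subset[OF g sub] \<Omega>m by simp
    then show "L2 (cbox a b) g" .
    have "\<exists>\<phi>. test_fun \<Omega> \<phi> \<and> (\<forall>x. x \<notin> cbox a b \<longrightarrow> \<phi> x = 0)
           \<and> (LINT x|lebesgue_on (cbox a b). (g x - \<phi> x)\<^sup>2) < 1 / real (Suc n)" for n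
      by (rule L2_cbox_approx_test_fun[OF gK sub]) simp
    then obtain \<phi> where \<phi>: "test_fun \<Omega> (\<phi> n) \<and> (\<forall>x. x \<notin> cbox a b \<longrightarrow> \<phi> n x = 0)
           \<and> (LINT x|lebesgue_on (cbox a b). (g x - \<phi> n x)\<^sup>2) < 1 / real (Suc n)" for n
      by (rule that[OF someI_ex])
    then have \<phi>: "\<And>n. test_fun \<Omega> (\<phi> n)" "\<And>n x. x \<notin> cbox a b \<Longrightarrow> \<phi> n x = 0"
      "\<And>n. (LINT x|lebesgue_on (cbox a b). (g x - \<phi> n x)\<^sup>2) \<le> 1 / real (Suc n)"
      by (auto simp: less_imp_le)
    have "(\<lambda>n. LINT x|lebesgue_on (cbox a b). (g x - \<phi> n x)\<^sup>2) \<longlonglongrightarrow> 0"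
    proof (rule tendsto_sandwich[OF _ _ tendsto_const LIMSEQ_Suc[OF lim_1_over_n]])
      show "\<forall>\<^sub>F n in sequentially. (LINT x|lebesgue_on (cbox a b). (g x - \<phi> n x)\<^sup>2) \<le> 1 / real (Suc n)"
        using \<phi>(3) by (intro always_eventually) blast
    qed simp
    then have "(\<lambda>n. LINT x|lebesgue_on (cbox a b). \<phi> n x * g x) \<longlonglongrightarrow> (LINT x|lebesgue_on (cbox a b). g x * g x)"
      by (intro L2_pairing_tendsto gK test_fun_L2[OF \<phi>(1)]) auto
    moreover have "(LINT x|lebesgue_on (cbox a b). \<phi> n x * g x) = 0" for n
    proof -
      have "(LINT x|lebesgue_on (cbox a b). \<phi> n x * g x)
          = (LINT x|lebesgue_on \<Omega>. (if x \<in> cbox a b then \<phi> n x * g x else 0))"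
        using sub \<Omega>m by (subst integral_restrict) auto
      also have "\<dots> = (LINT x|lebesgue_on \<Omega>. g x * \<phi> n x)"
        using \<phi>(2) by (intro Bochner_Integration.integral_cong) auto
      finally show ?thesis using orth[OF \<phi>(1)] by simp
    qed
    ultimately show "(LINT x|lebesgue_on (cbox a b). (g x)\<^sup>2) = 0"
      by (simp add: power2_eq_square LIMSEQ_const_iff)
  qed
  obtain \<D> where \<D>: "countable \<D>" "\<D> \<subseteq> Pow \<Omega>" "\<And>X. X \<in> \<D> \<Longrightarrow> \<exists>a b. X = cbox a b" "\<Union>\<D> = \<Omega>"
    using open_countable_Union_open_cbox[OF \<Omega>] by metis
  have "AE x in lebesgue. x \<in> X \<longrightarrow> g x = 0" if "X \<in> \<D>" for X
  proof -
    obtain a b where X: "X = cbox a b" using \<D>(3)[OF \<open>X \<in> \<D>\<close>] by blast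
    with box[of a b] that \<D>(2) show ?thesis by (auto simp: AE_restrict_space_iff)
  qed
  then have "AE x in lebesgue. \<forall>X\<in>\<D>. x \<in> X \<longrightarrow> g x = 0"
    by (subst AE_ball_countable[OF \<D>(1)]) blast
  then have "AE x in lebesgue. x \<in> \<Omega> \<longrightarrow> g x = 0"
    by eventually_elim (use \<D>(4) in blast)
  then show ?thesis using \<Omega>m by (simp add: AE_restrict_space_iff)
qed

lemma has_weak_pd_unique:
  assumes "open \<Omega>" "has_weak_pd \<Omega> j f g" "has_weak_pd \<Omega> j f g'"
  shows "AE x in lebesgue_on \<Omega>. g x = g' x"
proof -
  have L: "L2 \<Omega> g" "L2 \<Omega> g'" using assms by (auto simp: has_weak_pd_def)
  have m: "\<Omega> \<in> sets lebesgue" using assms(1) by (simp add: borel_open)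
  have "AE x in lebesgue_on \<Omega>. g x - g' x = 0"
  proof (rule AE_eq_0_if_orthogonal_to_test_funs[OF assms(1) L2_diff[OF L]])
    fix \<phi> assume \<phi>: "test_fun \<Omega> \<phi>"
    then have "(LINT x|lebesgue_on \<Omega>. g x * \<phi> x) = (LINT x|lebesgue_on \<Omega>. g' x * \<phi> x)"
      using assms(2,3) by (auto simp: has_weak_pd_def)
    then show "(LINT x|lebesgue_on \<Omega>. (g x - g' x) * \<phi> x) = 0"
      using L2_integrable_mult[OF L(1) test_fun_L2[OF \<phi> m]] L2_integrable_mult[OF L(2) test_fun_L2[OF \<phi> m]]
      by (simp add: left_diff_distrib)
  qed
  then show ?thesis by simp
qed

lemma has_weak_pd_L2: "has_weak_pd \<Omega> j f g \<Longrightarrow> L2 \<Omega> f" "has_weak_pd \<Omega> j f g \<Longrightarrow> L2 \<Omega> g"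
  by (auto simp: has_weak_pd_def)

lemma has_weak_pd_wpd: "has_weak_pd \<Omega> j f g \<Longrightarrow> has_weak_pd \<Omega> j f (wpd \<Omega> j f)"
  unfolding wpd_def by (rule someI[of "has_weak_pd \<Omega> j f"])

lemma has_weak_pd_add:
  assumes "\<Omega> \<in> sets lebesgue" "has_weak_pd \<Omega> j f g" "has_weak_pd \<Omega> j f' g'"
  shows "has_weak_pd \<Omega> j (\<lambda>x. f x + f' x) (\<lambda>x. g x + g' x)"
proof -
  have L: "L2 \<Omega> f" "L2 \<Omega> g" "L2 \<Omega> f'" "L2 \<Omega> g'" using assms by (auto simp: has_weak_pd_def)
  show ?thesis
    unfolding has_weak_pd_def
  proof (intro conjI allI impI L2_add L)
    fix \<phi> assume \<phi>: "test_fun \<Omega> \<phi>"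
    note T = test_fun_L2[OF \<phi> assms(1)] test_fun_L2[OF test_fun_pd[OF \<phi>] assms(1)]
    show "(LINT x|lebesgue_on \<Omega>. (f x + f' x) * pd j \<phi> x) = - (LINT x|lebesgue_on \<Omega>. (g x + g' x) * \<phi> x)"
      using assms(2,3) \<phi> L T
      by (simp add: distrib_right L2_integrable_mult has_weak_pd_def)
  qed
qed

lemma has_weak_pd_cmult:
  assumes "has_weak_pd \<Omega> j f g"
  shows "has_weak_pd \<Omega> j (\<lambda>x. c * f x) (\<lambda>x. c * g x)"
  using assms by (auto simp: has_weak_pd_def L2_cmult mult.assoc)

lemma has_weak_pd_diff:
  assumes "\<Omega> \<in> sets lebesgue" "has_weak_pd \<Omega> j f g" "has_weak_pd \<Omega> j f' g'"
  shows "has_weak_pd \<Omega> j (\<lambda>x. f x - f' x) (\<lambda>x. g x - g' x)"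
  using has_weak_pd_add[OF assms(1,2) has_weak_pd_cmult[OF assms(3), of "-1"]] by simp

lemma AE_wpd_eq:
  assumes "open \<Omega>" "has_weak_pd \<Omega> j f g"
  shows "AE x in lebesgue_on \<Omega>. wpd \<Omega> j f x = g x"
  using has_weak_pd_unique[OF assms(1) has_weak_pd_wpd[OF assms(2)] assms(2)] .

section \<open>Differentiation under the integral sign\<close>

lemma integrable_bounded_mult:
  fixes c b :: "'a \<Rightarrow> real"
  assumes "c \<in> borel_measurable M" "\<And>x. x \<in> space M \<Longrightarrow> \<bar>c x\<bar> \<le> B" "integrable M b"
  shows "integrable M (\<lambda>x. c x * b x)"
proof (rule Bochner_Integration.integrable_bound)
  show "integrable M (\<lambda>x. B * b x)" using assms(3) by simp
  show "(\<lambda>x. c x * b x) \<in> borel_measurable M"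
    by (rule borel_measurable_times[OF assms(1) borel_measurable_integrable[OF assms(3)]])
  show "AE x in M. norm (c x * b x) \<le> norm (B * b x)"
  proof (rule AE_I2)
    fix x assume "x \<in> space M"
    from assms(2)[OF this] show "norm (c x * b x) \<le> norm (B * b x)"
      by (simp add: abs_mult mult_right_mono)
  qed
qed

text \<open>The difference quotients are dominated, by the mean value theorem and compactness.\<close>

lemma DERIV_integral_translate:
  fixes f b :: "real^'d::finite \<Rightarrow> real"
  assumes f: "Ck (Suc 0) f" and S: "bounded S" "S \<in> sets lebesgue" and b: "integrable (lebesgue_on S) b"
  shows "((\<lambda>t. LINT y|lebesgue_on S. f (y + t *\<^sub>R v) * b y) has_real_derivative
      (LINT y|lebesgue_on S. (\<Sum>j\<in>UNIV. v $ j * pd j f (y + t0 *\<^sub>R v)) * b y)) (at t0)"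
proof -
  let ?M = "lebesgue_on S"
  define Df where "Df x = (\<Sum>j\<in>UNIV. v $ j * pd j f x)" for x
  have fd: "f differentiable (at x)" for x using f by simp
  have fc: "continuous_on UNIV f" using Ck_Suc_imp_Ck[OF f] by simp
  have Dc: "continuous_on UNIV Df"
    unfolding Df_def using f by (auto intro!: continuous_intros)
  have sh: "continuous_on UNIV (\<lambda>y. h (y + t *\<^sub>R v))" if "continuous_on UNIV h" for h :: "real^'d \<Rightarrow> real" and t
    by (rule continuous_on_compose2[OF that]) (auto intro!: continuous_intros)
  have bound: "\<exists>B. \<forall>y\<in>S. \<forall>t\<in>cball t0 R. \<bar>h (y + t *\<^sub>R v)\<bar> \<le> B" if "continuous_on UNIV h"
    for h :: "real^'d \<Rightarrow> real" and R
  proof -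
    have "compact ((\<lambda>(y, t). h (y + t *\<^sub>R v)) ` (closure S \<times> cball t0 R))"
      using S by (intro compact_continuous_image compact_Times)
        (auto simp: compact_closure split_beta' intro!: continuous_on_compose2[OF that] continuous_intros)
    then have "bounded ((\<lambda>(y, t). h (y + t *\<^sub>R v)) ` (closure S \<times> cball t0 R))" by (rule compact_imp_bounded)
    then obtain B where "\<forall>z\<in>(\<lambda>(y, t). h (y + t *\<^sub>R v)) ` (closure S \<times> cball t0 R). norm z \<le> B"
      unfolding bounded_iff by blast
    then have B: "\<bar>z\<bar> \<le> B" if "z \<in> (\<lambda>(y, t). h (y + t *\<^sub>R v)) ` (closure S \<times> cball t0 R)" for z
      using that by (metis real_norm_def)
    have "\<bar>h (y + t *\<^sub>R v)\<bar> \<le> B" if "y \<in> S" "t \<in> cball t0 R" for y t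
      by (rule B, rule image_eqI[of _ _ "(y, t)"]) (use that subsetD[OF closure_subset[of S]] in auto)
    then show ?thesis by blast
  qed
  have int: "integrable ?M (\<lambda>y. f (y + t *\<^sub>R v) * b y)" for t
  proof -
    obtain B where B: "\<forall>y\<in>S. \<forall>s\<in>cball t0 \<bar>t - t0\<bar>. \<bar>f (y + s *\<^sub>R v)\<bar> \<le> B"
      using bound[OF fc] by blast
    show ?thesis
      by (rule integrable_bounded_mult[where B = B])
       (use B b sh[OF fc] in \<open>auto simp: space_restrict_space dist_real_def abs_minus_commute
          intro: continuous_measurable_lebesgue_on\<close>)
  qed
  have "((\<lambda>h. ((LINT y|?M. f (y + (t0 + h) *\<^sub>R v) * b y) - (LINT y|?M. f (y + t0 *\<^sub>R v) * b y)) / h)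
      \<longlongrightarrow> (LINT y|?M. Df (y + t0 *\<^sub>R v) * b y)) (at 0)"
    unfolding tendsto_at_iff_sequentially o_def
  proof (intro allI impI)
    fix X :: "nat \<Rightarrow> real" assume X: "\<forall>i. X i \<in> UNIV - {0}" "X \<longlonglongrightarrow> 0"
    define q where "q i y = (f (y + (t0 + X i) *\<^sub>R v) - f (y + t0 *\<^sub>R v)) / X i" for i y
    from X(2) have "Bseq X" by (rule convergent_imp_Bseq[OF convergentI])
    then obtain R where R: "\<And>i. \<bar>X i\<bar> \<le> R" unfolding Bseq_def by auto
    obtain B where B: "\<forall>y\<in>S. \<forall>t\<in>cball t0 R. \<bar>Df (y + t *\<^sub>R v)\<bar> \<le> B" using bound[OF Dc] by blast
    have qb: "\<bar>q i y\<bar> \<le> B" if "y \<in> S" for i y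
    proof -
      have "norm (f (y + (t0 + X i) *\<^sub>R v) - f (y + t0 *\<^sub>R v)) \<le> B * norm ((t0 + X i) - t0)"
      proof (rule field_differentiable_bound[where S = "cball t0 R" and f' = "\<lambda>t. Df (y + t *\<^sub>R v)"])
        show "((\<lambda>t. f (y + t *\<^sub>R v)) has_field_derivative Df (y + z *\<^sub>R v)) (at z within cball t0 R)" for z
          using has_real_derivative_along[OF fd, of y v z] unfolding Df_def
          by (rule has_field_derivative_at_within)
        have "R \<ge> 0" using R[of 0] by linarith
        then show "t0 + X i \<in> cball t0 R" "t0 \<in> cball t0 R" using R[of i] by (auto simp: dist_real_def)
      qed (use B that in auto)
      then show ?thesis using X(1) by (simp add: q_def abs_divide divide_le_eq)
    qed
    have qm: "q i \<in> borel_measurable ?M" for i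
      unfolding q_def using X(1) by (intro continuous_measurable_lebesgue_on continuous_intros sh[OF fc]) auto
    have eq: "((LINT y|?M. f (y + (t0 + X i) *\<^sub>R v) * b y) - (LINT y|?M. f (y + t0 *\<^sub>R v) * b y)) / X i
        = (LINT y|?M. q i y * b y)" for i
    proof -
      have "(LINT y|?M. q i y * b y) = (LINT y|?M. (f (y + (t0 + X i) *\<^sub>R v) * b y - f (y + t0 *\<^sub>R v) * b y) / X i)"
        by (simp add: q_def left_diff_distrib)
      then show ?thesis using int[of "t0 + X i"] int[of t0] by (simp add: Bochner_Integration.integral_diff)
    qed
    show "(\<lambda>i. ((LINT y|?M. f (y + (t0 + X i) *\<^sub>R v) * b y) - (LINT y|?M. f (y + t0 *\<^sub>R v) * b y)) / X i)
        \<longlonglongrightarrow> (LINT y|?M. Df (y + t0 *\<^sub>R v) * b y)"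
      unfolding eq
    proof (rule integral_dominated_convergence[where w = "\<lambda>y. \<bar>B\<bar> * \<bar>b y\<bar>"])
      show "(\<lambda>y. Df (y + t0 *\<^sub>R v) * b y) \<in> borel_measurable ?M"
        by (rule borel_measurable_times[OF continuous_measurable_lebesgue_on[OF sh[OF Dc]] borel_measurable_integrable[OF b]])
      show "(\<lambda>y. q i y * b y) \<in> borel_measurable ?M" for i
        by (rule borel_measurable_times[OF qm borel_measurable_integrable[OF b]])
      show "integrable ?M (\<lambda>y. \<bar>B\<bar> * \<bar>b y\<bar>)" using b by simp
      have "(\<lambda>i. q i y) \<longlonglongrightarrow> Df (y + t0 *\<^sub>R v)" for y
      proof -
        have "((\<lambda>h. (f (y + (t0 + h) *\<^sub>R v) - f (y + t0 *\<^sub>R v)) / h) \<longlongrightarrow> Df (y + t0 *\<^sub>R v)) (at 0)"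
          using has_real_derivative_along[OF fd, of y v t0] unfolding Df_def DERIV_def .
        then show ?thesis unfolding tendsto_at_iff_sequentially o_def q_def using X by blast
      qed
      then show "AE y in ?M. (\<lambda>i. q i y * b y) \<longlonglongrightarrow> Df (y + t0 *\<^sub>R v) * b y"
        by (intro AE_I2 tendsto_intros)
      show "AE y in ?M. norm (q i y * b y) \<le> \<bar>B\<bar> * \<bar>b y\<bar>" for i
      proof (rule AE_I2)
        fix y assume "y \<in> space ?M"
        then have "\<bar>q i y\<bar> \<le> \<bar>B\<bar>" using qb[of y i] by (simp add: space_restrict_space)
        then show "norm (q i y * b y) \<le> \<bar>B\<bar> * \<bar>b y\<bar>" by (simp add: abs_mult mult_right_mono)
      qed
    qed
  qed
  then show ?thesis unfolding DERIV_def Df_def .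
qed

lemma sum_axis: "(\<Sum>j\<in>UNIV. axis i (1::real) $ j * h j) = h i"
  by (simp add: axis_def if_distrib[of "\<lambda>c. c * _"] sum.delta cong: if_cong)

text \<open>The integral of a translate does not depend on the translation, and its derivative with
  respect to the translation is the integral of the derivative.\<close>

lemma integral_pd_eq_0:
  fixes \<psi> :: "real^'d::finite \<Rightarrow> real"
  assumes \<psi>: "Ck (Suc 0) \<psi>" and K: "compact K" and out: "\<And>x. x \<notin> K \<Longrightarrow> \<psi> x = 0"
  shows "(LINT x|lebesgue. pd j \<psi> x) = 0"
proof -
  obtain R where R: "\<And>x. x \<in> K \<Longrightarrow> norm x \<le> R"
    using compact_imp_bounded[OF K] unfolding bounded_iff by blast
  let ?e = "axis j (1::real) :: real^'d"
  define S :: "(real^'d) set" where "S = cball 0 (R + 1)"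
  have S: "bounded S" "S \<in> sets lebesgue" by (auto simp: S_def)
  interpret finite_measure "lebesgue_on S" by (rule finite_measure_lebesgue_on) (simp add: S_def)
  have pc: "continuous_on UNIV \<psi>" using Ck_Suc_imp_Ck[OF \<psi>] by simp
  have m: "\<psi> \<in> borel_measurable lebesgue"
    using continuous_measurable_lebesgue_on[OF pc, of UNIV] by (simp add: lebesgue_on_UNIV_eq)
  have const: "(LINT y|lebesgue_on S. \<psi> (y + t *\<^sub>R ?e) * 1) = (LINT y|lebesgue. \<psi> y)" if t: "\<bar>t\<bar> < 1" for t
  proof -
    have z: "\<psi> (y + t *\<^sub>R ?e) = 0" if "y \<notin> S" for y
    proof (rule out, rule notI)
      assume "y + t *\<^sub>R ?e \<in> K"
      then have "norm (y + t *\<^sub>R ?e) \<le> R" by (rule R)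
      moreover have "norm y \<le> norm (y + t *\<^sub>R ?e) + norm (t *\<^sub>R ?e)"
        using norm_triangle_ineq4[of "y + t *\<^sub>R ?e" "t *\<^sub>R ?e"] by simp
      ultimately have "norm y \<le> R + 1" using t by simp
      then show False using that by (simp add: S_def)
    qed
    have "(LINT y|lebesgue_on S. \<psi> (y + t *\<^sub>R ?e)) = (LINT y|lebesgue. (if y \<in> S then \<psi> (y + t *\<^sub>R ?e) else 0))"
      by (rule Lebesgue_Measure.integral_restrict_UNIV[OF S(2), symmetric])
    also have "\<dots> = (LINT y|lebesgue. \<psi> (y + t *\<^sub>R ?e))"
      using z by (intro Bochner_Integration.integral_cong) auto
    also have "\<dots> = (LINT y|lebesgue. \<psi> y)" by (rule integral_lebesgue_translate[OF m])
    finally show ?thesis by simp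
  qed
  have "((\<lambda>t. LINT y|lebesgue_on S. \<psi> (y + t *\<^sub>R ?e) * 1) has_real_derivative 0) (at 0)"
  proof (rule DERIV_cong_ev[THEN iffD2, OF refl _ refl])
    show "\<forall>\<^sub>F t in nhds 0. (LINT y|lebesgue_on S. \<psi> (y + t *\<^sub>R ?e) * 1) = (LINT y|lebesgue. \<psi> y)"
      using eventually_nhds_in_open[of "ball 0 1" "0::real"] const by (auto elim!: eventually_mono)
  qed simp
  moreover have "((\<lambda>t. LINT y|lebesgue_on S. \<psi> (y + t *\<^sub>R ?e) * 1) has_real_derivative
      (LINT y|lebesgue_on S. (\<Sum>i\<in>UNIV. ?e $ i * pd i \<psi> (y + 0 *\<^sub>R ?e)) * 1)) (at 0)"
    by (rule DERIV_integral_translate[OF \<psi> S]) simp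
  ultimately have "(LINT y|lebesgue_on S. (\<Sum>i\<in>UNIV. ?e $ i * pd i \<psi> (y + 0 *\<^sub>R ?e)) * 1) = 0"
    using DERIV_unique by blast
  then have "(LINT y|lebesgue_on S. pd j \<psi> y) = 0" by (simp add: sum_axis)
  moreover have pd0: "pd j \<psi> y = 0" if "y \<notin> S" for y
  proof (rule pd_eq_0_outside)
    have "{x. \<psi> x \<noteq> 0} \<subseteq> cball 0 (R + 1)" using out R by (force intro: add_increasing2)
    then have "closure {x. \<psi> x \<noteq> 0} \<subseteq> S" unfolding S_def by (simp add: closure_minimal)
    then show "y \<notin> closure {x. \<psi> x \<noteq> 0}" using that by blast
  qed
  have "(\<lambda>y. if y \<in> S then pd j \<psi> y else 0) = pd j \<psi>" using pd0 by auto

  ultimately show ?thesis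
    using Lebesgue_Measure.integral_restrict_UNIV[OF S(2), of "pd j \<psi>"] by simp
qed

text \<open>Integration by parts: a classical derivative is a weak one.\<close>

lemma has_weak_pd_classical:
  assumes f: "Ck (Suc 0) f" and L: "L2 \<Omega> f" "L2 \<Omega> (pd j f)" and \<Omega>: "\<Omega> \<in> sets lebesgue"
  shows "has_weak_pd \<Omega> j f (pd j f)"
  unfolding has_weak_pd_def
proof (intro conjI L allI impI)
  fix \<phi> assume \<phi>: "test_fun \<Omega> \<phi>"
  let ?K = "closure {x. \<phi> x \<noteq> 0}"
  have \<phi>1: "Ck (Suc 0) \<phi>" and K: "compact ?K" "?K \<subseteq> \<Omega>" using \<phi> by (auto simp: test_fun_def smooth_def)
  have out: "\<phi> x = 0" "pd j \<phi> x = 0" if "x \<notin> ?K" for x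
    using that subsetD[OF closure_subset[of "{x. \<phi> x \<noteq> 0}"], of x] pd_eq_0_outside[OF that] by auto
  note fd = Ck_SucD(1)[OF f] and \<phi>d = Ck_SucD(1)[OF \<phi>1]
  note T = test_fun_L2[OF \<phi> \<Omega>] test_fun_L2[OF test_fun_pd[OF \<phi>] \<Omega>]
  have "(LINT x|lebesgue. pd j (\<lambda>x. f x * \<phi> x) x) = 0"
  proof (rule integral_pd_eq_0[OF Ck_mult[OF f \<phi>1] K(1)])
    fix x assume "x \<notin> ?K"
    from out(1)[OF this] show "f x * \<phi> x = 0" by simp
  qed
  moreover have "pd j (\<lambda>x. f x * \<phi> x) = (\<lambda>x. if x \<in> \<Omega> then pd j f x * \<phi> x + f x * pd j \<phi> x else 0)"
  proof
    fix x show "pd j (\<lambda>x. f x * \<phi> x) x = (if x \<in> \<Omega> then pd j f x * \<phi> x + f x * pd j \<phi> x else 0)"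
    proof (cases "x \<in> \<Omega>")
      case False
      then have "x \<notin> ?K" using K(2) by blast
      from out(1)[OF this] out(2)[OF this] False show ?thesis unfolding pd_mult[OF fd \<phi>d] by simp
    qed (simp add: pd_mult[OF fd \<phi>d])
  qed
  ultimately have "0 = (LINT x|lebesgue. (if x \<in> \<Omega> then pd j f x * \<phi> x + f x * pd j \<phi> x else 0))"
    by simp
  also have "\<dots> = (LINT x|lebesgue_on \<Omega>. pd j f x * \<phi> x + f x * pd j \<phi> x)"
    by (rule Lebesgue_Measure.integral_restrict_UNIV[OF \<Omega>])
  also have "\<dots> = (LINT x|lebesgue_on \<Omega>. pd j f x * \<phi> x) + (LINT x|lebesgue_on \<Omega>. f x * pd j \<phi> x)"
    by (intro Bochner_Integration.integral_add L2_integrable_mult L T)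
  finally show "(LINT x|lebesgue_on \<Omega>. f x * pd j \<phi> x) = - (LINT x|lebesgue_on \<Omega>. pd j f x * \<phi> x)"
    by linarith
qed

section \<open>Weak derivatives on the whole space\<close>

lemma has_weak_pd_test_fun: "test_fun UNIV \<phi> \<Longrightarrow> has_weak_pd UNIV j \<phi> (pd j \<phi>)"
  by (intro has_weak_pd_classical test_fun_L2 test_fun_pd) (auto simp: test_fun_def smooth_def)

lemma L2_norm_translate:
  assumes "L2 UNIV f"
  shows "L2_norm UNIV (\<lambda>x. f (x + v)) = L2_norm UNIV f"
  using integral_lebesgue_translate[OF borel_measurable_integrable[OF L2_integrable_square[OF assms, unfolded lebesgue_on_UNIV_eq]], of v]
  by (simp add: L2_norm_def lebesgue_on_UNIV_eq)

lemma LINT_translate_mult: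
  assumes "L2 UNIV f" "L2 UNIV g"
  shows "(LINT x|lebesgue. f (x + v) * g (x + w)) = (LINT x|lebesgue. f (x + (v - w)) * g x)"
proof -
  have "(\<lambda>x. f (x + (v - w)) * g x) \<in> borel_measurable lebesgue"
    using assms by (intro borel_measurable_times measurable_lebesgue_translate) (auto simp: L2_def lebesgue_on_UNIV_eq)
  from integral_lebesgue_translate[OF this, of w] show ?thesis by (simp add: algebra_simps)
qed

text \<open>Against a test function, translations and the derivative can be moved to the test function,
  where differentiation under the integral sign applies.\<close>

lemma DERIV_pairing_test_fun:
  fixes f g :: "real^'d::finite \<Rightarrow> real"
  assumes fg: "has_weak_pd UNIV j f g" and \<phi>: "test_fun UNIV \<phi>"
  shows "((\<lambda>t. LINT x|lebesgue. f (x + t *\<^sub>R axis j 1) * \<phi> x) has_real_derivative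
      (LINT x|lebesgue. g (x + t0 *\<^sub>R axis j 1) * \<phi> x)) (at t0)"
proof -
  let ?e = "axis j (1::real) :: real^'d"
  note L = has_weak_pd_L2[OF fg] and \<phi>L = test_fun_L2[OF \<phi>, of UNIV, simplified]
  have \<phi>1: "Ck (Suc 0) \<phi>" using \<phi> by (simp add: test_fun_def smooth_def)
  let ?K = "closure {x. \<phi> x \<noteq> 0}"
  have "bounded ?K" using \<phi> by (auto simp: test_fun_def intro: compact_imp_bounded)
  then obtain R where R: "\<And>x. x \<in> ?K \<Longrightarrow> norm x \<le> R" unfolding bounded_iff by blast
  have out: "\<phi> x = 0" "pd j \<phi> x = 0" if "x \<notin> ?K" for x
    using that subsetD[OF closure_subset[of "{x. \<phi> x \<noteq> 0}"], of x] pd_eq_0_outside[OF that] by auto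
  define S :: "(real^'d) set" where "S = cball 0 (R + \<bar>t0\<bar> + 1)"
  have S: "bounded S" "S \<in> sets lebesgue" by (auto simp: S_def)
  interpret finite_measure "lebesgue_on S" by (rule finite_measure_lebesgue_on) (simp add: S_def)
  have "L2 S f" using L2_subset[OF L(1) _ S(2)] by auto
  moreover have "L2 S (\<lambda>_. 1)" by (simp add: L2_def)
  ultimately have fS: "integrable (lebesgue_on S) f" using L2_integrable_mult by fastforce
  have outS: "y + t *\<^sub>R (- ?e) \<notin> ?K" if "\<bar>t - t0\<bar> < 1" "y \<notin> S" for t y
  proof
    assume "y + t *\<^sub>R (- ?e) \<in> ?K"
    then have "norm (y + t *\<^sub>R (- ?e)) \<le> R" by (rule R)
    moreover have "norm y \<le> norm (y + t *\<^sub>R (- ?e)) + norm (t *\<^sub>R (- ?e))"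
      using norm_triangle_ineq4[of "y + t *\<^sub>R (- ?e)" "t *\<^sub>R (- ?e)"] by simp
    ultimately have "norm y \<le> R + \<bar>t\<bar>" by simp
    then show False using that by (simp add: S_def)
  qed
  have restrict: "(LINT y|lebesgue_on S. h (y + t *\<^sub>R (- ?e)) * f y) = (LINT y|lebesgue. f y * h (y + t *\<^sub>R (- ?e)))"
    if "\<bar>t - t0\<bar> < 1" "\<And>x. x \<notin> ?K \<Longrightarrow> h x = 0" for t h
  proof -
    have "(LINT y|lebesgue_on S. h (y + t *\<^sub>R (- ?e)) * f y)
        = (LINT y|lebesgue. (if y \<in> S then h (y + t *\<^sub>R (- ?e)) * f y else 0))"
      by (rule Lebesgue_Measure.integral_restrict_UNIV[OF S(2), symmetric])
    also have "\<dots> = (LINT y|lebesgue. f y * h (y + t *\<^sub>R (- ?e)))"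
    proof (rule Bochner_Integration.integral_cong[OF refl])
      fix y show "(if y \<in> S then h (y + t *\<^sub>R (- ?e)) * f y else 0) = f y * h (y + t *\<^sub>R (- ?e))"
        using that(2)[OF outS[OF that(1)], of y] by auto
    qed
    finally show ?thesis .
  qed
  have "((\<lambda>t. LINT y|lebesgue_on S. \<phi> (y + t *\<^sub>R (- ?e)) * f y) has_real_derivative
      (LINT y|lebesgue_on S. (\<Sum>i\<in>UNIV. (- ?e) $ i * pd i \<phi> (y + t0 *\<^sub>R (- ?e))) * f y)) (at t0)"
    by (rule DERIV_integral_translate[OF \<phi>1 S fS])
  also have "(LINT y|lebesgue_on S. (\<Sum>i\<in>UNIV. (- ?e) $ i * pd i \<phi> (y + t0 *\<^sub>R (- ?e))) * f y)
      = - (LINT y|lebesgue_on S. pd j \<phi> (y + t0 *\<^sub>R (- ?e)) * f y)"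
    by (simp add: sum_negf sum_axis)
  also have "\<dots> = - (LINT y|lebesgue. f y * pd j \<phi> (y + t0 *\<^sub>R (- ?e)))"
    using restrict[of t0 "pd j \<phi>", OF _ out(2)] by simp
  also have "(LINT y|lebesgue. f y * pd j \<phi> (y + t0 *\<^sub>R (- ?e)))
      = - (LINT y|lebesgue. g y * \<phi> (y + t0 *\<^sub>R (- ?e)))"
    using fg[unfolded has_weak_pd_def lebesgue_on_UNIV_eq, THEN conjunct2, THEN conjunct2, rule_format,
        OF test_fun_translate[OF \<phi>], of "t0 *\<^sub>R (- ?e)"]
    unfolding pd_translate[OF Ck_SucD(1)[OF \<phi>1]] .
  also have "(LINT y|lebesgue. g y * \<phi> (y + t0 *\<^sub>R (- ?e))) = (LINT x|lebesgue. g (x + t0 *\<^sub>R ?e) * \<phi> x)"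
    using LINT_translate_mult[OF L(2) \<phi>L, of 0 "t0 *\<^sub>R (- ?e)"] by simp
  finally have D: "((\<lambda>t. LINT y|lebesgue_on S. \<phi> (y + t *\<^sub>R (- ?e)) * f y) has_real_derivative
      (LINT x|lebesgue. g (x + t0 *\<^sub>R ?e) * \<phi> x)) (at t0)" by simp
  show ?thesis
  proof (rule DERIV_cong_ev[THEN iffD1, OF refl _ refl D])
    have "(LINT y|lebesgue_on S. \<phi> (y + t *\<^sub>R (- ?e)) * f y) = (LINT x|lebesgue. f (x + t *\<^sub>R ?e) * \<phi> x)"
      if "\<bar>t - t0\<bar> < 1" for t
      using restrict[of t \<phi>, OF that out(1)] LINT_translate_mult[OF L(1) \<phi>L, of 0 "t *\<^sub>R (- ?e)"] by simp
    then show "\<forall>\<^sub>F t in nhds t0. (LINT y|lebesgue_on S. \<phi> (y + t *\<^sub>R (- ?e)) * f y)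
        = (LINT x|lebesgue. f (x + t *\<^sub>R ?e) * \<phi> x)"
      using eventually_nhds_in_open[of "ball t0 1" t0]
      by (auto elim!: eventually_mono simp: dist_real_def abs_minus_commute)
  qed
qed

lemma L2_UNIV_test_fun_sequence:
  assumes "L2 UNIV f"
  obtains \<phi> where "\<And>n. test_fun UNIV (\<phi> n)" "(\<lambda>n. LINT x|lebesgue. (f x - \<phi> n x)\<^sup>2) \<longlonglongrightarrow> 0"
proof -
  have "\<exists>\<phi>. test_fun UNIV \<phi> \<and> (LINT x|lebesgue. (f x - \<phi> x)\<^sup>2) < 1 / real (Suc n)" for n
    by (rule L2_UNIV_approx_test_fun[OF assms]) simp
  then obtain \<phi> where \<phi>: "test_fun UNIV (\<phi> n) \<and> (LINT x|lebesgue. (f x - \<phi> n x)\<^sup>2) < 1 / real (Suc n)" for n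
    by (rule that[OF someI_ex])
  have "(\<lambda>n. LINT x|lebesgue. (f x - \<phi> n x)\<^sup>2) \<longlonglongrightarrow> 0"
  proof (rule tendsto_sandwich[OF _ _ tendsto_const LIMSEQ_Suc[OF lim_1_over_n]])
    show "\<forall>\<^sub>F n in sequentially. (LINT x|lebesgue. (f x - \<phi> n x)\<^sup>2) \<le> 1 / real (Suc n)"
      using \<phi> by (intro always_eventually) (blast intro: less_imp_le)
  qed simp
  with \<phi> that show ?thesis by blast
qed

text \<open>A bound for difference quotients that is uniform in the increment lets the previous lemma
  pass from test functions to their \<open>L\<^sup>2\<close> closure. The factor 2 is not sharp; it comes from a crude
  triangle inequality for squares.\<close>

lemma pairing_difference_bound:
  fixes f g :: "real^'d::finite \<Rightarrow> real"
  assumes fg: "has_weak_pd UNIV j f g" and b: "L2 UNIV b"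
  shows "\<bar>LINT x|lebesgue. (f (x + t *\<^sub>R axis j 1) - f x) * b x\<bar> \<le> \<bar>t\<bar> * (2 * L2_norm UNIV g * L2_norm UNIV b)"
proof -
  let ?e = "axis j (1::real) :: real^'d"
  note L = has_weak_pd_L2[OF fg]
  have Ld: "L2 UNIV (\<lambda>x. f (x + t *\<^sub>R ?e) - f x)" by (intro L2_diff L2_translate L)
  obtain \<phi> where \<phi>: "\<And>n. test_fun UNIV (\<phi> n)" and lim: "(\<lambda>n. LINT x|lebesgue. (b x - \<phi> n x)\<^sup>2) \<longlonglongrightarrow> 0"
    using L2_UNIV_test_fun_sequence[OF b] by blast
  have \<phi>L: "L2 UNIV (\<phi> n)" for n using test_fun_L2[OF \<phi>] by simp
  have test: "\<bar>LINT x|lebesgue. (f (x + t *\<^sub>R ?e) - f x) * \<phi> n x\<bar> \<le> \<bar>t\<bar> * (L2_norm UNIV g * L2_norm UNIV (\<phi> n))" for n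
  proof -
    define F where "F t = (LINT x|lebesgue. f (x + t *\<^sub>R ?e) * \<phi> n x)" for t
    have "norm (F t - F 0) \<le> (L2_norm UNIV g * L2_norm UNIV (\<phi> n)) * norm (t - 0)"
    proof (rule field_differentiable_bound[where S = UNIV and f' = "\<lambda>t. LINT x|lebesgue. g (x + t *\<^sub>R ?e) * \<phi> n x"])
      show "(F has_field_derivative (LINT x|lebesgue. g (x + z *\<^sub>R ?e) * \<phi> n x)) (at z within UNIV)" for z
        unfolding F_def using DERIV_pairing_test_fun[OF fg \<phi>] by simp
      show "norm (LINT x|lebesgue. g (x + z *\<^sub>R ?e) * \<phi> n x) \<le> L2_norm UNIV g * L2_norm UNIV (\<phi> n)" for z
        using L2_Cauchy_Schwarz[OF L2_translate[OF L(2)] \<phi>L, of "z *\<^sub>R ?e" n]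
        by (simp add: L2_norm_translate[OF L(2)] lebesgue_on_UNIV_eq)
    qed auto
    moreover have "F t - F 0 = (LINT x|lebesgue. (f (x + t *\<^sub>R ?e) - f x) * \<phi> n x)"
      using L2_integrable_mult[OF L2_translate[OF L(1)] \<phi>L, of "t *\<^sub>R ?e" n] L2_integrable_mult[OF L(1) \<phi>L, of n]
      by (simp add: F_def left_diff_distrib lebesgue_on_UNIV_eq)
    ultimately show ?thesis by (simp add: mult.commute)
  qed
  have norm: "L2_norm UNIV (\<phi> n) \<le> sqrt (2 * (LINT x|lebesgue. (b x - \<phi> n x)\<^sup>2) + 2 * (LINT x|lebesgue. (b x)\<^sup>2))" for n
    using L2_dist_triangle[OF \<phi>L[of n] b L2_zero] unfolding L2_norm_def
    by (intro real_sqrt_le_mono) (simp add: lebesgue_on_UNIV_eq power2_commute[of "\<phi> n _"])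
  have "\<bar>LINT x|lebesgue. (f (x + t *\<^sub>R ?e) - f x) * b x\<bar>
      \<le> \<bar>t\<bar> * (L2_norm UNIV g * sqrt (2 * 0 + 2 * (LINT x|lebesgue. (b x)\<^sup>2)))"
  proof (rule LIMSEQ_le)
    show "(\<lambda>n. \<bar>LINT x|lebesgue. (f (x + t *\<^sub>R ?e) - f x) * \<phi> n x\<bar>) \<longlonglongrightarrow> \<bar>LINT x|lebesgue. (f (x + t *\<^sub>R ?e) - f x) * b x\<bar>"
      using L2_pairing_tendsto[OF b Ld \<phi>L] lim
      by (intro tendsto_rabs) (simp add: lebesgue_on_UNIV_eq mult.commute)
    show "(\<lambda>n. \<bar>t\<bar> * (L2_norm UNIV g * sqrt (2 * (LINT x|lebesgue. (b x - \<phi> n x)\<^sup>2) + 2 * (LINT x|lebesgue. (b x)\<^sup>2))))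
      \<longlonglongrightarrow> \<bar>t\<bar> * (L2_norm UNIV g * sqrt (2 * 0 + 2 * (LINT x|lebesgue. (b x)\<^sup>2)))"
      by (intro tendsto_intros lim)
    show "\<exists>N. \<forall>n\<ge>N. \<bar>LINT x|lebesgue. (f (x + t *\<^sub>R ?e) - f x) * \<phi> n x\<bar>
        \<le> \<bar>t\<bar> * (L2_norm UNIV g * sqrt (2 * (LINT x|lebesgue. (b x - \<phi> n x)\<^sup>2) + 2 * (LINT x|lebesgue. (b x)\<^sup>2)))"
      by (intro exI allI impI order_trans[OF test] mult_left_mono norm) auto
  qed
  also have "\<dots> = \<bar>t\<bar> * (L2_norm UNIV g * (sqrt 2 * L2_norm UNIV b))"
    by (simp add: L2_norm_def real_sqrt_mult lebesgue_on_UNIV_eq)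
  also have "\<dots> \<le> \<bar>t\<bar> * (L2_norm UNIV g * (2 * L2_norm UNIV b))"
    using sqrt2_less_2 by (intro mult_left_mono mult_right_mono) auto
  finally show ?thesis by (simp add: mult_ac)
qed

text \<open>The difference quotients of a function with a square-integrable weak derivative converge to
  it weakly in \<open>L\<^sup>2\<close>.\<close>

lemma DERIV_pairing:
  fixes f g :: "real^'d::finite \<Rightarrow> real"
  assumes fg: "has_weak_pd UNIV j f g" and b: "L2 UNIV b"
  shows "((\<lambda>t. LINT x|lebesgue. f (x + t *\<^sub>R axis j 1) * b x) has_real_derivative (LINT x|lebesgue. g x * b x)) (at 0)"
proof -
  let ?e = "axis j (1::real) :: real^'d"
  note L = has_weak_pd_L2[OF fg]
  define q where "q c t = (LINT x|lebesgue. (f (x + t *\<^sub>R ?e) - f x) * c x) / t" for c t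
  have split: "(LINT x|lebesgue. f (x + t *\<^sub>R ?e) * c x) - (LINT x|lebesgue. f x * c x)
      = (LINT x|lebesgue. (f (x + t *\<^sub>R ?e) - f x) * c x)" if c: "L2 UNIV c" for c t
    using L2_integrable_mult[OF L2_translate[OF L(1)] c, of "t *\<^sub>R ?e"] L2_integrable_mult[OF L(1) c]
    by (simp add: left_diff_distrib lebesgue_on_UNIV_eq)
  have "(q b \<longlongrightarrow> (LINT x|lebesgue. g x * b x)) (at 0)"
  proof (rule tendstoI)
    fix e :: real assume e: "e > 0"
    \<comment> \<open>3 = 2 + 1 from \<open>pairing_difference_bound\<close> and the Cauchy-Schwarz inequality;
      \<open>g\<close> may vanish, hence the summand 1\<close>
    define d where "d = e / (2 * (3 * (L2_norm UNIV g + 1)))"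
    have g1: "L2_norm UNIV g + 1 > 0" using L2_norm_nonneg[of UNIV g] by linarith
    then have d: "d > 0" using e by (simp add: d_def)
    then obtain \<phi> where \<phi>: "test_fun UNIV \<phi>" and close: "(LINT x|lebesgue. (b x - \<phi> x)\<^sup>2) < d\<^sup>2"
      using L2_UNIV_approx_test_fun[OF b, of "d\<^sup>2"] by auto
    have \<phi>L: "L2 UNIV \<phi>" using test_fun_L2[OF \<phi>] by simp
    have r: "L2 UNIV (\<lambda>x. b x - \<phi> x)" by (intro L2_diff b \<phi>L)
    have "L2_norm UNIV (\<lambda>x. b x - \<phi> x) < sqrt (d\<^sup>2)"
      unfolding L2_norm_def using close by (simp only: lebesgue_on_UNIV_eq real_sqrt_less_iff)
    then have rd: "L2_norm UNIV (\<lambda>x. b x - \<phi> x) < d" using d by simp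
    have small: "3 * L2_norm UNIV g * L2_norm UNIV (\<lambda>x. b x - \<phi> x) \<le> e / 2"
    proof -
      have "3 * L2_norm UNIV g * L2_norm UNIV (\<lambda>x. b x - \<phi> x) \<le> 3 * (L2_norm UNIV g + 1) * d"
        using rd g1 by (intro mult_mono) auto
      also have "\<dots> = e / 2" using g1 by (simp add: d_def field_simps)
      finally show ?thesis .
    qed
    have "(q \<phi> \<longlongrightarrow> (LINT x|lebesgue. g x * \<phi> x)) (at 0)"
      using DERIV_pairing_test_fun[OF fg \<phi>, of 0] split[OF \<phi>L] unfolding DERIV_def q_def by simp
    then have "\<forall>\<^sub>F t in at 0. dist (q \<phi> t) (LINT x|lebesgue. g x * \<phi> x) < e / 2"
      using e by (intro tendstoD) auto
    moreover have "\<forall>\<^sub>F t in at (0::real). t \<noteq> 0" by (simp add: eventually_at_filter)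
    ultimately show "\<forall>\<^sub>F t in at 0. dist (q b t) (LINT x|lebesgue. g x * b x) < e"
    proof eventually_elim
      case (elim t)
      have "L2 UNIV (\<lambda>x. f (x + t *\<^sub>R ?e) - f x)" by (intro L2_diff L2_translate L)
      note i = L2_integrable_mult[OF this \<phi>L, unfolded lebesgue_on_UNIV_eq]
        L2_integrable_mult[OF this b, unfolded lebesgue_on_UNIV_eq]
      have 1: "q b t - q \<phi> t = q (\<lambda>x. b x - \<phi> x) t"
        using i by (simp add: q_def diff_divide_distrib right_diff_distrib)
      have 2: "(LINT x|lebesgue. g x * b x) - (LINT x|lebesgue. g x * \<phi> x) = (LINT x|lebesgue. g x * (b x - \<phi> x))"
        using L2_integrable_mult[OF L(2) \<phi>L] L2_integrable_mult[OF L(2) b]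
        by (simp add: right_diff_distrib lebesgue_on_UNIV_eq)
      have "\<bar>q (\<lambda>x. b x - \<phi> x) t\<bar> \<le> 2 * L2_norm UNIV g * L2_norm UNIV (\<lambda>x. b x - \<phi> x)"
        using pairing_difference_bound[OF fg r, of t] elim(2)
        by (simp add: q_def abs_divide divide_le_eq mult.commute)
      moreover have "\<bar>LINT x|lebesgue. g x * (b x - \<phi> x)\<bar> \<le> L2_norm UNIV g * L2_norm UNIV (\<lambda>x. b x - \<phi> x)"
        using L2_Cauchy_Schwarz[OF L(2) r] by (simp add: lebesgue_on_UNIV_eq)
      ultimately show ?case using 1 2 elim(1) small unfolding dist_real_def by linarith
    qed
  qed
  then show ?thesis unfolding DERIV_def q_def using split[OF b] by simp
qed

text \<open>In the exchange of the two derivatives no second derivative occurs: the identity holds for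
  differences, by translation invariance of the integral, and passes to the limit in one increment
  after the other.\<close>

lemma LINT_weak_pd_exchange:
  fixes a b :: "real^'d::finite \<Rightarrow> real"
  assumes a: "has_weak_pd UNIV i a ai" "has_weak_pd UNIV j a aj"
    and b: "has_weak_pd UNIV i b bi" "has_weak_pd UNIV j b bj"
  shows "(LINT x|lebesgue. aj x * bi x) = (LINT x|lebesgue. ai x * bj x)"
proof -
  note L = has_weak_pd_L2[OF a(1)] has_weak_pd_L2[OF a(2)] has_weak_pd_L2[OF b(1)] has_weak_pd_L2[OF b(2)]
  let ?ei = "axis i (1::real) :: real^'d" and ?ej = "axis j (1::real) :: real^'d"
  have I: "integrable lebesgue (\<lambda>x. f (x + v) * g (x + w))" if "L2 UNIV f" "L2 UNIV g" for f g :: "real^'d \<Rightarrow> real" and v w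
    using L2_integrable_mult[OF L2_translate[OF that(1)] L2_translate[OF that(2)]] by (simp add: lebesgue_on_UNIV_eq)
  have I0: "integrable lebesgue (\<lambda>x. f x * g (x + w))" "integrable lebesgue (\<lambda>x. f (x + w) * g x)"
    "integrable lebesgue (\<lambda>x. f x * g x)"
    if "L2 UNIV f" "L2 UNIV g" for f g :: "real^'d \<Rightarrow> real" and v w
    using I[OF that, of 0 w] I[OF that, of w 0] I[OF that, of 0 0] by simp_all
  \<comment> \<open>expanded, both sides consist of four integrals, which agree in pairs after translations; on
    the left \<open>a\<close> is shifted by \<open>v\<close> and \<open>b\<close> by \<open>w\<close>, on the right \<open>b\<close> by \<open>- v\<close> and \<open>a\<close> by \<open>- w\<close>\<close>
  have step: "(LINT x|lebesgue. a (x + v) * (b (x + w) - b x)) - (LINT x|lebesgue. a x * (b (x + w) - b x))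
      = (LINT x|lebesgue. b (x - v) * (a (x - w) - a x)) - (LINT x|lebesgue. b x * (a (x - w) - a x))" for v w
  proof -
    have J: "integrable lebesgue (\<lambda>x. f x * g (x - w))" "integrable lebesgue (\<lambda>x. f (x - w) * g x)"
      "integrable lebesgue (\<lambda>x. f (x - v) * g (x - w))"
      if "L2 UNIV f" "L2 UNIV g" for f g :: "real^'d \<Rightarrow> real" and v w
      using I[OF that, of "-v" "-w"] I[OF that, of "-w" 0] I[OF that, of 0 "-w"] by simp_all
    have "(LINT x|lebesgue. b (x - v) * a (x - w)) = (LINT x|lebesgue. a (x + v) * b (x + w))"
      using LINT_translate_mult[OF L(5,1), of "-v" "-w"] LINT_translate_mult[OF L(5,1), of w v]
      by (simp add: mult.commute algebra_simps)
    moreover have "(LINT x|lebesgue. b (x - v) * a x) = (LINT x|lebesgue. a (x + v) * b x)"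
      using LINT_translate_mult[OF L(5,1), of "-v" 0] LINT_translate_mult[OF L(5,1), of 0 v]
      by (simp add: mult.commute)
    moreover have "(LINT x|lebesgue. b x * a (x - w)) = (LINT x|lebesgue. a x * b (x + w))"
      using LINT_translate_mult[OF L(5,1), of 0 "-w"] LINT_translate_mult[OF L(5,1), of w 0]
      by (simp add: mult.commute)
    ultimately show ?thesis
      using I[OF L(1,5)] I0[OF L(1,5)] J[OF L(5,1)] I0[OF L(5,1)]
      by (simp add: right_diff_distrib mult.commute)
  qed
  \<comment> \<open>the derivative with respect to \<open>v = s e\<^sub>j\<close> at \<open>s = 0\<close>, for a fixed increment \<open>w = t e\<^sub>i\<close>\<close>
  have exch: "(LINT x|lebesgue. aj x * (b (x + t *\<^sub>R ?ei) - b x)) = - (LINT x|lebesgue. bj x * (a (x - t *\<^sub>R ?ei) - a x))" for t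
  proof -
    have La: "L2 UNIV (\<lambda>x. a (x - t *\<^sub>R ?ei) - a x)"
      using L2_diff[OF L2_translate[OF L(1), of "- (t *\<^sub>R ?ei)"] L(1)] by simp
    have Lb: "L2 UNIV (\<lambda>x. b (x + t *\<^sub>R ?ei) - b x)" by (intro L2_diff L2_translate L)
    have "((\<lambda>s. (LINT x|lebesgue. a (x + s *\<^sub>R ?ej) * (b (x + t *\<^sub>R ?ei) - b x)) - (LINT x|lebesgue. a x * (b (x + t *\<^sub>R ?ei) - b x)))
      has_real_derivative (LINT x|lebesgue. aj x * (b (x + t *\<^sub>R ?ei) - b x)) - 0) (at 0)"
      by (intro derivative_intros DERIV_pairing a Lb)
    moreover have "((\<lambda>s. (LINT x|lebesgue. b (x - s *\<^sub>R ?ej) * (a (x - t *\<^sub>R ?ei) - a x)) - (LINT x|lebesgue. b x * (a (x - t *\<^sub>R ?ei) - a x)))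
      has_real_derivative (- (LINT x|lebesgue. bj x * (a (x - t *\<^sub>R ?ei) - a x))) - 0) (at 0)"
      using DERIV_pairing[OF b(2) La] DERIV_mirror[of "\<lambda>s. LINT x|lebesgue. b (x + s *\<^sub>R ?ej) * (a (x - t *\<^sub>R ?ei) - a x)" _ 0]
      by (intro derivative_intros) simp
    ultimately show ?thesis unfolding step using DERIV_unique by fastforce
  qed
  have eq: "(LINT x|lebesgue. b (x + t *\<^sub>R ?ei) * aj x) - (LINT x|lebesgue. b x * aj x)
      = - ((LINT x|lebesgue. a (x - t *\<^sub>R ?ei) * bj x) - (LINT x|lebesgue. a x * bj x))" for t
  proof -
    have "integrable lebesgue (\<lambda>x. a (x - t *\<^sub>R ?ei) * bj x)" using I0(2)[OF L(1,8), of "- (t *\<^sub>R ?ei)"] by simp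
    then show ?thesis
      using I0[OF L(5,4)] I0[OF L(1,8)] exch[of t]
      by (simp add: right_diff_distrib mult.commute)
  qed
  have "((\<lambda>t. (LINT x|lebesgue. b (x + t *\<^sub>R ?ei) * aj x) - (LINT x|lebesgue. b x * aj x))
      has_real_derivative (LINT x|lebesgue. bi x * aj x) - 0) (at 0)"
    by (intro derivative_intros DERIV_pairing b L)
  moreover have "((\<lambda>t. - ((LINT x|lebesgue. a (x - t *\<^sub>R ?ei) * bj x) - (LINT x|lebesgue. a x * bj x)))
      has_real_derivative - (- (LINT x|lebesgue. ai x * bj x) - 0)) (at 0)"
    using DERIV_pairing[OF a(1) L(8)] DERIV_mirror[of "\<lambda>s. LINT x|lebesgue. a (x + s *\<^sub>R ?ei) * bj x" _ 0]
    by (intro derivative_intros) simp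
  ultimately show ?thesis unfolding eq using DERIV_unique by (fastforce simp: mult.commute)
qed

text \<open>The exchange identity with a test function as the second factor.\<close>

lemma weak_pd_commute:
  fixes f :: "real^'d::finite \<Rightarrow> real"
  assumes "has_weak_pd UNIV j f fj" "has_weak_pd UNIV n f fn"
    and "has_weak_pd UNIV n fj fjn" "has_weak_pd UNIV j fn fnj"
  shows "AE x in lebesgue. fjn x = fnj x"
proof -
  note L = has_weak_pd_L2[OF assms(3)] has_weak_pd_L2[OF assms(4)]
  have "AE x in lebesgue_on UNIV. fjn x - fnj x = 0"
  proof (rule AE_eq_0_if_orthogonal_to_test_funs[OF open_UNIV L2_diff[OF L(2,4)]])
    fix \<phi> :: "real^'d \<Rightarrow> real" assume \<phi>: "test_fun UNIV \<phi>"
    have \<phi>L: "L2 UNIV \<phi>" using test_fun_L2[OF \<phi>] by simp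
    have "(LINT x|lebesgue. fj x * pd n \<phi> x) = (LINT x|lebesgue. fn x * pd j \<phi> x)"
      by (rule LINT_weak_pd_exchange[OF assms(2,1) has_weak_pd_test_fun[OF \<phi>] has_weak_pd_test_fun[OF \<phi>]])
    then have "(LINT x|lebesgue. fjn x * \<phi> x) = (LINT x|lebesgue. fnj x * \<phi> x)"
      using assms(3,4) \<phi> by (simp add: has_weak_pd_def lebesgue_on_UNIV_eq)
    then show "(LINT x|lebesgue_on UNIV. (fjn x - fnj x) * \<phi> x) = 0"
      using L2_integrable_mult[OF L(2) \<phi>L] L2_integrable_mult[OF L(4) \<phi>L]
      by (simp add: left_diff_distrib lebesgue_on_UNIV_eq)
  qed
  then show ?thesis unfolding lebesgue_on_UNIV_eq by simp
qed

section \<open>Periodic functions on a periodicity cell\<close>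

lemma nn_integral_lebesgue_translate:
  fixes f :: "'a::euclidean_space \<Rightarrow> ennreal"
  assumes "f \<in> borel_measurable lebesgue"
  shows "(\<integral>\<^sup>+x. f (x + v) \<partial>lebesgue) = (\<integral>\<^sup>+x. f x \<partial>lebesgue)"
  using nn_integral_distr[OF lebesgue_translation(1)[of v], of f] assms
  by (simp add: lebesgue_translation(2))

locale periodic_cell =
  fixes M :: "('d::finite) cell_data"
  assumes periodicity_cell: "periodicity_cell M"
begin

abbreviation Y :: "(real^'d) set" where "Y \<equiv> cell M"

lemma Y_open: "open Y" and Y_bounded: "bounded Y"
  and Y_frontier: "frontier Y \<in> null_sets lebesgue"
  and Y_disjoint: "\<And>V V'. V \<in> lattice M \<Longrightarrow> V' \<in> lattice M \<Longrightarrow> V \<noteq> V' \<Longrightarrow> (+) V ` Y \<inter> (+) V' ` Y = {}"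
  and Y_cover: "(\<Union>V\<in>lattice M. closure ((+) V ` Y)) = UNIV"
  using periodicity_cell by (auto simp: periodicity_cell_def)

lemma Y_sets [simp]: "Y \<in> sets lebesgue"
  using Y_open by (simp add: borel_open)

lemma Y_lmeasurable: "Y \<in> lmeasurable"
  using Y_open Y_bounded by (simp add: lmeasurable_open)

sublocale Yfin: finite_measure "lebesgue_on Y"
  by (rule finite_measure_lebesgue_on[OF Y_lmeasurable])

lemma measure_Y_pos: "measure lebesgue Y > 0"
proof -
  have "Y \<noteq> {}" using Y_cover by auto
  then have "\<not> negligible Y" using Y_open open_not_negligible by blast
  then have "measure lebesgue Y \<noteq> 0"
    using Y_lmeasurable by (simp add: negligible_iff_measure)
  then show ?thesis by (simp add: less_le)
qed

lemma lattice_uminus: "V \<in> lattice M \<Longrightarrow> - V \<in> lattice M"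
proof -
  assume "V \<in> lattice M"
  then obtain n where "V = (\<Sum>i\<in>UNIV. of_int (n i) *\<^sub>R basis M i)" by (auto simp: lattice_def)
  then have "- V = (\<Sum>i\<in>UNIV. of_int (- n i) *\<^sub>R basis M i)" by (simp add: sum_negf)
  then show ?thesis
    unfolding lattice_def by (rule range_eqI[where x = "\<lambda>i. - n i"])
qed

lemma countable_lattice: "countable (lattice M)"
  by (simp add: lattice_def)

lemma AE_lattice_cover: "AE x in lebesgue. \<exists>V\<in>lattice M. x \<in> (+) V ` Y"
proof -
  have "negligible (\<Union>V\<in>lattice M. (+) V ` frontier Y)"
    using Y_frontier countable_lattice
    by (intro negligible_countable_Union) (auto simp: negligible_iff_null_sets[symmetric] intro!: negligible_translation)
  then have "AE x in lebesgue. x \<notin> (\<Union>V\<in>lattice M. (+) V ` frontier Y)"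
    by (intro AE_not_in) (simp add: negligible_iff_null_sets)
  then show ?thesis
  proof eventually_elim
    case (elim x)
    obtain V where V: "V \<in> lattice M" "x \<in> closure ((+) V ` Y)" using Y_cover by blast
    then obtain y where y: "y \<in> closure Y" "x = V + y" by (auto simp: closure_translation)
    then have "y \<in> Y" using elim V(1) Y_open by (auto simp: frontier_def interior_open)
    then show ?case using y V by blast
  qed
qed

text \<open>The translate of the cell is cut along the lattice translates of the cell, which cover
  almost everything. Each piece is moved back into the cell without changing its measure, and the
  pieces that arrive there are cut out by the lattice translates of the translated cell, which cover
  almost everything as well.\<close>

lemma nn_integral_cell_translate:
  assumes f: "f \<in> borel_measurable lebesgue" and per: "\<And>V x. V \<in> lattice M \<Longrightarrow> f (x + V) = f x"
  shows "(\<integral>\<^sup>+y. f (y + z) * indicator Y y \<partial>lebesgue) = (\<integral>\<^sup>+y. f y * indicator Y y \<partial>lebesgue)"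
proof -
  define \<nu> where "\<nu> = density lebesgue f"
  have em: "emeasure \<nu> A = (\<integral>\<^sup>+x. f x * indicator A x \<partial>lebesgue)" if "A \<in> sets lebesgue" for A
    unfolding \<nu>_def using f that by (rule emeasure_density)
  have sets_\<nu>: "sets \<nu> = sets lebesgue" by (simp add: \<nu>_def)
  have tr: "(+) V ` A \<in> sets lebesgue" if "A \<in> sets lebesgue" for V and A :: "(real^'d) set"
    by (rule lebesgue_sets_translation[OF that])
  have shift: "emeasure \<nu> ((+) V ` A) = emeasure \<nu> A" if "V \<in> lattice M" "A \<in> sets lebesgue" for V A
  proof -
    have "(\<lambda>x. f x * indicator ((+) V ` A) x) \<in> borel_measurable lebesgue"
      using f tr[OF that(2), of V] by (intro borel_measurable_times_ennreal borel_measurable_indicator) auto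
    from nn_integral_lebesgue_translate[OF this, of V]
    have "emeasure \<nu> ((+) V ` A) = (\<integral>\<^sup>+x. f (x + V) * indicator ((+) V ` A) (x + V) \<partial>lebesgue)"
      using em[OF tr[OF that(2)]] by simp
    also have "\<dots> = (\<integral>\<^sup>+x. f x * indicator A x \<partial>lebesgue)"
      by (intro nn_integral_cong) (auto simp: per[OF that(1)] indicator_def image_iff add.commute)
    finally show ?thesis using em[OF that(2)] by simp
  qed
  have split: "emeasure \<nu> A = (\<integral>\<^sup>+V. emeasure \<nu> (A \<inter> (+) (V + w) ` Y) \<partial>count_space (lattice M))"
    if A: "A \<in> sets lebesgue" for A w
  proof -
    have "AE x in lebesgue. \<exists>V\<in>lattice M. x \<in> (+) (V + w) ` Y"
    proof -
      have N: "negligible {x. \<not> (\<exists>V\<in>lattice M. x \<in> (+) V ` Y)}"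
        using AE_lattice_cover by (simp add: eventually_ae_filter negligible_iff_null_sets)
          (meson completion.complete2 null_sets_completion_subset)
      have "negligible ((+) w ` {x. \<not> (\<exists>V\<in>lattice M. x \<in> (+) V ` Y)})"
        by (rule negligible_translation[OF N])
      then have "AE x in lebesgue. x \<notin> (+) w ` {x. \<not> (\<exists>V\<in>lattice M. x \<in> (+) V ` Y)}"
        by (simp add: AE_not_in negligible_iff_null_sets)
      then show ?thesis
      proof eventually_elim
        case (elim x)
        have "x = w + (x - w)" by simp
        then have "x - w \<notin> {x. \<not> (\<exists>V\<in>lattice M. x \<in> (+) V ` Y)}" using elim by blast
        then obtain V y where "V \<in> lattice M" "y \<in> Y" "x - w = V + y" by auto
        then show ?case by (intro bexI[of _ V] image_eqI[of _ _ y]) (auto simp: algebra_simps)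
      qed
    qed
    then have "emeasure \<nu> A = emeasure \<nu> (\<Union>V\<in>lattice M. A \<inter> (+) (V + w) ` Y)"
    proof -
      assume ae: "AE x in lebesgue. \<exists>V\<in>lattice M. x \<in> (+) (V + w) ` Y"
      have U: "(\<Union>V\<in>lattice M. A \<inter> (+) (V + w) ` Y) \<in> sets lebesgue"
        using A tr[OF Y_sets] countable_lattice by (intro sets.countable_UN'' sets.Int) auto
      show ?thesis unfolding em[OF A] em[OF U]
        using ae by (intro nn_integral_cong_AE, eventually_elim) (auto simp: indicator_def)
    qed
    also have "\<dots> = (\<integral>\<^sup>+V. emeasure \<nu> (A \<inter> (+) (V + w) ` Y) \<partial>count_space (lattice M))"
    proof (rule emeasure_UN_countable)
      show "disjoint_family_on (\<lambda>V. A \<inter> (+) (V + w) ` Y) (lattice M)"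
        unfolding disjoint_family_on_def
      proof (intro ballI impI)
        fix V V' assume V: "V \<in> lattice M" "V' \<in> lattice M" "V \<noteq> V'"
        have "(+) (V + w) ` Y \<inter> (+) (V' + w) ` Y = (+) w ` ((+) V ` Y \<inter> (+) V' ` Y)"
          by (simp add: image_Int image_image add_ac)
        then show "A \<inter> (+) (V + w) ` Y \<inter> (A \<inter> (+) (V' + w) ` Y) = {}"
          using Y_disjoint[OF V] by auto
      qed
    qed (use A tr[OF Y_sets] countable_lattice sets_\<nu> in auto)
    finally show ?thesis .
  qed
  have "(\<integral>\<^sup>+y. f (y + z) * indicator Y y \<partial>lebesgue) = emeasure \<nu> ((+) z ` Y)"
  proof -
    have "(\<lambda>x. f x * indicator ((+) z ` Y) x) \<in> borel_measurable lebesgue"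
      using f tr[OF Y_sets, of z] by (intro borel_measurable_times_ennreal borel_measurable_indicator) auto
    from nn_integral_lebesgue_translate[OF this, of z]
    have "emeasure \<nu> ((+) z ` Y) = (\<integral>\<^sup>+x. f (x + z) * indicator ((+) z ` Y) (x + z) \<partial>lebesgue)"
      using em[OF tr[OF Y_sets]] by simp
    also have "\<dots> = (\<integral>\<^sup>+y. f (y + z) * indicator Y y \<partial>lebesgue)"
      by (intro nn_integral_cong) (auto simp: indicator_def image_iff add.commute)
    finally show ?thesis by simp
  qed
  also have "\<dots> = (\<integral>\<^sup>+V. emeasure \<nu> ((+) z ` Y \<inter> (+) (V + 0) ` Y) \<partial>count_space (lattice M))"
    by (rule split[OF tr[OF Y_sets]])
  \<comment> \<open>the piece in \<open>V + Y\<close> is moved back into \<open>Y\<close>\<close>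
  also have "\<dots> = (\<integral>\<^sup>+V. emeasure \<nu> (Y \<inter> (+) (- V + z) ` Y) \<partial>count_space (lattice M))"
  proof (rule nn_integral_cong)
    fix V assume "V \<in> space (count_space (lattice M))"
    then have V: "V \<in> lattice M" by simp
    have "(+) V ` (Y \<inter> (+) (- V + z) ` Y) = (+) z ` Y \<inter> (+) (V + 0) ` Y"
      by (simp add: image_Int image_image Int_commute)
    then show "emeasure \<nu> ((+) z ` Y \<inter> (+) (V + 0) ` Y) = emeasure \<nu> (Y \<inter> (+) (- V + z) ` Y)"
      using shift[OF V, of "Y \<inter> (+) (- V + z) ` Y"] tr[OF Y_sets] by (simp add: sets.Int)
  qed
  also have "\<dots> = (\<integral>\<^sup>+V. emeasure \<nu> (Y \<inter> (+) (V + z) ` Y) \<partial>count_space (lattice M))"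
    by (rule nn_integral_bij_count_space[where g = uminus and f = "\<lambda>V. emeasure \<nu> (Y \<inter> (+) (V + z) ` Y)"])
      (rule bij_betwI[where g = uminus]; auto simp: lattice_uminus)
  also have "\<dots> = emeasure \<nu> Y" by (rule split[symmetric]) simp
  also have "\<dots> = (\<integral>\<^sup>+y. f y * indicator Y y \<partial>lebesgue)" by (rule em) simp
  finally show ?thesis .
qed

definition periodic :: "(real^'d \<Rightarrow> real) \<Rightarrow> bool" where
  "periodic f \<longleftrightarrow> (\<forall>V\<in>lattice M. \<forall>x. f (x + V) = f x)"

lemma periodic_bounded:
  assumes c: "continuous_on UNIV f" and per: "periodic f"
  obtains K where "\<And>x. \<bar>f x\<bar> \<le> K"
proof -
  have "compact (f ` closure Y)"
    using c Y_bounded by (intro compact_continuous_image) (auto simp: compact_closure intro: continuous_on_subset)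
  then have "bounded (f ` closure Y)" by (rule compact_imp_bounded)
  then obtain K where K: "\<And>y. y \<in> closure Y \<Longrightarrow> \<bar>f y\<bar> \<le> K" unfolding bounded_iff by auto
  have "\<bar>f x\<bar> \<le> K" for x
  proof -
    obtain V where V: "V \<in> lattice M" "x \<in> closure ((+) V ` Y)" using Y_cover by blast
    from V(2) obtain y where "y \<in> closure Y" "x = V + y" unfolding closure_translation by blast
    then have y: "y \<in> closure Y" "x = y + V" by (simp_all add: add.commute)
    then show ?thesis using K V(1) per by (auto simp: periodic_def)
  qed
  then show ?thesis by (rule that)
qed

lemma L2_continuous: "continuous_on UNIV f \<Longrightarrow> L2 Y f"
  by (rule L2_continuous_bounded_set[OF _ Y_bounded Y_sets])

lemma L2_smooth: "smooth f \<Longrightarrow> L2 Y f"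
  by (intro L2_continuous smooth_continuous)

lemma L2_const: "L2 Y (\<lambda>x. c)" by (rule L2_continuous) simp

lemma L2_integrable: "L2 Y f \<Longrightarrow> integrable (lebesgue_on Y) f"
  using L2_integrable_mult[OF _ L2_const[of 1]] by fastforce

lemma continuous_translate: "continuous_on UNIV f \<Longrightarrow> continuous_on UNIV (\<lambda>y. f (y + z))"
  for f :: "real^'d \<Rightarrow> real"
  by (rule continuous_on_compose2[of UNIV f]) (auto intro!: continuous_intros)

text \<open>Adding a constant reduces the claim to nonnegative functions.\<close>

lemma LINT_cell_translate:
  assumes c: "continuous_on UNIV f" and per: "periodic f"
  shows "(LINT y|lebesgue_on Y. f (y + z)) = (LINT y|lebesgue_on Y. f y)"
proof -
  obtain K where K: "\<And>x. \<bar>f x\<bar> \<le> K" using periodic_bounded[OF assms] by blast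
  define g where "g x = f x + K" for x
  have gc: "continuous_on UNIV g" unfolding g_def by (intro continuous_intros c)
  have g0: "g x \<ge> 0" for x using K[of x] by (simp add: g_def)
  have int: "(LINT y|lebesgue_on Y. h y) = enn2real (\<integral>\<^sup>+y. ennreal (h y) * indicator Y y \<partial>lebesgue)"
    if "continuous_on UNIV h" "\<And>x. h x \<ge> 0" for h :: "real^'d \<Rightarrow> real"
  proof -
    have "(LINT y|lebesgue_on Y. h y) = enn2real (\<integral>\<^sup>+y. ennreal (h y) \<partial>lebesgue_on Y)"
      using that by (intro integral_eq_nn_integral continuous_measurable_lebesgue_on) auto
    then show ?thesis by (simp add: nn_integral_restrict_space)
  qed
  have "(\<integral>\<^sup>+y. ennreal (g (y + z)) * indicator Y y \<partial>lebesgue) = (\<integral>\<^sup>+y. ennreal (g y) * indicator Y y \<partial>lebesgue)"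
  proof (rule nn_integral_cell_translate[of "\<lambda>y. ennreal (g y)"])
    show "(\<lambda>y. ennreal (g y)) \<in> borel_measurable lebesgue"
      using continuous_measurable_lebesgue_on[OF gc, of UNIV] by (simp add: lebesgue_on_UNIV_eq)
  qed (use per in \<open>auto simp: g_def periodic_def\<close>)
  then have "(LINT y|lebesgue_on Y. g (y + z)) = (LINT y|lebesgue_on Y. g y)"
    using int[OF gc g0] int[OF continuous_translate[OF gc] g0] by simp
  then show ?thesis
    unfolding g_def using L2_integrable[OF L2_continuous[OF c]] L2_integrable[OF L2_continuous[OF continuous_translate[OF c]]]
    by simp
qed

lemma periodic_pd:
  assumes "\<And>x. f differentiable (at x)" "periodic f"
  shows "periodic (pd j f)"
  unfolding periodic_def
proof (intro ballI allI)
  fix V x assume "V \<in> lattice M"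
  then have "(\<lambda>x. f (x + V)) = f" using assms(2) by (auto simp: periodic_def)
  then show "pd j f (x + V) = pd j f x" using pd_translate[OF assms(1), of j V] by metis
qed

lemma LINT_pd_periodic_eq_0:
  assumes f: "Ck (Suc 0) f" and per: "periodic f"
  shows "(LINT y|lebesgue_on Y. pd j f y) = 0"
proof -
  have c: "continuous_on UNIV f" using Ck_Suc_imp_Ck[OF f] by simp
  have "((\<lambda>t. LINT y|lebesgue_on Y. f (y + t *\<^sub>R axis j 1) * 1) has_real_derivative
      (LINT y|lebesgue_on Y. (\<Sum>i\<in>UNIV. axis j 1 $ i * pd i f (y + 0 *\<^sub>R axis j 1)) * 1)) (at 0)"
    by (rule DERIV_integral_translate[OF f Y_bounded Y_sets]) simp
  then have "((\<lambda>t. LINT y|lebesgue_on Y. f y) has_real_derivative (LINT y|lebesgue_on Y. pd j f y)) (at 0)"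
    by (simp add: LINT_cell_translate[OF c per] sum_axis)
  then show ?thesis using DERIV_unique DERIV_const by blast
qed

lemma periodic_integration_by_parts:
  assumes "smooth f" "periodic f" "smooth g" "periodic g"
  shows "(LINT y|lebesgue_on Y. pd j f y * g y) = - (LINT y|lebesgue_on Y. f y * pd j g y)"
proof -
  have "(LINT y|lebesgue_on Y. pd j (\<lambda>x. f x * g x) y) = 0"
    using assms by (intro LINT_pd_periodic_eq_0 Ck_mult smooth_Ck) (auto simp: periodic_def)
  then have "(LINT y|lebesgue_on Y. pd j f y * g y + f y * pd j g y) = 0"
    by (simp add: pd_mult smooth_differentiable assms)
  then show ?thesis
    using assms by (simp add: L2_integrable_mult L2_continuous smooth_continuous smooth_pd)
qed

text \<open>Symmetry of second derivatives, almost everywhere and hence for integrals, from the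
  corresponding property of the test functions.\<close>

lemma AE_pd_commute:
  assumes f: "smooth f"
  shows "AE y in lebesgue_on Y. pd i (pd j f) y = pd j (pd i f) y"
proof -
  have W: "has_weak_pd Y j g (pd j g)" if "smooth g" for g j
    using that by (intro has_weak_pd_classical L2_continuous smooth_continuous smooth_Ck smooth_pd) auto
  have L: "L2 Y (pd i (pd j f))" "L2 Y (pd j (pd i f))" "L2 Y f"
    using f by (auto intro: L2_continuous smooth_continuous smooth_pd)
  have "AE y in lebesgue_on Y. pd i (pd j f) y - pd j (pd i f) y = 0"
  proof (rule AE_eq_0_if_orthogonal_to_test_funs[OF Y_open L2_diff[OF L(1,2)]])
    fix \<phi> assume \<phi>: "test_fun Y \<phi>"
    have \<phi>U: "test_fun UNIV \<phi>" using \<phi> by (simp add: test_fun_def)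
    have ibp: "(LINT y|lebesgue_on Y. pd i (pd j f) y * \<phi> y) = (LINT y|lebesgue_on Y. f y * pd j (pd i \<phi>) y)" for i j
      using W[OF smooth_pd[OF f], of i j] W[OF f, of j] \<phi> test_fun_pd[OF \<phi>, of i] by (simp add: has_weak_pd_def)
    have "AE y in lebesgue. pd j (pd i \<phi>) y = pd i (pd j \<phi>) y"
      using weak_pd_commute has_weak_pd_test_fun test_fun_pd \<phi>U by blast
    then have "AE y in lebesgue_on Y. pd j (pd i \<phi>) y = pd i (pd j \<phi>) y"
      by (auto simp: AE_restrict_space_iff)
    then have "(LINT y|lebesgue_on Y. f y * pd j (pd i \<phi>) y) = (LINT y|lebesgue_on Y. f y * pd i (pd j \<phi>) y)"
      using L(3) test_fun_L2[OF test_fun_pd[OF test_fun_pd[OF \<phi>]] Y_sets, THEN L2_measurable]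
      by (intro integral_cong_AE borel_measurable_times) (auto simp: L2_measurable)
    then show "(LINT y|lebesgue_on Y. (pd i (pd j f) y - pd j (pd i f) y) * \<phi> y) = 0"
      using ibp[of i j] ibp[of j i] L2_integrable_mult[OF L(1) test_fun_L2[OF \<phi> Y_sets]]
        L2_integrable_mult[OF L(2) test_fun_L2[OF \<phi> Y_sets]]
      by (simp add: left_diff_distrib)
  qed
  then show ?thesis by simp
qed

lemma LINT_pd_exchange_periodic:
  assumes f: "smooth f" "periodic f" and g: "smooth g" "periodic g"
  shows "(LINT y|lebesgue_on Y. pd j f y * pd i g y) = (LINT y|lebesgue_on Y. pd i f y * pd j g y)"
proof -
  have gp: "periodic (pd i g)" "periodic (pd j g)" using g by (auto intro: periodic_pd smooth_differentiable)
  have "(LINT y|lebesgue_on Y. f y * pd j (pd i g) y) = (LINT y|lebesgue_on Y. f y * pd i (pd j g) y)"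
    using AE_pd_commute[OF g(1), of j i] f g
    by (intro integral_cong_AE borel_measurable_times continuous_measurable_lebesgue_on smooth_continuous smooth_pd) auto
  then show ?thesis
    using periodic_integration_by_parts[OF f smooth_pd[OF g(1)] gp(1), of j]
      periodic_integration_by_parts[OF f smooth_pd[OF g(1)] gp(2), of i] by simp
qed

lemma periodic_Korn:
  assumes u: "\<And>i. smooth (u i)" "\<And>i. periodic (u i)"
  shows "(\<Sum>i\<in>UNIV. \<Sum>j\<in>UNIV. LINT y|lebesgue_on Y. (pd j (u i) y)\<^sup>2)
    \<le> (\<Sum>i\<in>UNIV. \<Sum>j\<in>(UNIV::'d set). LINT y|lebesgue_on Y. (pd j (u i) y + pd i (u j) y)\<^sup>2)"
  by (rule Korn_if_exchange[of Y "\<lambda>i j. pd j (u i)", OF L2_smooth[OF smooth_pd[OF u(1)]] LINT_pd_exchange_periodic[OF u u]])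

lemma L2_norm_cell_translate:
  assumes "continuous_on UNIV f" "periodic f"
  shows "L2_norm Y (\<lambda>y. f (y + z)) = L2_norm Y f"
proof -
  have "(LINT y|lebesgue_on Y. (f (y + z))\<^sup>2) = (LINT y|lebesgue_on Y. (f y)\<^sup>2)"
    using LINT_cell_translate[of "\<lambda>y. (f y)\<^sup>2" z] assms by (auto simp: periodic_def intro: continuous_intros)
  then show ?thesis by (simp add: L2_norm_def)
qed

text \<open>A weak form of the Poincare-Wirtinger inequality. The segment from \<open>y\<close> to \<open>y + z\<close>
  may leave the cell, which is possibly disconnected, but periodicity brings the gradient back into
  it.\<close>

lemma periodic_Poincare:
  assumes f: "smooth f" "periodic f" and \<psi>: "L2 Y \<psi>" and R: "\<And>z. z \<in> Y \<Longrightarrow> norm z \<le> R"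
  shows "\<bar>(LINT y|lebesgue_on Y. f y) * (LINT y|lebesgue_on Y. \<psi> y) - measure lebesgue Y * (LINT y|lebesgue_on Y. f y * \<psi> y)\<bar>
    \<le> measure lebesgue Y * (R * L2_norm Y \<psi> * (\<Sum>j\<in>UNIV. L2_norm Y (pd j f)))"
proof -
  let ?M = "lebesgue_on Y"
  define B where "B = R * L2_norm Y \<psi> * (\<Sum>j\<in>UNIV. L2_norm Y (pd j f))"
  have c: "continuous_on UNIV f" using f smooth_continuous by blast
  have pc: "continuous_on UNIV (pd j f)" for j using f by (intro smooth_continuous smooth_pd)
  have pp: "periodic (pd j f)" for j using f by (intro periodic_pd smooth_differentiable)
  have \<psi>i: "integrable ?M \<psi>" by (rule L2_integrable[OF \<psi>])
  have R0: "R \<ge> 0" if "z \<in> Y" for z using R[OF that] norm_ge_zero order_trans by blast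
  define G where "G z = (LINT y|?M. f (y + z) * \<psi> y)" for z
  have close: "\<bar>G z - G 0\<bar> \<le> B" if z: "z \<in> Y" for z
  proof -
    have "norm (G (1 *\<^sub>R z) - G (0 *\<^sub>R z)) \<le> B * norm (1 - (0::real))"
    proof (rule field_differentiable_bound[where S = UNIV and f' = "\<lambda>t. LINT y|?M. (\<Sum>j\<in>UNIV. z $ j * pd j f (y + t *\<^sub>R z)) * \<psi> y"])
      show "((\<lambda>t. G (t *\<^sub>R z)) has_field_derivative
          (LINT y|?M. (\<Sum>j\<in>UNIV. z $ j * pd j f (y + t *\<^sub>R z)) * \<psi> y)) (at t within UNIV)" for t
        unfolding G_def using DERIV_integral_translate[OF smooth_Ck[OF f(1)] Y_bounded Y_sets \<psi>i, of z t] by simp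
      fix t :: real
      have Lt: "L2 Y (\<lambda>y. pd j f (y + t *\<^sub>R z))" for j
        by (intro L2_continuous continuous_translate pc)
      have "(LINT y|?M. (\<Sum>j\<in>UNIV. z $ j * pd j f (y + t *\<^sub>R z)) * \<psi> y)
          = (\<Sum>j\<in>UNIV. z $ j * (LINT y|?M. pd j f (y + t *\<^sub>R z) * \<psi> y))"
        using L2_integrable_mult[OF Lt \<psi>] by (simp add: sum_distrib_right mult.assoc)
      also have "\<bar>\<dots>\<bar> \<le> (\<Sum>j\<in>UNIV. R * (L2_norm Y (pd j f) * L2_norm Y \<psi>))"
      proof (rule order_trans[OF sum_abs], rule sum_mono)
        fix j :: 'd
        have "\<bar>z $ j\<bar> \<le> R" using component_le_norm_cart[of z j] R[OF z] by linarith
        moreover have "\<bar>LINT y|?M. pd j f (y + t *\<^sub>R z) * \<psi> y\<bar> \<le> L2_norm Y (pd j f) * L2_norm Y \<psi>"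
          using L2_Cauchy_Schwarz[OF Lt \<psi>] by (simp add: L2_norm_cell_translate[OF pc pp])
        ultimately show "\<bar>z $ j * (LINT y|?M. pd j f (y + t *\<^sub>R z) * \<psi> y)\<bar> \<le> R * (L2_norm Y (pd j f) * L2_norm Y \<psi>)"
          unfolding abs_mult using R0[OF z] by (intro mult_mono) auto
      qed
      also have "\<dots> = B" by (simp add: B_def sum_distrib_left mult_ac)
      finally show "norm (LINT y|?M. (\<Sum>j\<in>UNIV. z $ j * pd j f (y + t *\<^sub>R z)) * \<psi> y) \<le> B" by simp
    qed auto
    then show ?thesis by simp
  qed
  interpret P: pair_sigma_finite ?M ?M ..
  have meas: "(\<lambda>(x, y). \<psi> x * f (x + y)) \<in> borel_measurable (?M \<Otimes>\<^sub>M ?M)"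
  proof -
    have id: "(\<lambda>x. x) \<in> borel_measurable ?M"
      by (intro measurable_restrict_space1 measurable_completion) simp
    have "(\<lambda>p. fst p + snd p) \<in> borel_measurable (?M \<Otimes>\<^sub>M ?M)"
      using measurable_compose[OF measurable_fst id] measurable_compose[OF measurable_snd id]
      by (intro borel_measurable_add)
    then have "(\<lambda>p. f (fst p + snd p)) \<in> borel_measurable (?M \<Otimes>\<^sub>M ?M)"
      by (rule measurable_compose) (use c in \<open>simp add: borel_measurable_continuous_onI\<close>)
    moreover have "(\<lambda>p. \<psi> (fst p)) \<in> borel_measurable (?M \<Otimes>\<^sub>M ?M)"
      by (rule measurable_compose[OF measurable_fst]) (use \<psi> in \<open>simp add: L2_def\<close>)
    ultimately show ?thesis by (simp add: split_beta' borel_measurable_times)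
  qed
  have fi: "integrable ?M (\<lambda>y. f (x + y))" for x
    using L2_integrable[OF L2_continuous[OF continuous_translate[OF c, of x]]] by (simp add: add.commute)
  have inner: "(LINT z|?M. f (y + z)) = (LINT z|?M. f z)" for y
    using LINT_cell_translate[OF c f(2), of y] by (simp add: add.commute)
  have int: "integrable (?M \<Otimes>\<^sub>M ?M) (\<lambda>(x, y). \<psi> x * f (x + y))"
  proof (rule P.Fubini_integrable[OF meas])
    have "(LINT y|?M. \<bar>f (x + y)\<bar>) = (LINT y|?M. \<bar>f y\<bar>)" for x
      using LINT_cell_translate[of "\<lambda>y. \<bar>f y\<bar>" x] c f(2)
      by (simp add: add.commute periodic_def continuous_on_rabs)
    then show "integrable ?M (\<lambda>x. LINT y|?M. norm (case (x, y) of (x, y) \<Rightarrow> \<psi> x * f (x + y)))"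
      using \<psi>i by (simp add: abs_mult)
    show "AE x in ?M. integrable ?M (\<lambda>y. case (x, y) of (x, y) \<Rightarrow> \<psi> x * f (x + y))"
      using fi by simp
  qed
  \<comment> \<open>the mean over all \<open>z\<close> in the cell turns the translates of \<open>f\<close> into the mean of \<open>f\<close>\<close>
  have "(LINT z|?M. G z) = (LINT y|?M. LINT z|?M. \<psi> y * f (y + z))"
    using P.Fubini_integral[OF int] by (simp add: G_def mult.commute)
  also have "\<dots> = (LINT y|lebesgue_on Y. f y) * (LINT y|lebesgue_on Y. \<psi> y)" by (simp add: inner)
  finally have mean: "(LINT z|?M. G z) = (LINT y|lebesgue_on Y. f y) * (LINT y|lebesgue_on Y. \<psi> y)" .
  have Gi: "integrable ?M G"
    using P.integrable_snd[OF int] by (simp add: G_def[abs_def] mult.commute)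
  have "\<bar>LINT z|?M. G z - G 0\<bar> \<le> (LINT z|?M. \<bar>G z - G 0\<bar>)" by (rule integral_abs_bound)
  also have "\<dots> \<le> (LINT z|?M. B)"
    using Gi close by (intro integral_mono_AE AE_I2) (auto simp: space_restrict_space)
  also have "(LINT z|?M. B) = measure lebesgue Y * B" by (simp add: space_restrict_space measure_restrict_space)
  also have "(LINT z|?M. G z - G 0) = (LINT z|?M. G z) - measure lebesgue Y * G 0"
    using Gi by (simp add: space_restrict_space measure_restrict_space)
  finally show ?thesis unfolding mean B_def by (simp add: G_def)
qed

lemma vH1_grad: "vH1 Y w \<Longrightarrow> has_weak_pd Y j (\<lambda>x. w x $ i) (grad Y w i j)"
  unfolding grad_def vH1_def H1_def using has_weak_pd_wpd by blast

text \<open>Weak derivatives are unique almost everywhere, so the norm that defines the periodic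
  Sobolev space controls each component and each derivative separately.\<close>

lemma H1_per_approx:
  assumes w: "H1_per M w"
  obtains \<Phi> :: "nat \<Rightarrow> real^'d \<Rightarrow> real^'d" where
    "\<And>n i. smooth (\<lambda>x. \<Phi> n x $ i)" "\<And>n i. periodic (\<lambda>x. \<Phi> n x $ i)"
    "\<And>i. (\<lambda>n. LINT y|lebesgue_on Y. (w y $ i - \<Phi> n y $ i)\<^sup>2) \<longlonglongrightarrow> 0"
    "\<And>i j. (\<lambda>n. LINT y|lebesgue_on Y. (cgrad M w i j y - pd j (\<lambda>x. \<Phi> n x $ i) y)\<^sup>2) \<longlonglongrightarrow> 0"
proof -
  from w obtain \<Phi> where \<Phi>: "\<And>n. smooth_periodic M (\<Phi> n)"
    and lim: "(\<lambda>n. H1_normsq Y (\<lambda>y. \<Phi> n y - w y)) \<longlonglongrightarrow> 0" and wv: "vH1 Y w"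
    by (auto simp: H1_per_def)
  have sm: "smooth (\<lambda>x. \<Phi> n x $ i)" and per: "periodic (\<lambda>x. \<Phi> n x $ i)" for n i
    using \<Phi>[of n] by (auto simp: smooth_periodic_def vsmooth_def periodic_def)
  have W: "has_weak_pd Y j (\<lambda>x. w x $ i) (cgrad M w i j)" for i j by (rule vH1_grad[OF wv])
  have P: "has_weak_pd Y j (\<lambda>x. \<Phi> n x $ i) (pd j (\<lambda>x. \<Phi> n x $ i))" for n i j
    using sm by (intro has_weak_pd_classical L2_continuous smooth_continuous smooth_Ck smooth_pd) auto
  have g: "(LINT y|lebesgue_on Y. (grad Y (\<lambda>y. \<Phi> n y - w y) i j y)\<^sup>2)
      = (LINT y|lebesgue_on Y. (cgrad M w i j y - pd j (\<lambda>x. \<Phi> n x $ i) y)\<^sup>2)" for n i j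
  proof -
    have D: "has_weak_pd Y j (\<lambda>x. (\<Phi> n x - w x) $ i) (\<lambda>y. pd j (\<lambda>x. \<Phi> n x $ i) y - cgrad M w i j y)"
      using has_weak_pd_diff[OF Y_sets P W] by simp
    have "AE y in lebesgue_on Y. grad Y (\<lambda>y. \<Phi> n y - w y) i j y = pd j (\<lambda>x. \<Phi> n x $ i) y - cgrad M w i j y"
      unfolding grad_def[of Y "\<lambda>y. \<Phi> n y - w y"] by (rule AE_wpd_eq[OF Y_open D])
    then have "AE y in lebesgue_on Y. (grad Y (\<lambda>y. \<Phi> n y - w y) i j y)\<^sup>2 = (cgrad M w i j y - pd j (\<lambda>x. \<Phi> n x $ i) y)\<^sup>2"
      by eventually_elim (simp add: power2_commute)
    moreover have "L2 Y (grad Y (\<lambda>y. \<Phi> n y - w y) i j)"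
      unfolding grad_def by (rule has_weak_pd_L2(2)[OF has_weak_pd_wpd[OF D]])
    ultimately show ?thesis
      using L2_diff[OF has_weak_pd_L2(2)[OF W[where i = i and j = j]] has_weak_pd_L2(2)[OF P[where i = i and j = j and n = n]]]
      by (intro integral_cong_AE borel_measurable_power) (auto simp: L2_def)
  qed
  have n: "H1_normsq Y (\<lambda>y. \<Phi> n y - w y) = (\<Sum>i\<in>UNIV. LINT y|lebesgue_on Y. (w y $ i - \<Phi> n y $ i)\<^sup>2)
      + (\<Sum>(i,j)\<in>UNIV. LINT y|lebesgue_on Y. (cgrad M w i j y - pd j (\<lambda>x. \<Phi> n x $ i) y)\<^sup>2)" for n
    by (simp add: H1_normsq_def L2_normsq_def g power2_commute)
  have n0: "0 \<le> (\<Sum>i\<in>UNIV. LINT y|lebesgue_on Y. (w y $ i - \<Phi> n y $ i)\<^sup>2)"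
    "0 \<le> (\<Sum>(i,j)\<in>UNIV. LINT y|lebesgue_on Y. (cgrad M w i j y - pd j (\<lambda>x. \<Phi> n x $ i) y)\<^sup>2)" for n
    by (auto intro!: sum_nonneg)
  have 1: "(LINT y|lebesgue_on Y. (w y $ i - \<Phi> n y $ i)\<^sup>2) \<le> H1_normsq Y (\<lambda>y. \<Phi> n y - w y)" for n i
    using member_le_sum[of i UNIV "\<lambda>i. LINT y|lebesgue_on Y. (w y $ i - \<Phi> n y $ i)\<^sup>2"] n0[of n] n[of n] by simp
  have 2: "(LINT y|lebesgue_on Y. (cgrad M w i j y - pd j (\<lambda>x. \<Phi> n x $ i) y)\<^sup>2) \<le> H1_normsq Y (\<lambda>y. \<Phi> n y - w y)" for n i j
    using member_le_sum[of "(i,j)" UNIV "\<lambda>(i,j). LINT y|lebesgue_on Y. (cgrad M w i j y - pd j (\<lambda>x. \<Phi> n x $ i) y)\<^sup>2"] n0[of n] n[of n]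
    by (auto simp: split_beta)
  show ?thesis
  proof (rule that[OF sm per])
    show "(\<lambda>n. LINT y|lebesgue_on Y. (w y $ i - \<Phi> n y $ i)\<^sup>2) \<longlonglongrightarrow> 0" for i
      by (rule tendsto_sandwich[OF _ _ tendsto_const lim]) (use 1 in \<open>auto intro!: always_eventually\<close>)
    show "(\<lambda>n. LINT y|lebesgue_on Y. (cgrad M w i j y - pd j (\<lambda>x. \<Phi> n x $ i) y)\<^sup>2) \<longlonglongrightarrow> 0" for i j
      by (rule tendsto_sandwich[OF _ _ tendsto_const lim]) (use 2 in \<open>auto intro!: always_eventually\<close>)
  qed
qed

lemma H1_per_L2:
  assumes "H1_per M w"
  shows "L2 Y (\<lambda>y. w y $ i)" "L2 Y (cgrad M w i j)"
  using assms has_weak_pd_L2[OF vH1_grad] by (auto simp: H1_per_def)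

lemma LINT_cgrad_eq_0:
  assumes w: "H1_per M w"
  shows "(LINT y|lebesgue_on Y. cgrad M w i j y) = 0"
proof -
  obtain \<Phi> :: "nat \<Rightarrow> real^'d \<Rightarrow> real^'d" where \<Phi>: "\<And>n i. smooth (\<lambda>x. \<Phi> n x $ i)" "\<And>n i. periodic (\<lambda>x. \<Phi> n x $ i)"
    "\<And>i. (\<lambda>n. LINT y|lebesgue_on Y. (w y $ i - \<Phi> n y $ i)\<^sup>2) \<longlonglongrightarrow> 0"
    "\<And>i j. (\<lambda>n. LINT y|lebesgue_on Y. (cgrad M w i j y - pd j (\<lambda>x. \<Phi> n x $ i) y)\<^sup>2) \<longlonglongrightarrow> 0"
    using H1_per_approx[OF w] by blast
  have "(\<lambda>n. LINT y|lebesgue_on Y. pd j (\<lambda>x. \<Phi> n x $ i) y * 1) \<longlonglongrightarrow> (LINT y|lebesgue_on Y. cgrad M w i j y * 1)"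
    by (rule L2_pairing_tendsto[OF H1_per_L2(2)[OF w] L2_const _ \<Phi>(4)])
      (intro L2_continuous smooth_continuous smooth_pd \<Phi>)
  moreover have "(LINT y|lebesgue_on Y. pd j (\<lambda>x. \<Phi> n x $ i) y) = 0" for n
    by (rule LINT_pd_periodic_eq_0[OF smooth_Ck[OF \<Phi>(1)] \<Phi>(2)])
  ultimately show ?thesis by (simp add: LIMSEQ_const_iff)
qed

text \<open>Periodic fields of mean zero with the same strain coincide: along smooth approximations of
  their difference the strain tends to zero, hence the gradient by Korn's inequality, hence the
  deviation from the mean by the Poincare-Wirtinger inequality.\<close>

lemma LINT_eq_if_same_strain:
  assumes w: "H1_per0 M w" "H1_per0 M w'" and \<psi>: "L2 Y \<psi>"
    and strain: "\<And>i j. AE y in lebesgue_on Y.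
      cgrad M w i j y + cgrad M w j i y = cgrad M w' i j y + cgrad M w' j i y"
  shows "(LINT y|lebesgue_on Y. w y $ p * \<psi> y) = (LINT y|lebesgue_on Y. w' y $ p * \<psi> y)"
proof -
  let ?M = "lebesgue_on Y"
  have wp: "H1_per M w" "H1_per M w'" using w by (auto simp: H1_per0_def)
  obtain \<Phi> :: "nat \<Rightarrow> real^'d \<Rightarrow> real^'d" where \<Phi>: "\<And>n i. smooth (\<lambda>x. \<Phi> n x $ i)" "\<And>n i. periodic (\<lambda>x. \<Phi> n x $ i)"
    "\<And>i. (\<lambda>n. LINT y|?M. (w y $ i - \<Phi> n y $ i)\<^sup>2) \<longlonglongrightarrow> 0"
    "\<And>i j. (\<lambda>n. LINT y|?M. (cgrad M w i j y - pd j (\<lambda>x. \<Phi> n x $ i) y)\<^sup>2) \<longlonglongrightarrow> 0"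
    using H1_per_approx[OF wp(1)] by blast
  obtain \<Phi>' :: "nat \<Rightarrow> real^'d \<Rightarrow> real^'d" where \<Phi>': "\<And>n i. smooth (\<lambda>x. \<Phi>' n x $ i)" "\<And>n i. periodic (\<lambda>x. \<Phi>' n x $ i)"
    "\<And>i. (\<lambda>n. LINT y|?M. (w' y $ i - \<Phi>' n y $ i)\<^sup>2) \<longlonglongrightarrow> 0"
    "\<And>i j. (\<lambda>n. LINT y|?M. (cgrad M w' i j y - pd j (\<lambda>x. \<Phi>' n x $ i) y)\<^sup>2) \<longlonglongrightarrow> 0"
    using H1_per_approx[OF wp(2)] by blast
  define u where "u n i = (\<lambda>x. \<Phi> n x $ i - \<Phi>' n x $ i)" for n i
  have us: "smooth (u n i)" for n i unfolding u_def by (intro smooth_diff \<Phi> \<Phi>')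
  have up: "periodic (u n i)" for n i using \<Phi>(2)[of n i] \<Phi>'(2)[of n i] by (simp add: u_def periodic_def)
  have diff_lim: "(\<lambda>n. LINT y|?M. ((a y + c y) - (s n y + r n y))\<^sup>2) \<longlonglongrightarrow> 0"
    if L: "L2 Y a" "L2 Y c" "\<And>n. L2 Y (s n)" "\<And>n. L2 Y (r n)"
      and lim: "(\<lambda>n. LINT y|?M. (a y - s n y)\<^sup>2) \<longlonglongrightarrow> 0" "(\<lambda>n. LINT y|?M. (c y - r n y)\<^sup>2) \<longlonglongrightarrow> 0"
    for a c s r
  proof (rule tendsto_sandwich[OF _ _ tendsto_const])
    have "(LINT y|?M. ((a y + c y) - (s n y + r n y))\<^sup>2) \<le> 2 * (LINT y|?M. (a y - s n y)\<^sup>2) + 2 * (LINT y|?M. (c y - r n y)\<^sup>2)" for n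
      using L2_dist_triangle[OF L2_add[OF L(1,2)] L2_add[OF L(3)[of n] L(2)] L2_add[OF L(3,4)[of n]]] by simp
    then show "\<forall>\<^sub>F n in sequentially. (LINT y|?M. ((a y + c y) - (s n y + r n y))\<^sup>2)
        \<le> 2 * (LINT y|?M. (a y - s n y)\<^sup>2) + 2 * (LINT y|?M. (c y - r n y)\<^sup>2)" by simp
    have "(\<lambda>n. 2 * (LINT y|?M. (a y - s n y)\<^sup>2) + 2 * (LINT y|?M. (c y - r n y)\<^sup>2)) \<longlonglongrightarrow> 2 * 0 + 2 * 0"
      by (intro tendsto_intros lim)
    then show "(\<lambda>n. 2 * (LINT y|?M. (a y - s n y)\<^sup>2) + 2 * (LINT y|?M. (c y - r n y)\<^sup>2)) \<longlonglongrightarrow> 0" by simp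
  qed simp
  have Lpd: "L2 Y (pd j (u n i))" for n i j by (intro L2_continuous smooth_continuous smooth_pd us)
  have L\<Phi>: "L2 Y (pd j (\<lambda>x. \<Phi> n x $ i))" "L2 Y (\<lambda>x. - pd j (\<lambda>x. \<Phi>' n x $ i) x)"
    "L2 Y (\<lambda>x. \<Phi> n x $ i)" "L2 Y (\<lambda>x. - \<Phi>' n x $ i)" for n i j
    by (rule L2_smooth[OF smooth_pd[OF \<Phi>(1)]] L2_uminus[OF L2_smooth[OF smooth_pd[OF \<Phi>'(1)]]]
        L2_smooth[OF \<Phi>(1)] L2_uminus[OF L2_smooth[OF \<Phi>'(1)]])+
  note Lw = H1_per_L2[OF wp(1)] H1_per_L2[OF wp(2)]
  have pdu: "pd j (u n i) x = pd j (\<lambda>x. \<Phi> n x $ i) x + - pd j (\<lambda>x. \<Phi>' n x $ i) x" for n i j x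
  proof -
    have "pd j (\<lambda>x. \<Phi> n x $ i + (-1) * \<Phi>' n x $ i) x
        = pd j (\<lambda>x. \<Phi> n x $ i) x + pd j (\<lambda>x. (-1) * \<Phi>' n x $ i) x"
      by (subst pd_add[OF smooth_differentiable[OF \<Phi>(1)]
            smooth_differentiable[OF smooth_mult[OF smooth_const \<Phi>'(1)]]]) simp
    moreover have "pd j (\<lambda>x. (-1) * \<Phi>' n x $ i) x = - pd j (\<lambda>x. \<Phi>' n x $ i) x"
      by (subst pd_mult[OF smooth_differentiable[OF smooth_const] smooth_differentiable[OF \<Phi>'(1)]]) simp
    ultimately show ?thesis by (simp add: u_def)
  qed
  have grad_lim: "(\<lambda>n. LINT y|?M. ((cgrad M w i j y + - cgrad M w' i j y) - pd j (u n i) y)\<^sup>2) \<longlonglongrightarrow> 0" for i j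
    unfolding pdu
    by (rule diff_lim[OF Lw(2) L2_uminus[OF Lw(4)] L\<Phi>(1,2) \<Phi>(4)])
      (use \<Phi>'(4)[of i j] in \<open>simp add: power2_commute\<close>)
  have u_lim: "(\<lambda>n. LINT y|?M. ((w y $ i + - w' y $ i) - u n i y)\<^sup>2) \<longlonglongrightarrow> 0" for i
  proof -
    have "(\<lambda>n. LINT y|?M. ((w y $ i + - w' y $ i) - (\<Phi> n y $ i + - \<Phi>' n y $ i))\<^sup>2) \<longlonglongrightarrow> 0"
      by (rule diff_lim[OF Lw(1) L2_uminus[OF Lw(3)] L\<Phi>(3,4) \<Phi>(3)])
        (use \<Phi>'(3)[of i] in \<open>simp add: power2_commute\<close>)
    then show ?thesis by (simp add: u_def)
  qed
  have Lg: "L2 Y (\<lambda>y. cgrad M w i j y + - cgrad M w' i j y)" for i j by (intro L2_add L2_uminus Lw)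
  have sym_lim: "(\<lambda>n. LINT y|?M. (pd j (u n i) y + pd i (u n j) y)\<^sup>2) \<longlonglongrightarrow> 0" for i j
  proof -
    have "(\<lambda>n. LINT y|?M. (((cgrad M w i j y + - cgrad M w' i j y) + (cgrad M w j i y + - cgrad M w' j i y))
        - (pd j (u n i) y + pd i (u n j) y))\<^sup>2) \<longlonglongrightarrow> 0"
      by (rule diff_lim[OF Lg Lg Lpd Lpd grad_lim grad_lim])
    moreover have "(LINT y|?M. (((cgrad M w i j y + - cgrad M w' i j y) + (cgrad M w j i y + - cgrad M w' j i y))
        - (pd j (u n i) y + pd i (u n j) y))\<^sup>2) = (LINT y|?M. (pd j (u n i) y + pd i (u n j) y)\<^sup>2)" for n
    proof (rule integral_cong_AE)
      show "AE y in ?M. (((cgrad M w i j y + - cgrad M w' i j y) + (cgrad M w j i y + - cgrad M w' j i y))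
        - (pd j (u n i) y + pd i (u n j) y))\<^sup>2 = (pd j (u n i) y + pd i (u n j) y)\<^sup>2"
        using strain[of i j]
      proof eventually_elim
        case (elim y)
        then have "((cgrad M w i j y + - cgrad M w' i j y) + (cgrad M w j i y + - cgrad M w' j i y))
          - (pd j (u n i) y + pd i (u n j) y) = - (pd j (u n i) y + pd i (u n j) y)" by simp
        then show ?case by (metis power2_minus)
      qed
      show "(\<lambda>y. (pd j (u n i) y + pd i (u n j) y)\<^sup>2) \<in> borel_measurable ?M"
        using L2_add[OF Lpd Lpd] by (intro borel_measurable_power) (auto simp: L2_def)
      show "(\<lambda>y. (((cgrad M w i j y + - cgrad M w' i j y) + (cgrad M w j i y + - cgrad M w' j i y))
        - (pd j (u n i) y + pd i (u n j) y))\<^sup>2) \<in> borel_measurable ?M"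
        using L2_diff[OF L2_add[OF Lg Lg] L2_add[OF Lpd Lpd]] by (intro borel_measurable_power) (auto simp: L2_def)
    qed
    ultimately show ?thesis by simp
  qed
  have pd_lim: "(\<lambda>n. LINT y|?M. (pd j (u n i) y)\<^sup>2) \<longlonglongrightarrow> 0" for i j
  proof (rule tendsto_sandwich[OF _ _ tendsto_const])
    have "(LINT y|?M. (pd j (u n i) y)\<^sup>2)
        \<le> (\<Sum>i\<in>UNIV. \<Sum>j\<in>UNIV. LINT y|?M. (pd j (u n i) y + pd i (u n j) y)\<^sup>2)" for n
    proof -
      have "(LINT y|?M. (pd j (u n i) y)\<^sup>2) \<le> (\<Sum>j\<in>UNIV. LINT y|?M. (pd j (u n i) y)\<^sup>2)"
        by (intro member_le_sum) auto
      also have "\<dots> \<le> (\<Sum>i\<in>UNIV. \<Sum>j\<in>UNIV. LINT y|?M. (pd j (u n i) y)\<^sup>2)"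
        by (rule member_le_sum[of i UNIV "\<lambda>i. \<Sum>j\<in>UNIV. LINT y|?M. (pd j (u n i) y)\<^sup>2"]) (auto intro!: sum_nonneg)
      also have "\<dots> \<le> (\<Sum>i\<in>UNIV. \<Sum>j\<in>UNIV. LINT y|?M. (pd j (u n i) y + pd i (u n j) y)\<^sup>2)"
        by (rule periodic_Korn[OF us up])
      finally show ?thesis .
    qed
    then show "\<forall>\<^sub>F n in sequentially. (LINT y|?M. (pd j (u n i) y)\<^sup>2)
        \<le> (\<Sum>i\<in>UNIV. \<Sum>j\<in>UNIV. LINT y|?M. (pd j (u n i) y + pd i (u n j) y)\<^sup>2)" by simp
    show "(\<lambda>n. \<Sum>i\<in>UNIV. \<Sum>j\<in>UNIV. LINT y|?M. (pd j (u n i) y + pd i (u n j) y)\<^sup>2) \<longlonglongrightarrow> 0"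
      by (intro tendsto_null_sum sym_lim)
  qed simp
  have norm_lim: "(\<lambda>n. L2_norm Y (pd j (u n p))) \<longlonglongrightarrow> 0" for j
    using tendsto_real_sqrt[OF pd_lim[of j p]] by (simp add: L2_norm_def)
  obtain R where R: "\<And>z. z \<in> Y \<Longrightarrow> norm z \<le> R" using Y_bounded by (auto simp: bounded_iff)
  have Lu: "L2 Y (u n p)" for n by (intro L2_continuous smooth_continuous us)
  have Lwp: "L2 Y (\<lambda>y. w y $ p + - w' y $ p)" by (intro L2_add L2_uminus Lw)
  have P: "(\<lambda>n. (LINT y|?M. u n p y) * (LINT y|?M. \<psi> y) - measure lebesgue Y * (LINT y|?M. u n p y * \<psi> y)) \<longlonglongrightarrow> 0"
  proof (rule Lim_null_comparison)
    show "\<forall>\<^sub>F n in sequentially. norm ((LINT y|?M. u n p y) * (LINT y|?M. \<psi> y) - measure lebesgue Y * (LINT y|?M. u n p y * \<psi> y))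
        \<le> measure lebesgue Y * (R * L2_norm Y \<psi> * (\<Sum>j\<in>UNIV. L2_norm Y (pd j (u n p))))"
      using periodic_Poincare[OF us up \<psi> R] by simp
    show "(\<lambda>n. measure lebesgue Y * (R * L2_norm Y \<psi> * (\<Sum>j\<in>UNIV. L2_norm Y (pd j (u n p))))) \<longlonglongrightarrow> 0"
      by (intro tendsto_mult_right_zero tendsto_null_sum norm_lim)
  qed
  have "(\<lambda>n. LINT y|?M. u n p y * 1) \<longlonglongrightarrow> (LINT y|?M. (w y $ p + - w' y $ p) * 1)"
    by (rule L2_pairing_tendsto[OF Lwp L2_const Lu u_lim])
  moreover have "(LINT y|?M. (w y $ p + - w' y $ p) * 1) = 0"
    using w L2_integrable[OF Lw(1)] L2_integrable[OF Lw(3)] by (simp add: H1_per0_def)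
  moreover have "(\<lambda>n. LINT y|?M. u n p y * \<psi> y) \<longlonglongrightarrow> (LINT y|?M. (w y $ p + - w' y $ p) * \<psi> y)"
    by (rule L2_pairing_tendsto[OF Lwp \<psi> Lu u_lim])
  ultimately have "(\<lambda>n. (LINT y|?M. u n p y) * (LINT y|?M. \<psi> y) - measure lebesgue Y * (LINT y|?M. u n p y * \<psi> y))
      \<longlonglongrightarrow> 0 * (LINT y|?M. \<psi> y) - measure lebesgue Y * (LINT y|?M. (w y $ p + - w' y $ p) * \<psi> y)"
    by (intro tendsto_intros) auto
  from LIMSEQ_unique[OF this P] have "(LINT y|?M. (w y $ p + - w' y $ p) * \<psi> y) = 0"
    using measure_Y_pos by simp
  then show ?thesis
    using L2_integrable_mult[OF Lw(1) \<psi>] L2_integrable_mult[OF Lw(3) \<psi>] by (simp add: left_diff_distrib)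
qed

end

section \<open>The effective tensors\<close>

lemma sum_UNIV_prod:
  fixes f :: "'a::finite \<times> 'b::finite \<Rightarrow> 'c::comm_monoid_add"
  shows "(\<Sum>p\<in>UNIV. f p) = (\<Sum>x\<in>UNIV. \<Sum>y\<in>UNIV. f (x, y))"
  by (simp add: sum.cartesian_product UNIV_Times_UNIV[symmetric] del: UNIV_Times_UNIV)

lemma sum_of_bool_eq:
  fixes f :: "'a::finite \<Rightarrow> real"
  shows "(\<Sum>i\<in>UNIV. of_bool (i = k) * f i) = f k" "(\<Sum>i\<in>UNIV. f i * of_bool (i = k)) = f k"
proof -
  have "(\<Sum>i\<in>UNIV. of_bool (i = k) * f i) = (\<Sum>i\<in>UNIV. if i = k then f i else 0)"
    by (intro sum.cong) auto
  then show "(\<Sum>i\<in>UNIV. of_bool (i = k) * f i) = f k" by simp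
  then show "(\<Sum>i\<in>UNIV. f i * of_bool (i = k)) = f k" by (simp add: mult.commute)
qed

locale periodic_medium = periodic_cell M for M :: "('d::finite) cell_data" +
  assumes medium: "elastic_medium M" and cell_fns: "cell_functions M"
begin

type_synonym 'e field = "'e \<Rightarrow> 'e \<Rightarrow> real^'e \<Rightarrow> real"

definition stress :: "'d field \<Rightarrow> 'd field" where
  "stress G i j y = (\<Sum>k\<in>UNIV. \<Sum>p\<in>UNIV. stiff M y i j k p * G k p y)"

text \<open>The elastic energy form, on tensor fields instead of displacements. All cell problems and
  effective tensors are expressed by it, with the following three kinds of fields: gradients,
  constant unit tensors, and the products of a displacement with a unit vector.\<close>

definition energy :: "'d field \<Rightarrow> 'd field \<Rightarrow> real" where
  "energy F G = (LINT y|lebesgue_on Y. (\<Sum>i\<in>UNIV. \<Sum>j\<in>UNIV. F i j y * stress G i j y))"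

definition grad_field :: "(real^'d \<Rightarrow> real^'d) \<Rightarrow> 'd field" where
  "grad_field w i j y = cgrad M w i j y"

definition unit_field :: "'d \<Rightarrow> 'd \<Rightarrow> 'd field" where
  "unit_field k l i j y = of_bool (i = k) * of_bool (j = l)"

definition dyad_field :: "(real^'d \<Rightarrow> real^'d) \<Rightarrow> 'd \<Rightarrow> 'd field" where
  "dyad_field u m i j y = u y $ i * of_bool (j = m)"

definition add_field :: "'d field \<Rightarrow> 'd field \<Rightarrow> 'd field" (infixl \<open>\<oplus>\<close> 65) where
  "(F \<oplus> G) i j y = F i j y + G i j y"

definition L2_field :: "'d field \<Rightarrow> bool" where
  "L2_field G \<longleftrightarrow> (\<forall>i j. L2 Y (G i j))"

lemma L2_fieldD: "L2_field G \<Longrightarrow> L2 Y (G i j)" by (simp add: L2_field_def)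

lemma stiff_Linf: "Linf Y (\<lambda>y. stiff M y i j k p)"
  using medium by (auto simp: elastic_medium_def)

lemma stiff_symmetric: "AE y in lebesgue_on Y. \<forall>i j k p.
        stiff M y i j k p = stiff M y j i k p \<and>
        stiff M y i j k p = stiff M y i j p k \<and>
        stiff M y i j k p = stiff M y k p i j"
  using medium by (auto simp: elastic_medium_def)

lemma stress_L2: "L2_field G \<Longrightarrow> L2 Y (stress G i j)"
  unfolding stress_def[abs_def] by (intro L2_sum L2_Linf_mult stiff_Linf L2_fieldD)


lemma energy_integrable:
  assumes "L2_field F" "L2_field G"
  shows "integrable (lebesgue_on Y) (\<lambda>y. F i j y * stress G i j y)"
  by (rule L2_integrable_mult[OF L2_fieldD[OF assms(1)] stress_L2[OF assms(2)]])

lemma energy_sum: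
  assumes "L2_field F" "L2_field G"
  shows "energy F G = (\<Sum>i\<in>UNIV. \<Sum>j\<in>UNIV. LINT y|lebesgue_on Y. F i j y * stress G i j y)"
  unfolding energy_def using energy_integrable[OF assms] by simp

lemma energy_commute:
  assumes "L2_field F" "L2_field G"
  shows "energy F G = energy G F"
  unfolding energy_def
proof (rule integral_cong_AE)
  have m: "(\<lambda>y. \<Sum>i\<in>UNIV. \<Sum>j\<in>UNIV. F i j y * stress G i j y) \<in> borel_measurable (lebesgue_on Y)"
    if "L2_field F" "L2_field G" for F G
    by (intro borel_measurable_sum borel_measurable_times L2_measurable stress_L2 L2_fieldD that)
  show "(\<lambda>y. \<Sum>i\<in>UNIV. \<Sum>j\<in>UNIV. F i j y * stress G i j y) \<in> borel_measurable (lebesgue_on Y)"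
    "(\<lambda>y. \<Sum>i\<in>UNIV. \<Sum>j\<in>UNIV. G i j y * stress F i j y) \<in> borel_measurable (lebesgue_on Y)"
    by (intro m assms)+
  show "AE y in lebesgue_on Y. (\<Sum>i\<in>UNIV. \<Sum>j\<in>UNIV. F i j y * stress G i j y)
      = (\<Sum>i\<in>UNIV. \<Sum>j\<in>UNIV. G i j y * stress F i j y)"
    using stiff_symmetric
  proof eventually_elim
    case (elim y)
    have "(\<Sum>i\<in>UNIV. \<Sum>j\<in>UNIV. F i j y * stress G i j y)
        = (\<Sum>x\<in>UNIV. \<Sum>z\<in>UNIV. F (fst x) (snd x) y * stiff M y (fst x) (snd x) (fst z) (snd z) * G (fst z) (snd z) y)"
      by (simp add: stress_def sum_distrib_left mult.assoc sum_UNIV_prod)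
    also have "\<dots> = (\<Sum>z\<in>UNIV. \<Sum>x\<in>UNIV. G (fst z) (snd z) y * stiff M y (fst z) (snd z) (fst x) (snd x) * F (fst x) (snd x) y)"
      using elim by (subst sum.swap) (intro sum.cong refl, simp add: mult.commute mult.left_commute)
    also have "\<dots> = (\<Sum>i\<in>UNIV. \<Sum>j\<in>UNIV. G i j y * stress F i j y)"
      by (simp add: stress_def sum_distrib_left mult.assoc sum_UNIV_prod)
    finally show ?case .
  qed
qed

lemma L2_field_add: "L2_field F \<Longrightarrow> L2_field G \<Longrightarrow> L2_field (F \<oplus> G)"
  by (simp add: L2_field_def add_field_def[abs_def] L2_add)

lemma energy_add_left:
  assumes "L2_field F" "L2_field F'" "L2_field G"
  shows "energy (F \<oplus> F') G = energy F G + energy F' G"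
  unfolding energy_sum[OF L2_field_add[OF assms(1,2)] assms(3)] energy_sum[OF assms(1,3)] energy_sum[OF assms(2,3)]
  using energy_integrable[OF assms(1,3)] energy_integrable[OF assms(2,3)]
  by (simp add: add_field_def distrib_right sum.distrib)

lemma energy_add_right:
  assumes "L2_field F" "L2_field F'" "L2_field G"
  shows "energy G (F \<oplus> F') = energy G F + energy G F'"
  using energy_add_left[OF assms] energy_commute L2_field_add assms by metis

lemma L2_field_combination:
  assumes "\<And>a. L2_field (G a)" shows "L2_field (\<lambda>i j y. \<Sum>a\<in>UNIV. c a * G a i j y)"
  using assms unfolding L2_field_def by (intro allI L2_sum L2_cmult) auto

lemma energy_combination_left:
  fixes G :: "'a::finite \<Rightarrow> 'd field"
  assumes G: "\<And>a. L2_field (G a)" and H: "L2_field H"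
  shows "energy (\<lambda>i j y. \<Sum>a\<in>UNIV. c a * G a i j y) H = (\<Sum>a\<in>UNIV. c a * energy (G a) H)"
proof -
  have "(LINT y|lebesgue_on Y. (\<Sum>a\<in>UNIV. c a * G a i j y) * stress H i j y)
      = (\<Sum>a\<in>UNIV. c a * (LINT y|lebesgue_on Y. G a i j y * stress H i j y))" for i j
    using energy_integrable[OF G H] by (simp add: sum_distrib_right mult.assoc)
  then have "energy (\<lambda>i j y. \<Sum>a\<in>UNIV. c a * G a i j y) H
      = (\<Sum>i\<in>UNIV. \<Sum>j\<in>UNIV. \<Sum>a\<in>UNIV. c a * (LINT y|lebesgue_on Y. G a i j y * stress H i j y))"
    by (simp add: energy_sum[OF L2_field_combination[OF G] H])
  also have "\<dots> = (\<Sum>i\<in>UNIV. \<Sum>a\<in>UNIV. \<Sum>j\<in>UNIV. c a * (LINT y|lebesgue_on Y. G a i j y * stress H i j y))"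
    by (intro sum.cong refl sum.swap)
  also have "\<dots> = (\<Sum>a\<in>UNIV. \<Sum>i\<in>UNIV. \<Sum>j\<in>UNIV. c a * (LINT y|lebesgue_on Y. G a i j y * stress H i j y))"
    by (rule sum.swap)
  also have "\<dots> = (\<Sum>a\<in>UNIV. c a * energy (G a) H)"
    by (simp add: energy_sum[OF G H] sum_distrib_left)
  finally show ?thesis .
qed

lemma energy_combination_right:
  fixes G :: "'a::finite \<Rightarrow> 'd field"
  assumes G: "\<And>a. L2_field (G a)" and H: "L2_field H"
  shows "energy H (\<lambda>i j y. \<Sum>a\<in>UNIV. c a * G a i j y) = (\<Sum>a\<in>UNIV. c a * energy H (G a))"
  using energy_combination_left[OF G H, of c] energy_commute[OF H L2_field_combination[OF G], of c] energy_commute[OF H G] by simp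

text \<open>By its minor symmetries the stiffness sees only the symmetric part of a field.\<close>

lemma stress_sym_cong:
  assumes sym: "\<And>i j k p. stiff M y i j k p = stiff M y i j p k"
    and GH: "\<And>k p. G k p y + G p k y = H k p y + H p k y"
  shows "stress G i j y = stress H i j y"
proof -
  have half: "2 * stress F i j y = (\<Sum>k\<in>UNIV. \<Sum>p\<in>UNIV. stiff M y i j k p * (F k p y + F p k y))" for F
  proof -
    have "stress F i j y = (\<Sum>k\<in>UNIV. \<Sum>p\<in>UNIV. stiff M y i j k p * F p k y)"
      unfolding stress_def by (subst sum.swap) (simp add: sym[of i j])
    then show ?thesis unfolding distrib_left sum.distrib by (simp add: stress_def)
  qed
  show ?thesis using half[of G] half[of H] by (simp add: GH)
qed

lemma energy_strain_cong:
  assumes "L2_field F" "L2_field G" "L2_field H"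
    and strain: "\<And>i j. AE y in lebesgue_on Y. G i j y + G j i y = H i j y + H j i y"
  shows "energy F G = energy F H"
  unfolding energy_def
proof (rule integral_cong_AE)
  show "(\<lambda>y. \<Sum>i\<in>UNIV. \<Sum>j\<in>UNIV. F i j y * stress G i j y) \<in> borel_measurable (lebesgue_on Y)"
    "(\<lambda>y. \<Sum>i\<in>UNIV. \<Sum>j\<in>UNIV. F i j y * stress H i j y) \<in> borel_measurable (lebesgue_on Y)"
    by (intro borel_measurable_sum borel_measurable_times L2_measurable stress_L2 L2_fieldD assms)+
  have "AE y in lebesgue_on Y. \<forall>i j. G i j y + G j i y = H i j y + H j i y"
    using strain by (simp add: AE_all_countable)
  with stiff_symmetric show "AE y in lebesgue_on Y. (\<Sum>i\<in>UNIV. \<Sum>j\<in>UNIV. F i j y * stress G i j y)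
      = (\<Sum>i\<in>UNIV. \<Sum>j\<in>UNIV. F i j y * stress H i j y)"
  proof eventually_elim
    case (elim y)
    have "stress G i j y = stress H i j y" for i j
      by (rule stress_sym_cong) (use elim in blast)+
    then show ?case by simp
  qed
qed

lemma energy_coercive:
  obtains \<kappa> where "\<kappa> > 0"
    "\<And>G. L2_field G \<Longrightarrow> energy G G \<ge> \<kappa> * (\<Sum>i\<in>UNIV. \<Sum>j\<in>UNIV. LINT y|lebesgue_on Y. ((G i j y + G j i y) / 2)\<^sup>2)"
proof -
  from medium obtain \<kappa> where \<kappa>: "\<kappa> > 0" and el: "AE y in lebesgue_on Y. \<forall>\<epsilon> :: 'd \<Rightarrow> 'd \<Rightarrow> real. (\<forall>i j. \<epsilon> i j = \<epsilon> j i) \<longrightarrow>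
        (\<Sum>(i,j,k,p)\<in>UNIV. \<epsilon> i j * stiff M y i j k p * \<epsilon> k p) \<ge> \<kappa> * (\<Sum>(i,j)\<in>UNIV. (\<epsilon> i j)\<^sup>2)"
    unfolding elastic_medium_def by blast
  have "energy G G \<ge> \<kappa> * (\<Sum>i\<in>UNIV. \<Sum>j\<in>UNIV. LINT y|lebesgue_on Y. ((G i j y + G j i y) / 2)\<^sup>2)" if G: "L2_field G" for G
  proof -
    define e where "e i j y = (G i j y + G j i y) / 2" for i j y
    have "L2 Y (\<lambda>y. (G i j y + G j i y) / 2)" for i j by (intro L2_divide L2_add L2_fieldD G)
    then have e: "L2_field e" by (simp add: L2_field_def e_def[abs_def])
    have eG: "energy F G = energy F e" if "L2_field F" for F
      by (rule energy_strain_cong[OF that G e], intro AE_I2) (simp add: e_def field_simps)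
    have "energy G G = energy e e"
      using eG[OF G] eG[OF e] energy_commute[OF G e] by simp
    moreover have "(LINT y|lebesgue_on Y. \<kappa> * (\<Sum>i\<in>UNIV. \<Sum>j\<in>UNIV. (e i j y)\<^sup>2)) \<le> energy e e"
      unfolding energy_def
    proof (rule integral_mono_AE)
      show "integrable (lebesgue_on Y) (\<lambda>y. \<kappa> * (\<Sum>i\<in>UNIV. \<Sum>j\<in>UNIV. (e i j y)\<^sup>2))"
        using L2_integrable_square[OF L2_fieldD[OF e]] by simp
      show "integrable (lebesgue_on Y) (\<lambda>y. \<Sum>i\<in>UNIV. \<Sum>j\<in>UNIV. e i j y * stress e i j y)"
        using energy_integrable[OF e e] by simp
      show "AE y in lebesgue_on Y. \<kappa> * (\<Sum>i\<in>UNIV. \<Sum>j\<in>UNIV. (e i j y)\<^sup>2) \<le> (\<Sum>i\<in>UNIV. \<Sum>j\<in>UNIV. e i j y * stress e i j y)"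
        using el
      proof eventually_elim
        case (elim y)
        have "\<forall>i j. e i j y = e j i y" by (simp add: e_def add.commute)
        then have "\<kappa> * (\<Sum>(i,j)\<in>UNIV. (e i j y)\<^sup>2) \<le> (\<Sum>(i,j,k,p)\<in>UNIV. e i j y * stiff M y i j k p * e k p y)"
          using elim[THEN spec, of "\<lambda>i j. e i j y"] by blast
        then show ?case by (simp add: stress_def sum_UNIV_prod sum_distrib_left mult.assoc)
      qed
    qed
    moreover have "(LINT y|lebesgue_on Y. \<kappa> * (\<Sum>i\<in>UNIV. \<Sum>j\<in>UNIV. (e i j y)\<^sup>2))
        = \<kappa> * (\<Sum>i\<in>UNIV. \<Sum>j\<in>UNIV. LINT y|lebesgue_on Y. (e i j y)\<^sup>2)"
      using L2_integrable_square[OF L2_fieldD[OF e]] by simp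
    ultimately have "\<kappa> * (\<Sum>i\<in>UNIV. \<Sum>j\<in>UNIV. LINT y|lebesgue_on Y. (e i j y)\<^sup>2) \<le> energy G G" by linarith
    then show ?thesis by (simp only: e_def)
  qed
  with \<kappa> that show ?thesis by blast
qed

lemma energy_unit_field: "energy (unit_field k l) G = (LINT y|lebesgue_on Y. stress G k l y)"
proof -
  have "(\<Sum>i\<in>UNIV. \<Sum>j\<in>UNIV. unit_field k l i j y * stress G i j y) = stress G k l y" for y
    unfolding unit_field_def
    by (simp add: mult.assoc sum_distrib_left[symmetric] sum_of_bool_eq)
  then show ?thesis by (simp add: energy_def)
qed

lemma energy_dyad_field: "energy (dyad_field u m) G = (LINT y|lebesgue_on Y. (\<Sum>r\<in>UNIV. u y $ r * stress G r m y))"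
proof -
  have "(\<Sum>i\<in>UNIV. \<Sum>j\<in>UNIV. dyad_field u m i j y * stress G i j y) = (\<Sum>r\<in>UNIV. u y $ r * stress G r m y)" for y
    unfolding dyad_field_def
    by (simp add: mult.assoc sum_distrib_left[symmetric] sum_of_bool_eq)
  then show ?thesis by (simp add: energy_def)
qed

lemma stress_add: "stress (F \<oplus> G) i j y = stress F i j y + stress G i j y"
  by (simp add: stress_def add_field_def distrib_left sum.distrib)

lemma stress_unit_field: "stress (unit_field k l) i j y = stiff M y i j k l"
  unfolding stress_def unit_field_def
  by (simp add: mult.left_commute[of "stiff _ _ _ _ _ _"] sum_distrib_left[symmetric] sum_of_bool_eq)

lemma stress_dyad_field: "stress (dyad_field u m) i j y = (\<Sum>p\<in>UNIV. stiff M y i j p m * u y $ p)"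
  unfolding stress_def dyad_field_def by (simp add: mult.assoc[symmetric] sum_of_bool_eq)

lemma L2_unit_field: "L2_field (unit_field k l)"
  unfolding L2_field_def unit_field_def[abs_def] by (intro allI L2_const)

lemma L2_grad_field: "H1_per0 M w \<Longrightarrow> L2_field (grad_field w)"
  unfolding L2_field_def grad_field_def[abs_def] using H1_per_L2(2) by (auto simp: H1_per0_def)

lemma L2_component: "H1_per0 M w \<Longrightarrow> L2 Y (\<lambda>y. w y $ i)"
  using H1_per_L2(1) by (auto simp: H1_per0_def)

lemma L2_dyad_field: "H1_per0 M w \<Longrightarrow> L2_field (dyad_field w m)"
  unfolding L2_field_def dyad_field_def[abs_def] by (subst mult.commute) (intro allI L2_cmult L2_component)

lemma A_form_energy: "A_form M w v = energy (grad_field w) (grad_field v)"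
  by (simp add: A_form_def energy_def stress_def grad_field_def sum_UNIV_prod sum_distrib_left mult.assoc)

lemma stress_transpose: "AE y in lebesgue_on Y. stress G i j y = stress G j i y"
  using stiff_symmetric by eventually_elim (metis (mono_tags, lifting) stress_def sum.cong)

lemma energy_unit_field_transpose:
  assumes "L2_field G" shows "energy (unit_field k l) G = energy (unit_field l k) G"
  unfolding energy_unit_field
  by (intro integral_cong_AE stress_transpose L2_measurable stress_L2 assms)

lemma beta_Linf: "Linf Y (beta M)"
proof -
  have d: "Linf Y (dens M)" using medium by (simp add: elastic_medium_def)
  then obtain K where K: "AE y in lebesgue_on Y. \<bar>dens M y\<bar> \<le> K" by (auto simp: Linf_def)
  then have "AE y in lebesgue_on Y. \<bar>dens M y / rho0 M\<bar> \<le> K / \<bar>rho0 M\<bar>"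
    by eventually_elim (simp add: abs_divide divide_right_mono)
  moreover have "(\<lambda>y. dens M y / rho0 M) \<in> borel_measurable (lebesgue_on Y)"
    using d by (intro borel_measurable_divide) (auto simp: Linf_def)
  ultimately show ?thesis by (auto simp: Linf_def beta_def[abs_def])
qed

lemma rho0_pos: "rho0 M > 0"
proof -
  from medium obtain r where r: "r > 0" "AE y in lebesgue_on Y. dens M y \<ge> r" "Linf Y (dens M)"
    by (auto simp: elastic_medium_def)
  have "(LINT y|lebesgue_on Y. r) \<le> (LINT y|lebesgue_on Y. dens M y)"
    using r L2_integrable[OF Linf_imp_L2[OF r(3) Y_lmeasurable]] by (intro integral_mono_AE) auto
  then have "r * measure lebesgue Y \<le> (LINT y|lebesgue_on Y. dens M y)"
    by (simp add: space_restrict_space measure_restrict_space mult.commute)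
  then show ?thesis
    using r(1) measure_Y_pos unfolding rho0_def avg_def
    by (intro divide_pos_pos) (auto intro: less_le_trans[OF mult_pos_pos])
qed

abbreviation (input) vol :: real where "vol \<equiv> measure lebesgue Y"

text \<open>The total strains of the first two cell problems, whose stresses are \<open>S0\<close> and \<open>S1\<close>.\<close>

abbreviation (input) load1 :: "'d \<Rightarrow> 'd \<Rightarrow> 'd field" where
  "load1 k l \<equiv> grad_field (chi1 M k l) \<oplus> unit_field k l"

abbreviation (input) load2 :: "'d \<Rightarrow> 'd \<Rightarrow> 'd \<Rightarrow> 'd field" where
  "load2 k l m \<equiv> grad_field (chi2 M k l m) \<oplus> dyad_field (chi1 M k l) m"

lemma chi_H1:
  "H1_per0 M (chi1 M k l)" "H1_per0 M (chi2 M k l m)" "H1_per0 M (chi3 M k l m n)"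
  "H1_per0 M (zeta2 M n)" "H1_per0 M (zeta3 M k l)"
  using cell_fns by (auto simp: cell_functions_def cell_solution_def)

lemmas L2_fields = L2_grad_field[OF chi_H1(1)] L2_grad_field[OF chi_H1(2)] L2_grad_field[OF chi_H1(3)]
  L2_grad_field[OF chi_H1(4)] L2_grad_field[OF chi_H1(5)]
  L2_dyad_field[OF chi_H1(1)] L2_dyad_field[OF chi_H1(2)] L2_dyad_field[OF chi_H1(4)]
  L2_unit_field

lemma S0_stress: "S0 M k l i j = stress (load1 k l) i j"
  by (rule ext) (simp add: S0_def stress_add stress_unit_field, simp add: stress_def grad_field_def sum_UNIV_prod)

lemma S1_stress: "S1 M k l m i j = stress (load2 k l m) i j"
  by (rule ext) (simp add: S1_def stress_add stress_dyad_field, simp add: stress_def grad_field_def sum_UNIV_prod)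

lemma C0_energy: "vol * C0 M i j k l = energy (unit_field i j) (load1 k l)"
  using measure_Y_pos by (simp add: C0_def avg_def S0_stress energy_unit_field)

lemma C1_energy: "vol * C1 M i j k l m = energy (unit_field i j) (load2 k l m)"
  using measure_Y_pos by (simp add: C1_def avg_def S1_stress energy_unit_field)

lemma C2_energy: "vol * C2 M i j n k l m
    = energy (unit_field i j) (grad_field (chi3 M k l m n) \<oplus> dyad_field (chi2 M k l m) n)"
  using measure_Y_pos
  by (simp add: C2_def avg_def energy_unit_field stress_def grad_field_def dyad_field_def add_field_def sum_UNIV_prod)

text \<open>A constant in the load of a cell problem does no work on displacements of mean zero. This
  is why the effective tensors, which only make the loads balanced, drop out of the equations
  below.\<close>

lemma LINT_constant_load:
  assumes v: "H1_per0 M v" and S: "\<And>r. L2 Y (S r)"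
  shows "(LINT y|lebesgue_on Y. (\<Sum>r\<in>UNIV. (S r y - c r) * v y $ r)) = (LINT y|lebesgue_on Y. (\<Sum>r\<in>UNIV. v y $ r * S r y))"
proof -
  note V = L2_component[OF v]
  have "(LINT y|lebesgue_on Y. (\<Sum>r\<in>UNIV. (S r y - c r) * v y $ r))
      = (LINT y|lebesgue_on Y. (\<Sum>r\<in>UNIV. v y $ r * S r y - c r * v y $ r))"
    by (simp add: algebra_simps)
  also have "\<dots> = (\<Sum>r\<in>UNIV. (LINT y|lebesgue_on Y. v y $ r * S r y) - c r * (LINT y|lebesgue_on Y. v y $ r))"
    using L2_integrable_mult[OF V S] L2_integrable[OF V] by simp
  also have "\<dots> = (LINT y|lebesgue_on Y. (\<Sum>r\<in>UNIV. v y $ r * S r y))"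
    using v L2_integrable_mult[OF V S] by (simp add: H1_per0_def)
  finally show ?thesis .
qed

lemma LINT_dyad_load:
  "(LINT y|lebesgue_on Y. (\<Sum>(p,r,s)\<in>UNIV. u y $ p * stiff M y p m r s * cgrad M v r s y))
    = energy (dyad_field u m) (grad_field v)"
  by (simp add: energy_dyad_field stress_def grad_field_def sum_UNIV_prod sum_distrib_left mult.assoc)

lemma integrable_dyad_load:
  assumes "H1_per0 M u" "H1_per0 M v"
  shows "integrable (lebesgue_on Y) (\<lambda>y. \<Sum>(p,r,s)\<in>UNIV. u y $ p * stiff M y p m r s * cgrad M v r s y)"
proof -
  have "integrable (lebesgue_on Y) (\<lambda>y. \<Sum>p\<in>UNIV. u y $ p * stress (grad_field v) p m y)"
    using L2_integrable_mult[OF L2_component[OF assms(1)] stress_L2[OF L2_grad_field[OF assms(2)]]] by simp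
  then show ?thesis by (simp add: stress_def grad_field_def sum_UNIV_prod sum_distrib_left mult.assoc)
qed

lemma integrable_load:
  assumes v: "H1_per0 M v" and S: "\<And>r. L2 Y (S r)"
  shows "integrable (lebesgue_on Y) (\<lambda>y. \<Sum>r\<in>UNIV. (S r y - c r) * v y $ r)"
  by (intro Bochner_Integration.integrable_sum L2_integrable_mult L2_diff L2_component v S L2_const)

lemma chi1_equation:
  assumes v: "H1_per0 M v"
  shows "energy (grad_field (chi1 M k l)) (grad_field v) = - energy (unit_field k l) (grad_field v)"
proof -
  have "A_form M (chi1 M k l) v
      = - (LINT y|lebesgue_on Y. (\<Sum>(r,s)\<in>UNIV. stiff M y k l r s * cgrad M v r s y))"
    using cell_fns v by (simp add: cell_functions_def cell_solution_def)
  then show ?thesis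
    by (simp add: A_form_energy energy_unit_field stress_def grad_field_def sum_UNIV_prod)
qed

lemma chi2_equation:
  assumes v: "H1_per0 M v"
  shows "energy (grad_field (chi2 M k l m)) (grad_field v)
    = energy (dyad_field v m) (load1 k l) - energy (dyad_field (chi1 M k l) m) (grad_field v)"
proof -
  have L: "L2 Y (stress (load1 k l) i j)" for i j
    by (intro stress_L2 L2_field_add L2_fields)
  have "A_form M (chi2 M k l m) v = (LINT y|lebesgue_on Y.
           (\<Sum>r\<in>UNIV. (S0 M k l m r y - C0 M k l m r) * v y $ r)
           - (\<Sum>(p,r,s)\<in>UNIV. chi1 M k l y $ p * stiff M y p m r s * cgrad M v r s y))"
    using cell_fns v by (simp add: cell_functions_def cell_solution_def)
  also have "\<dots> = (LINT y|lebesgue_on Y. (\<Sum>r\<in>UNIV. v y $ r * stress (load1 k l) m r y))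
      - energy (dyad_field (chi1 M k l) m) (grad_field v)"
    using integrable_load[where S = "\<lambda>r. stress (load1 k l) m r", OF v L, of "\<lambda>r. C0 M k l m r"]
      integrable_dyad_load[OF chi_H1(1) v, of k l m]
    by (simp add: S0_stress LINT_constant_load[where S = "\<lambda>r. stress (load1 k l) m r", OF v L] LINT_dyad_load)
  also have "(LINT y|lebesgue_on Y. (\<Sum>r\<in>UNIV. v y $ r * stress (load1 k l) m r y))
      = (LINT y|lebesgue_on Y. (\<Sum>r\<in>UNIV. v y $ r * stress (load1 k l) r m y))"
  proof (rule integral_cong_AE)
    have "AE y in lebesgue_on Y. \<forall>r. stress (load1 k l) m r y = stress (load1 k l) r m y"
      using stress_transpose by (simp add: AE_all_countable)
    then show "AE y in lebesgue_on Y. (\<Sum>r\<in>UNIV. v y $ r * stress (load1 k l) m r y) = (\<Sum>r\<in>UNIV. v y $ r * stress (load1 k l) r m y)"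
      by eventually_elim simp
  qed (intro borel_measurable_sum borel_measurable_times L2_measurable L L2_component[OF v])+
  finally show ?thesis by (simp add: A_form_energy energy_dyad_field)
qed

lemma chi3_equation:
  assumes v: "H1_per0 M v"
  shows "energy (grad_field (chi3 M k l m n)) (grad_field v)
    = energy (dyad_field v n) (load2 k l m) - energy (dyad_field (chi2 M k l m) n) (grad_field v)"
proof -
  have L: "L2 Y (stress (load2 k l m) i j)" for i j
    by (intro stress_L2 L2_field_add L2_fields)
  have "A_form M (chi3 M k l m n) v = (LINT y|lebesgue_on Y.
           (\<Sum>r\<in>UNIV. (S1 M k l m r n y - C1 M r n k l m) * v y $ r)
           - (\<Sum>(p,r,s)\<in>UNIV. chi2 M k l m y $ p * stiff M y p n r s * cgrad M v r s y))"
    using cell_fns v by (simp add: cell_functions_def cell_solution_def)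
  also have "\<dots> = (LINT y|lebesgue_on Y. (\<Sum>r\<in>UNIV. v y $ r * stress (load2 k l m) r n y))
      - energy (dyad_field (chi2 M k l m) n) (grad_field v)"
    using integrable_load[where S = "\<lambda>r. stress (load2 k l m) r n", OF v L, of "\<lambda>r. C1 M r n k l m"]
      integrable_dyad_load[OF chi_H1(2) v, of k l m n]
    by (simp add: S1_stress LINT_constant_load[where S = "\<lambda>r. stress (load2 k l m) r n", OF v L] LINT_dyad_load)
  finally show ?thesis by (simp add: A_form_energy energy_dyad_field)
qed

lemma beta_L2: "H1_per0 M v \<Longrightarrow> L2 Y (\<lambda>y. beta M y * v y $ i)"
  by (intro L2_Linf_mult beta_Linf L2_component)

lemma zeta2_equation:
  assumes v: "H1_per0 M v"
  shows "energy (grad_field (zeta2 M n)) (grad_field v) = (LINT y|lebesgue_on Y. beta M y * v y $ n)"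
proof -
  have "A_form M (zeta2 M n) v = (LINT y|lebesgue_on Y. (beta M y - 1) * v y $ n)"
    using cell_fns v by (simp add: cell_functions_def cell_solution_def)
  also have "\<dots> = (LINT y|lebesgue_on Y. beta M y * v y $ n) - (LINT y|lebesgue_on Y. v y $ n)"
    using L2_integrable[OF beta_L2[OF v]] L2_integrable[OF L2_component[OF v]] by (simp add: left_diff_distrib)
  finally show ?thesis using v by (simp add: A_form_energy H1_per0_def)
qed

lemma phi1_stress: "phi1 M i k l y = stress (grad_field (zeta2 M k)) i l y + beta M y * chi1 M k l y $ i"
  by (simp add: phi1_def stress_def grad_field_def sum_UNIV_prod)

lemma zeta3_equation:
  assumes v: "H1_per0 M v"
  shows "energy (grad_field (zeta3 M k l)) (grad_field v)
    = energy (dyad_field v l) (grad_field (zeta2 M k))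
      + (LINT y|lebesgue_on Y. (\<Sum>r\<in>UNIV. v y $ r * (beta M y * chi1 M k l y $ r)))
      - energy (dyad_field (zeta2 M k) l) (grad_field v)"
proof -
  have L: "L2 Y (stress (grad_field (zeta2 M k)) i j)" for i j by (intro stress_L2 L2_fields)
  have P: "L2 Y (phi1 M r k l)" for r
    unfolding phi1_stress[abs_def] by (intro L2_add L beta_L2 chi_H1)
  have "A_form M (zeta3 M k l) v = (LINT y|lebesgue_on Y. (\<Sum>r\<in>UNIV. (phi1 M r k l y - B1 M r k l) * v y $ r))
           - (LINT y|lebesgue_on Y. (\<Sum>(a,r,s)\<in>UNIV. zeta2 M k y $ a * stiff M y a l r s * cgrad M v r s y))"
    using cell_fns v by (simp add: cell_functions_def cell_solution_def)
  also have "\<dots> = (LINT y|lebesgue_on Y. (\<Sum>r\<in>UNIV. v y $ r * phi1 M r k l y)) - energy (dyad_field (zeta2 M k) l) (grad_field v)"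
    by (simp add: LINT_constant_load[OF v P] LINT_dyad_load)
  also have "(LINT y|lebesgue_on Y. (\<Sum>r\<in>UNIV. v y $ r * phi1 M r k l y))
      = (LINT y|lebesgue_on Y. (\<Sum>r\<in>UNIV. v y $ r * stress (grad_field (zeta2 M k)) r l y))
       + (LINT y|lebesgue_on Y. (\<Sum>r\<in>UNIV. v y $ r * (beta M y * chi1 M k l y $ r)))"
    using L2_integrable_mult[OF L2_component[OF v] L] L2_integrable_mult[OF L2_component[OF v] beta_L2[OF chi_H1(1)]]
    by (simp add: phi1_stress distrib_left sum.distrib)
  finally show ?thesis by (simp add: A_form_energy energy_dyad_field)
qed

lemma B1_energy: "vol * B1 M i k l = energy (unit_field i l) (grad_field (zeta2 M k))
    + (LINT y|lebesgue_on Y. beta M y * chi1 M k l y $ i)"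
  using measure_Y_pos L2_integrable[OF stress_L2[OF L2_fields(4)]] L2_integrable[OF beta_L2[OF chi_H1(1)]]
  by (simp add: B1_def avg_def phi1_stress energy_unit_field)

lemma B2_energy: "vol * B2 M i l k m = energy (unit_field i l) (grad_field (zeta3 M k m) \<oplus> dyad_field (zeta2 M k) m)
    + (LINT y|lebesgue_on Y. beta M y * chi2 M m k l y $ i)"
proof -
  have "phi2 M i l k m y = stress (grad_field (zeta3 M k m) \<oplus> dyad_field (zeta2 M k) m) i l y + beta M y * chi2 M m k l y $ i" for y
    by (simp add: phi2_def stress_add stress_dyad_field, simp add: stress_def grad_field_def sum_UNIV_prod)
  then show ?thesis
    using measure_Y_pos L2_integrable[OF stress_L2[OF L2_field_add[OF L2_fields(5,8)]]] L2_integrable[OF beta_L2[OF chi_H1(2)]]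
    by (simp add: B2_def avg_def energy_unit_field)
qed

subsection \<open>Symmetries\<close>

text \<open>Each tensor is an average that involves the solution of the last cell problem of its
  hierarchy. Testing the equation of \<open>chi1 M i j\<close> with that solution turns the average into a
  work of loads of lower order, and one more use of a cell equation, if necessary, makes the
  behaviour under the exchange of the two index groups visible.\<close>

lemma C0_representation:
  "vol * C0 M i j k l = energy (unit_field i j) (unit_field k l) - energy (grad_field (chi1 M i j)) (grad_field (chi1 M k l))"
  using chi1_equation[OF chi_H1(1), of i j k l] by (simp add: C0_energy energy_add_right L2_fields)

lemma vol_eqI: "vol * a = vol * b \<Longrightarrow> a = b"
  using measure_Y_pos by simp

lemma C0_minor: "C0 M i j k l = C0 M j i k l"
  by (rule vol_eqI)
    (simp only: C0_energy energy_unit_field_transpose[OF L2_field_add[OF L2_fields(1,9)], of i j])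

lemma C0_major: "C0 M i j k l = C0 M k l i j"
  by (rule vol_eqI) (simp only: C0_representation
    energy_commute[OF L2_fields(9,9), of i j k l] energy_commute[OF L2_fields(1,1), of i j k l])

lemma C1_representation:
  "vol * C1 M i j k l m = energy (dyad_field (chi1 M k l) m) (load1 i j) - energy (dyad_field (chi1 M i j) m) (load1 k l)"
  using chi1_equation[OF chi_H1(2), of i j k l m] chi2_equation[OF chi_H1(1), of k l m i j]
    energy_commute[OF L2_fields(1,2), of i j k l m] energy_commute[OF L2_fields(9,6), of i j k l m]
  by (simp add: C1_energy energy_add_right L2_fields)

lemma C1_antisymmetric: "C1 M i j k l m = - C1 M k l i j m"
proof -
  have "vol * (C1 M i j k l m + C1 M k l i j m) = 0"
    unfolding distrib_left C1_representation by simp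
  then show ?thesis using measure_Y_pos by simp
qed

lemma C1_minor: "C1 M i j k l m = C1 M j i k l m"
  by (rule vol_eqI)
    (simp only: C1_energy energy_unit_field_transpose[OF L2_field_add[OF L2_fields(2,6)], of i j])

lemma C2_representation:
  "vol * C2 M i j n k l m = energy (grad_field (chi2 M i j n)) (grad_field (chi2 M k l m))
     - energy (dyad_field (chi1 M i j) n) (dyad_field (chi1 M k l) m)"
  using chi1_equation[OF chi_H1(3), of i j k l m n] chi3_equation[OF chi_H1(1), of k l m n i j]
    chi2_equation[OF chi_H1(2), of i j n k l m]
    energy_commute[OF L2_fields(1,3), of i j k l m n] energy_commute[OF L2_fields(9,7), of i j k l m n]
  by (simp add: C2_energy energy_add_right L2_fields)

lemma C2_major: "C2 M i j n k l m = C2 M k l m i j n"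
  by (rule vol_eqI) (simp only: C2_representation
    energy_commute[OF L2_fields(2,2), of i j n k l m] energy_commute[OF L2_fields(6,6), of i j n k l m])

lemma C2_minor: "C2 M i j n k l m = C2 M j i n k l m"
  by (rule vol_eqI)
    (simp only: C2_energy energy_unit_field_transpose[OF L2_field_add[OF L2_fields(3,7)], of i j])

lemma beta2_symmetric: "beta2 M i k = beta2 M k i"
  using zeta2_equation[OF chi_H1(4), of i k] zeta2_equation[OF chi_H1(4), of k i]
    energy_commute[OF L2_fields(4,4), of i k] by (simp add: beta2_def avg_def)

lemma B1_antisymmetric: "B1 M i k l = - B1 M k i l"
proof -
  have "vol * B1 M i k l = (LINT y|lebesgue_on Y. beta M y * chi1 M k l y $ i) - (LINT y|lebesgue_on Y. beta M y * chi1 M i l y $ k)" for i k l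
    using chi1_equation[OF chi_H1(4), of i l k] zeta2_equation[OF chi_H1(1), of k i l]
      energy_commute[OF L2_fields(4,1), of k i l] by (simp add: B1_energy)
  then have "vol * (B1 M i k l + B1 M k i l) = 0" unfolding distrib_left by simp
  then show ?thesis using measure_Y_pos by simp
qed

text \<open>The loads \<open>k l\<close> and \<open>l k\<close> pose the same variational problem, and ellipticity determines
  the strain of its solution.\<close>

lemma chi1_strain_transpose:
  "AE y in lebesgue_on Y. cgrad M (chi1 M k l) i j y + cgrad M (chi1 M k l) j i y
     = cgrad M (chi1 M l k) i j y + cgrad M (chi1 M l k) j i y"
proof -
  let ?D = "grad_field (chi1 M k l)" and ?E = "grad_field (chi1 M l k)"
  define X where "X i j y = ?D i j y + (-1) * ?E i j y" for i j y
  have X_sum: "X = (\<lambda>i j y. \<Sum>b\<in>UNIV. (if b then 1 else - 1) * (if b then ?D else ?E) i j y)"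
    by (intro ext) (simp add: X_def UNIV_bool)
  have L: "L2_field (if b then ?D else ?E)" for b by (simp add: L2_fields)
  have XL: "L2_field X" unfolding X_sum by (rule L2_field_combination[OF L])
  have eq: "energy ?D (grad_field v) = energy ?E (grad_field v)" if "H1_per0 M v" for v
    using chi1_equation[OF that, of k l] chi1_equation[OF that, of l k]
      energy_unit_field_transpose[OF L2_grad_field[OF that], of k l] by simp
  have "energy X H = energy ?D H - energy ?E H" if "L2_field H" for H
    unfolding X_sum energy_combination_left[OF L that] by (simp add: UNIV_bool)
  moreover have "energy X X = energy X ?D - energy X ?E"
    unfolding X_sum energy_combination_right[OF L L2_field_combination[OF L]] by (simp add: UNIV_bool)
  ultimately have "energy X X = 0"
    using eq[OF chi_H1(1), of k l] eq[OF chi_H1(1), of l k] by (simp add: L2_fields)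
  moreover obtain \<kappa> where \<kappa>: "\<kappa> > 0" and coer: "\<And>G. L2_field G \<Longrightarrow>
    energy G G \<ge> \<kappa> * (\<Sum>i\<in>UNIV. \<Sum>j\<in>UNIV. LINT y|lebesgue_on Y. ((G i j y + G j i y) / 2)\<^sup>2)"
    using energy_coercive by blast
  moreover note coer[OF XL]
  ultimately have le: "(\<Sum>i\<in>UNIV. \<Sum>j\<in>UNIV. LINT y|lebesgue_on Y. ((X i j y + X j i y) / 2)\<^sup>2) \<le> 0"
    by (simp only: mult_le_0_iff) linarith
  have "(LINT y|lebesgue_on Y. ((X i j y + X j i y) / 2)\<^sup>2) \<le> (\<Sum>j\<in>UNIV. LINT y|lebesgue_on Y. ((X i j y + X j i y) / 2)\<^sup>2)"
    by (rule member_le_sum) auto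
  also have "\<dots> \<le> (\<Sum>i\<in>UNIV. \<Sum>j\<in>UNIV. LINT y|lebesgue_on Y. ((X i j y + X j i y) / 2)\<^sup>2)"
    by (rule member_le_sum[of i UNIV "\<lambda>i. \<Sum>j\<in>UNIV. LINT y|lebesgue_on Y. ((X i j y + X j i y) / 2)\<^sup>2"]) (auto intro!: sum_nonneg)
  finally have "(LINT y|lebesgue_on Y. ((X i j y + X j i y) / 2)\<^sup>2) \<le> 0" using le by simp
  moreover have "(LINT y|lebesgue_on Y. ((X i j y + X j i y) / 2)\<^sup>2) \<ge> 0" by simp
  ultimately have "(LINT y|lebesgue_on Y. ((X i j y + X j i y) / 2)\<^sup>2) = 0" by linarith
  moreover have "L2 Y (\<lambda>y. (X i j y + X j i y) / 2)" by (intro L2_divide L2_add L2_fieldD XL)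
  ultimately have "AE y in lebesgue_on Y. (X i j y + X j i y) / 2 = 0" by (rule L2_eq_0_AE[rotated])
  then show ?thesis by eventually_elim (simp add: X_def grad_field_def)
qed

text \<open>The second cell function is tested against the inertial one, so that the indices \<open>i\<close> and
  \<open>l\<close> remain only in the first cell function and its strain, where they may be interchanged.\<close>

lemma beta_chi2_transpose:
  "(LINT y|lebesgue_on Y. beta M y * chi2 M i l m y $ k) = (LINT y|lebesgue_on Y. beta M y * chi2 M l i m y $ k)"
proof -
  let ?Z = "grad_field (zeta2 M k)"
  have rep: "(LINT y|lebesgue_on Y. beta M y * chi2 M i l m y $ k)
      = energy (dyad_field (zeta2 M k) m) (grad_field (chi1 M i l)) + energy (dyad_field (zeta2 M k) m) (unit_field i l)
        - energy (dyad_field (chi1 M i l) m) ?Z" for i l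
    using zeta2_equation[OF chi_H1(2), of k i l m] chi2_equation[OF chi_H1(4), of i l m k]
      energy_commute[OF L2_fields(4,2), of k i l m] by (simp add: energy_add_right L2_fields)
  have "energy (dyad_field (zeta2 M k) m) (grad_field (chi1 M i l)) = energy (dyad_field (zeta2 M k) m) (grad_field (chi1 M l i))"
    using chi1_strain_transpose by (intro energy_strain_cong L2_fields) (simp add: grad_field_def)
  moreover have "energy (dyad_field (zeta2 M k) m) (unit_field i l) = energy (dyad_field (zeta2 M k) m) (unit_field l i)"
    using energy_unit_field_transpose[OF L2_fields(8), of i l k m] energy_commute[OF L2_fields(8,9)] by metis
  moreover have "energy (dyad_field (chi1 M i l) m) ?Z = energy (dyad_field (chi1 M l i) m) ?Z"
  proof -
    have S: "L2 Y (stress ?Z r m)" for r by (intro stress_L2 L2_fields)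
    have "(LINT y|lebesgue_on Y. chi1 M i l y $ r * stress ?Z r m y) = (LINT y|lebesgue_on Y. chi1 M l i y $ r * stress ?Z r m y)" for r
      by (rule LINT_eq_if_same_strain[OF chi_H1(1) chi_H1(1) S chi1_strain_transpose])
    then show ?thesis
      using L2_integrable_mult[OF L2_component[OF chi_H1(1)] S] by (simp add: energy_dyad_field)
  qed
  ultimately show ?thesis unfolding rep by simp
qed

text \<open>In the resulting representation the first and the last term are exchanged by the symmetry
  only after the first two indices of \<open>chi2\<close> have been interchanged in each of them.\<close>

lemma B2_symmetric: "B2 M i l k m = B2 M k m i l"
proof -
  have rep: "vol * B2 M i l k m = (LINT y|lebesgue_on Y. beta M y * chi2 M i l m y $ k)
      - (LINT y|lebesgue_on Y. (\<Sum>r\<in>UNIV. chi1 M i l y $ r * (beta M y * chi1 M k m y $ r)))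
      + (LINT y|lebesgue_on Y. beta M y * chi2 M m k l y $ i)" for i l k m
    using chi1_equation[OF chi_H1(5), of i l k m] zeta3_equation[OF chi_H1(1), of k m i l]
      zeta2_equation[OF chi_H1(2), of k i l m] chi2_equation[OF chi_H1(4), of i l m k]
      energy_commute[OF L2_fields(4,2), of k i l m] energy_commute[OF L2_fields(1,5), of i l k m]
      energy_commute[OF L2_fields(9,8), of i l k m]
    by (simp add: B2_energy energy_add_right L2_fields)
  have "(LINT y|lebesgue_on Y. (\<Sum>r\<in>UNIV. chi1 M i l y $ r * (beta M y * chi1 M k m y $ r)))
      = (LINT y|lebesgue_on Y. (\<Sum>r\<in>UNIV. chi1 M k m y $ r * (beta M y * chi1 M i l y $ r)))"
    by (simp add: mult_ac)
  then have "vol * B2 M i l k m = vol * B2 M k m i l"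
    unfolding rep using beta_chi2_transpose[of i l m k] beta_chi2_transpose[of m k l i] by simp
  then show ?thesis using measure_Y_pos by simp
qed

text \<open>The energy of \<open>\<epsilon>\<close> is that of the total strain, whose mean over the cell is \<open>\<epsilon>\<close> because a
  periodic gradient has mean zero; Jensen's inequality bounds it from below.\<close>

lemma C0_elliptic:
  obtains c where "c > 0" "\<And>\<epsilon>. (\<And>i j. \<epsilon> i j = \<epsilon> j i) \<Longrightarrow>
    (\<Sum>i\<in>UNIV. \<Sum>j\<in>UNIV. \<Sum>k\<in>UNIV. \<Sum>l\<in>UNIV. \<epsilon> i j * C0 M i j k l * \<epsilon> k l) \<ge> c * (\<Sum>i\<in>UNIV. \<Sum>j\<in>UNIV. (\<epsilon> i j)\<^sup>2)"
proof -
  obtain \<kappa> where \<kappa>: "\<kappa> > 0" and coer: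
    "\<And>G. L2_field G \<Longrightarrow> energy G G \<ge> \<kappa> * (\<Sum>i\<in>UNIV. \<Sum>j\<in>UNIV. LINT y|lebesgue_on Y. ((G i j y + G j i y) / 2)\<^sup>2)"
    using energy_coercive by blast
  have "(\<Sum>i\<in>UNIV. \<Sum>j\<in>UNIV. \<Sum>k\<in>UNIV. \<Sum>l\<in>UNIV. \<epsilon> i j * C0 M i j k l * \<epsilon> k l) \<ge> \<kappa> * (\<Sum>i\<in>UNIV. \<Sum>j\<in>UNIV. (\<epsilon> i j)\<^sup>2)"
    if sym: "\<And>i j. \<epsilon> i j = \<epsilon> j i" for \<epsilon>
  proof -
    define F where "F a = load1 (fst a) (snd a)" for a
    define c where "c a = \<epsilon> (fst a) (snd a)" for a
    define G where "G = (\<lambda>i j y. \<Sum>a\<in>UNIV. c a * F a i j y)"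
    have FL: "L2_field (F a)" for a unfolding F_def by (intro L2_field_add L2_fields)
    have GL: "L2_field G" unfolding G_def by (rule L2_field_combination[OF FL])
    have FF: "energy (F a) (F b) = vol * C0 M (fst a) (snd a) (fst b) (snd b)" for a b
    proof -
      have "energy (grad_field (chi1 M (fst a) (snd a))) (unit_field (fst b) (snd b))
          = - energy (grad_field (chi1 M (fst a) (snd a))) (grad_field (chi1 M (fst b) (snd b)))"
        using chi1_equation[OF chi_H1(1), of "fst b" "snd b" "fst a" "snd a"]
          energy_commute[OF L2_fields(9,1), of "fst b" "snd b" "fst a" "snd a"]
          energy_commute[OF L2_fields(1,1), of "fst b" "snd b" "fst a" "snd a"] by linarith
      moreover have "energy (unit_field (fst a) (snd a)) (grad_field (chi1 M (fst b) (snd b)))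
          = - energy (grad_field (chi1 M (fst a) (snd a))) (grad_field (chi1 M (fst b) (snd b)))"
        using chi1_equation[OF chi_H1(1), of "fst a" "snd a" "fst b" "snd b"] by simp
      ultimately show ?thesis
        unfolding F_def C0_representation by (simp add: energy_add_left energy_add_right L2_fields L2_field_add)
    qed
    have "energy G G = (\<Sum>a\<in>UNIV. c a * (\<Sum>b\<in>UNIV. c b * energy (F a) (F b)))"
      unfolding G_def energy_combination_left[OF FL L2_field_combination[OF FL]] energy_combination_right[OF FL FL] ..
    also have "\<dots> = vol * (\<Sum>i\<in>UNIV. \<Sum>j\<in>UNIV. \<Sum>k\<in>UNIV. \<Sum>l\<in>UNIV. \<epsilon> i j * C0 M i j k l * \<epsilon> k l)"
      by (simp add: FF c_def sum_UNIV_prod sum_distrib_left mult_ac)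
    finally have GG: "energy G G = vol * (\<Sum>i\<in>UNIV. \<Sum>j\<in>UNIV. \<Sum>k\<in>UNIV. \<Sum>l\<in>UNIV. \<epsilon> i j * C0 M i j k l * \<epsilon> k l)" .
    have meanF: "(LINT y|lebesgue_on Y. F a i j y) = vol * unit_field (fst a) (snd a) i j 0" for a i j
    proof -
      have "(LINT y|lebesgue_on Y. F a i j y) = (LINT y|lebesgue_on Y. cgrad M (chi1 M (fst a) (snd a)) i j y)
          + (LINT y|lebesgue_on Y. unit_field (fst a) (snd a) i j 0)"
        using L2_integrable[OF L2_fieldD[OF L2_fields(1)]]
        unfolding F_def add_field_def unit_field_def grad_field_def by simp
      then show ?thesis
        using LINT_cgrad_eq_0 chi_H1(1) by (simp add: H1_per0_def space_restrict_space measure_restrict_space)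
    qed
    have meanG: "(LINT y|lebesgue_on Y. G i j y) = vol * \<epsilon> i j" for i j
    proof -
      have "(LINT y|lebesgue_on Y. G i j y) = (\<Sum>a\<in>UNIV. c a * (vol * unit_field (fst a) (snd a) i j 0))"
        unfolding G_def using L2_integrable[OF L2_fieldD[OF FL]] by (simp add: meanF)
      also have "\<dots> = (\<Sum>k\<in>UNIV. of_bool (k = i) * (\<Sum>l\<in>UNIV. of_bool (l = j) * (vol * \<epsilon> k l)))"
        by (simp add: sum_UNIV_prod c_def unit_field_def sum_distrib_left mult_ac eq_commute)
      finally show ?thesis by (simp only: sum_of_bool_eq)
    qed
    have "vol * (\<epsilon> i j)\<^sup>2 \<le> (LINT y|lebesgue_on Y. ((G i j y + G j i y) / 2)\<^sup>2)" for i j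
    proof -
      have S: "L2 Y (\<lambda>y. (G i j y + G j i y) / 2)" by (intro L2_divide L2_add L2_fieldD GL)
      have "(LINT y|lebesgue_on Y. (G i j y + G j i y) / 2 * 1) = vol * \<epsilon> i j"
        using L2_integrable[OF L2_fieldD[OF GL]] by (simp add: meanG sym[of j i])
      then have "\<bar>vol * \<epsilon> i j\<bar> \<le> L2_norm Y (\<lambda>y. (G i j y + G j i y) / 2) * L2_norm Y (\<lambda>_. 1)"
        using L2_Cauchy_Schwarz[OF S L2_const, of 1] by simp
      from power_mono[OF this abs_ge_zero, of 2]
      have "(vol * \<epsilon> i j)\<^sup>2 \<le> (L2_norm Y (\<lambda>y. (G i j y + G j i y) / 2) * L2_norm Y (\<lambda>_. 1))\<^sup>2"
        by (simp only: power2_abs)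
      also have "\<dots> = (LINT y|lebesgue_on Y. ((G i j y + G j i y) / 2)\<^sup>2) * vol"
        unfolding power_mult_distrib L2_norm_square by (simp add: space_restrict_space measure_restrict_space)
      finally have "vol * (vol * (\<epsilon> i j)\<^sup>2) \<le> vol * (LINT y|lebesgue_on Y. ((G i j y + G j i y) / 2)\<^sup>2)"
        by (simp add: power_mult_distrib power2_eq_square mult_ac)
      then show ?thesis using measure_Y_pos by simp
    qed
    then have "\<kappa> * (\<Sum>i\<in>UNIV. \<Sum>j\<in>UNIV. vol * (\<epsilon> i j)\<^sup>2) \<le> energy G G"
      using \<kappa> by (intro order_trans[OF _ coer[OF GL]] mult_left_mono sum_mono) auto
    then have "vol * (\<kappa> * (\<Sum>i\<in>UNIV. \<Sum>j\<in>UNIV. (\<epsilon> i j)\<^sup>2))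
        \<le> vol * (\<Sum>i\<in>UNIV. \<Sum>j\<in>UNIV. \<Sum>k\<in>UNIV. \<Sum>l\<in>UNIV. \<epsilon> i j * C0 M i j k l * \<epsilon> k l)"
      unfolding GG by (simp add: sum_distrib_left mult_ac)
    then show ?thesis using measure_Y_pos by simp
  qed
  with \<kappa> that show ?thesis by blast
qed

end

section \<open>Coercivity of the quadratic forms\<close>

lemma bilinear_bound:
  fixes B :: "'a::finite \<Rightarrow> 'b::finite \<Rightarrow> real"
  obtains K where "K \<ge> 0" "\<And>f g. \<bar>\<Sum>x\<in>UNIV. \<Sum>y\<in>UNIV. f x * B x y * g y\<bar> \<le> K * (L2_set f UNIV * L2_set g UNIV)"
proof
  let ?K = "\<Sum>x\<in>UNIV. \<Sum>y\<in>UNIV. \<bar>B x y\<bar>"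
  show "?K \<ge> 0" by (intro sum_nonneg) simp
  have le: "\<bar>f x\<bar> \<le> L2_set f UNIV" for f :: "'c::finite \<Rightarrow> real" and x
    using member_le_L2_set[of UNIV x "\<lambda>x. \<bar>f x\<bar>"] by (simp add: L2_set_def)
  show "\<bar>\<Sum>x\<in>UNIV. \<Sum>y\<in>UNIV. f x * B x y * g y\<bar> \<le> ?K * (L2_set f UNIV * L2_set g UNIV)" for f g
  proof -
    have "\<bar>f x * B x y * g y\<bar> \<le> \<bar>B x y\<bar> * (L2_set f UNIV * L2_set g UNIV)" for x y
    proof -
      have "\<bar>f x\<bar> * \<bar>g y\<bar> \<le> L2_set f UNIV * L2_set g UNIV" by (intro mult_mono le) auto
      then have "\<bar>B x y\<bar> * (\<bar>f x\<bar> * \<bar>g y\<bar>) \<le> \<bar>B x y\<bar> * (L2_set f UNIV * L2_set g UNIV)"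
        by (rule mult_left_mono) simp
      then show ?thesis by (simp add: abs_mult mult.commute mult.left_commute)
    qed
    then show ?thesis
      unfolding sum_distrib_right by (intro order_trans[OF sum_abs] sum_mono)
  qed
qed

text \<open>The indefinite coupling term is absorbed by Young's inequality as soon as the weight is
  large. Since the cell size enters only through the product \<open>ell * H\<close>, the threshold does not
  depend on it.\<close>

lemma weighted_form_lower_bound:
  fixes c :: real
  assumes c: "c > 0" and \<theta>: "\<theta> \<ge> (K' + K\<^sup>2 / (2 * c)) / c + 1" and ell: "ell > 0"
    and a: "a \<ge> c * E\<^sup>2" and b: "\<bar>b\<bar> \<le> K * (E * H)" and q: "q \<ge> (\<theta> * c - K') * H\<^sup>2"
  shows "a + ell * b + ell\<^sup>2 * q \<ge> c / 2 * (E\<^sup>2 + ell\<^sup>2 * H\<^sup>2)"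
proof -
  have young: "K * (E * (ell * H)) \<le> c / 2 * E\<^sup>2 + K\<^sup>2 / (2 * c) * (ell * H)\<^sup>2"
  proof -
    have "0 \<le> (c * E - K * (ell * H))\<^sup>2 / (2 * c)" using c by simp
    also have "\<dots> = c / 2 * E\<^sup>2 + K\<^sup>2 / (2 * c) * (ell * H)\<^sup>2 - K * (E * (ell * H))"
      using c by (simp add: power2_eq_square field_simps)
    finally show ?thesis by simp
  qed
  have "ell * b \<ge> - (K * (E * (ell * H)))"
  proof -
    have "ell * \<bar>b\<bar> \<le> ell * (K * (E * H))" using b ell by (intro mult_left_mono) auto
    moreover have "ell * - \<bar>b\<bar> \<le> ell * b" using ell by (intro mult_left_mono) auto
    ultimately show ?thesis by (simp add: mult_ac)
  qed
  moreover have "ell\<^sup>2 * q \<ge> ell\<^sup>2 * ((\<theta> * c - K') * H\<^sup>2)" using q by (intro mult_left_mono) auto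
  moreover have "ell\<^sup>2 * ((\<theta> * c - K') * H\<^sup>2) \<ge> (K\<^sup>2 / (2 * c) + c) * (ell * H)\<^sup>2"
  proof -
    have "((K' + K\<^sup>2 / (2 * c)) / c + 1) * c \<le> \<theta> * c" using \<theta> c by (intro mult_right_mono) auto
    moreover have "((K' + q) / c + 1) * c = K' + q + c" for q using c by (simp add: field_simps)
    ultimately have "\<theta> * c - K' \<ge> K\<^sup>2 / (2 * c) + c" by simp
    then have "(K\<^sup>2 / (2 * c) + c) * (ell * H)\<^sup>2 \<le> (\<theta> * c - K') * (ell * H)\<^sup>2" by (intro mult_right_mono) auto
    then show ?thesis by (simp add: power_mult_distrib mult_ac)
  qed
  moreover have "c / 2 * (E\<^sup>2 + ell\<^sup>2 * H\<^sup>2) = c / 2 * E\<^sup>2 + c / 2 * (ell * H)\<^sup>2"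
    by (simp add: power_mult_distrib algebra_simps)
  moreover have "c / 2 * (ell * H)\<^sup>2 \<le> c * (ell * H)\<^sup>2" using c by (intro mult_right_mono) auto
  ultimately show ?thesis using a young unfolding distrib_right by linarith
qed

context periodic_medium
begin

text \<open>The weight multiplies the form of \<open>C0\<close>, which is elliptic on each slice of \<open>\<eta>\<close> with
  fixed last index; the remaining part of \<open>A2\<close> is bounded.\<close>

lemma e_form_coercive:
  obtains \<theta>e c where "\<theta>e > 0" "c > 0"
    "\<And>\<theta> ell \<epsilon> \<eta>. \<theta> > \<theta>e \<Longrightarrow> ell > 0 \<Longrightarrow> (\<And>i j. \<epsilon> i j = \<epsilon> j i) \<Longrightarrow> (\<And>i j n. \<eta> i j n = \<eta> j i n) \<Longrightarrow>
      e_form M ell \<theta> \<epsilon> \<eta> \<ge> c * ((\<Sum>i\<in>UNIV. \<Sum>j\<in>UNIV. (\<epsilon> i j)\<^sup>2) + ell\<^sup>2 * (\<Sum>i\<in>UNIV. \<Sum>j\<in>UNIV. \<Sum>n\<in>UNIV. (\<eta> i j n)\<^sup>2))"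
proof -
  obtain c where c: "c > 0" and el: "\<And>\<epsilon>. (\<And>i j. \<epsilon> i j = \<epsilon> j i) \<Longrightarrow>
    (\<Sum>i\<in>UNIV. \<Sum>j\<in>UNIV. \<Sum>k\<in>UNIV. \<Sum>l\<in>UNIV. \<epsilon> i j * C0 M i j k l * \<epsilon> k l) \<ge> c * (\<Sum>i\<in>UNIV. \<Sum>j\<in>UNIV. (\<epsilon> i j)\<^sup>2)"
    using C0_elliptic by blast
  define D where "D i j n k p m = - C2 M i j n k p m
     + (\<Sum>(a,b)\<in>UNIV. beta2 M b a * C0 M a n i j * C0 M b m k p)" for i j n k p m
  obtain K where K: "K \<ge> 0" and bK: "\<And>f g. \<bar>\<Sum>x\<in>UNIV. \<Sum>y\<in>UNIV. f x * (case x of (i, j) \<Rightarrow> case y of (k, p, m) \<Rightarrow> C1 M i j k p m) * g y\<bar>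
      \<le> K * (L2_set f UNIV * L2_set g UNIV)"
    using bilinear_bound[of "\<lambda>x y. case x of (i, j) \<Rightarrow> case y of (k, p, m) \<Rightarrow> C1 M i j k p m"] by blast
  obtain K' where K': "K' \<ge> 0" and bK': "\<And>f g. \<bar>\<Sum>x\<in>UNIV. \<Sum>y\<in>UNIV. f x * (case x of (i, j, n) \<Rightarrow> case y of (k, p, m) \<Rightarrow> D i j n k p m) * g y\<bar>
      \<le> K' * (L2_set f UNIV * L2_set g UNIV)"
    using bilinear_bound[of "\<lambda>x y. case x of (i, j, n) \<Rightarrow> case y of (k, p, m) \<Rightarrow> D i j n k p m"] by blast
  define \<theta>e where "\<theta>e = (K' + K\<^sup>2 / (2 * c)) / c + 1"
  have pos: "\<theta>e > 0" using K' c by (simp add: \<theta>e_def add_nonneg_pos)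
  have "e_form M ell \<theta> \<epsilon> \<eta> \<ge> c / 4 * ((\<Sum>i\<in>UNIV. \<Sum>j\<in>UNIV. (\<epsilon> i j)\<^sup>2) + ell\<^sup>2 * (\<Sum>i\<in>UNIV. \<Sum>j\<in>UNIV. \<Sum>n\<in>UNIV. (\<eta> i j n)\<^sup>2))"
    if \<theta>: "\<theta> > \<theta>e" and ell: "ell > 0" and sym: "\<And>i j. \<epsilon> i j = \<epsilon> j i" "\<And>i j n. \<eta> i j n = \<eta> j i n"
    for \<theta> ell \<epsilon> \<eta>
  proof -
    define f where "f = (\<lambda>(i, j). \<epsilon> i j)"
    define g where "g = (\<lambda>(i, j, n). \<eta> i j n)"
    define a where "a = (\<Sum>i\<in>UNIV. \<Sum>j\<in>UNIV. \<Sum>k\<in>UNIV. \<Sum>l\<in>UNIV. \<epsilon> i j * C0 M i j k l * \<epsilon> k l)"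
    define b where "b = (\<Sum>x\<in>UNIV. \<Sum>y\<in>UNIV. f x * (case x of (i, j) \<Rightarrow> case y of (k, p, m) \<Rightarrow> C1 M i j k p m) * g y)"
    define r where "r = (\<Sum>x\<in>UNIV. \<Sum>y\<in>UNIV. g x * (case x of (i, j, n) \<Rightarrow> case y of (k, p, m) \<Rightarrow> D i j n k p m) * g y)"
    define s where "s = (\<Sum>n\<in>UNIV. \<Sum>i\<in>UNIV. \<Sum>j\<in>UNIV. \<Sum>k\<in>UNIV. \<Sum>l\<in>UNIV. \<eta> i j n * C0 M i j k l * \<eta> k l n)"
    have E: "(L2_set f UNIV)\<^sup>2 = (\<Sum>i\<in>UNIV. \<Sum>j\<in>UNIV. (\<epsilon> i j)\<^sup>2)"
      by (simp add: L2_set_def sum_nonneg f_def sum_UNIV_prod)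
    have H: "(L2_set g UNIV)\<^sup>2 = (\<Sum>i\<in>UNIV. \<Sum>j\<in>UNIV. \<Sum>n\<in>UNIV. (\<eta> i j n)\<^sup>2)"
      by (simp add: L2_set_def sum_nonneg g_def sum_UNIV_prod)
    have cycle: "(\<Sum>i\<in>UNIV. \<Sum>j\<in>UNIV. \<Sum>n\<in>UNIV. X i j n) = (\<Sum>n\<in>UNIV. \<Sum>i\<in>UNIV. \<Sum>j\<in>UNIV. X i j n)"
      for X :: "'d \<Rightarrow> 'd \<Rightarrow> 'd \<Rightarrow> real"
    proof -
      have "(\<Sum>i\<in>UNIV. \<Sum>j\<in>UNIV. \<Sum>n\<in>UNIV. X i j n) = (\<Sum>i\<in>UNIV. \<Sum>n\<in>UNIV. \<Sum>j\<in>UNIV. X i j n)"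
        by (intro sum.cong refl sum.swap)
      also have "\<dots> = (\<Sum>n\<in>UNIV. \<Sum>i\<in>UNIV. \<Sum>j\<in>UNIV. X i j n)" by (rule sum.swap)
      finally show ?thesis .
    qed
    have "(\<Sum>(i,j,n,k,p,m)\<in>UNIV. \<eta> i j n * A2 M \<theta> i j n k p m * \<eta> k p m)
        = (\<Sum>i\<in>UNIV. \<Sum>j\<in>UNIV. \<Sum>n\<in>UNIV. \<Sum>k\<in>UNIV. \<Sum>p\<in>UNIV. \<Sum>m\<in>UNIV.
            \<theta> * (\<eta> i j n * C0 M i j k p * (of_bool (m = n) * \<eta> k p m)) + \<eta> i j n * D i j n k p m * \<eta> k p m)"
      unfolding sum_UNIV_prod by (simp add: A2_def D_def algebra_simps eq_commute)
    also have "\<dots> = \<theta> * (\<Sum>i\<in>UNIV. \<Sum>j\<in>UNIV. \<Sum>n\<in>UNIV. \<Sum>k\<in>UNIV. \<Sum>p\<in>UNIV. \<eta> i j n * C0 M i j k p * \<eta> k p n) + r"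
      unfolding sum.distrib sum_distrib_left[symmetric] sum_of_bool_eq
      by (simp add: r_def g_def sum_UNIV_prod)
    also have "\<dots> = \<theta> * s + r" unfolding cycle[of "\<lambda>i j n. \<Sum>k\<in>UNIV. \<Sum>p\<in>UNIV. \<eta> i j n * C0 M i j k p * \<eta> k p n"] s_def ..
    finally have q: "(\<Sum>(i,j,n,k,p,m)\<in>UNIV. \<eta> i j n * A2 M \<theta> i j n k p m * \<eta> k p m) = \<theta> * s + r" .
    have e: "2 * e_form M ell \<theta> \<epsilon> \<eta> = a + ell * b + ell\<^sup>2 * (\<theta> * s + r)"
      unfolding e_form_def q by (simp add: a_def b_def f_def g_def sum_UNIV_prod)
    have "s \<ge> (\<Sum>n\<in>UNIV. c * (\<Sum>i\<in>UNIV. \<Sum>j\<in>UNIV. (\<eta> i j n)\<^sup>2))"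
      unfolding s_def by (intro sum_mono el sym(2))
    then have "s \<ge> c * (L2_set g UNIV)\<^sup>2"
      unfolding H cycle[of "\<lambda>i j n. (\<eta> i j n)\<^sup>2"] by (simp add: sum_distrib_left)
    moreover have "r \<ge> - (K' * (L2_set g UNIV)\<^sup>2)"
      using bK'[of g g] by (simp add: r_def power2_eq_square)
    moreover have "\<theta> * (c * (L2_set g UNIV)\<^sup>2) \<le> \<theta> * s"
      using \<open>s \<ge> c * (L2_set g UNIV)\<^sup>2\<close> \<theta> pos by (intro mult_left_mono) auto
    ultimately have "\<theta> * s + r \<ge> (\<theta> * c - K') * (L2_set g UNIV)\<^sup>2"
      unfolding left_diff_distrib mult.assoc by linarith
    moreover have "a \<ge> c * (L2_set f UNIV)\<^sup>2" unfolding E a_def by (rule el[OF sym(1)])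
    moreover have "\<bar>b\<bar> \<le> K * (L2_set f UNIV * L2_set g UNIV)" unfolding b_def by (rule bK)
    ultimately have "a + ell * b + ell\<^sup>2 * (\<theta> * s + r) \<ge> c / 2 * ((L2_set f UNIV)\<^sup>2 + ell\<^sup>2 * (L2_set g UNIV)\<^sup>2)"
      using weighted_form_lower_bound[OF c, of K' K \<theta> ell] \<theta> ell unfolding \<theta>e_def by simp
    then show ?thesis using e unfolding E H by simp
  qed
  with pos c show ?thesis by (intro that[of \<theta>e "c / 4"]) auto
qed

lemma k_form_coercive:
  obtains \<theta>k c where "\<theta>k > 0" "c > 0"
    "\<And>\<theta> ell u \<gamma>. \<theta> > \<theta>k \<Longrightarrow> ell > 0 \<Longrightarrow>
      k_form M ell \<theta> u \<gamma> \<ge> c * ((\<Sum>i\<in>UNIV. (u i)\<^sup>2) + ell\<^sup>2 * (\<Sum>i\<in>UNIV. \<Sum>p\<in>UNIV. (\<gamma> i p)\<^sup>2))"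
proof -
  define D where "D i l k m = - B2 M i l k m
     + (\<Sum>a\<in>UNIV. beta2 M i a * C0 M a l k m) + (\<Sum>a\<in>UNIV. beta2 M k a * C0 M a m i l)" for i l k m
  obtain K where K: "K \<ge> 0" and bK: "\<And>f g. \<bar>\<Sum>i\<in>UNIV. \<Sum>y\<in>UNIV. f i * (case y of (k, p) \<Rightarrow> B1 M i k p) * g y\<bar>
      \<le> K * (L2_set f UNIV * L2_set g UNIV)"
    using bilinear_bound[of "\<lambda>i y. case y of (k, p) \<Rightarrow> B1 M i k p"] by blast
  obtain K' where K': "K' \<ge> 0" and bK': "\<And>f g. \<bar>\<Sum>x\<in>UNIV. \<Sum>y\<in>UNIV. f x * (case x of (i, p) \<Rightarrow> case y of (k, m) \<Rightarrow> D i p k m) * g y\<bar>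
      \<le> K' * (L2_set f UNIV * L2_set g UNIV)"
    using bilinear_bound[of "\<lambda>x y. case x of (i, p) \<Rightarrow> case y of (k, m) \<Rightarrow> D i p k m"] by blast
  define \<theta>k where "\<theta>k = (K' + K\<^sup>2 / (2 * 1)) / 1 + 1"
  have pos: "\<theta>k > 0" using K' by (simp add: \<theta>k_def add_nonneg_pos)
  have "k_form M ell \<theta> u \<gamma> \<ge> rho0 M / 4 * ((\<Sum>i\<in>UNIV. (u i)\<^sup>2) + ell\<^sup>2 * (\<Sum>i\<in>UNIV. \<Sum>p\<in>UNIV. (\<gamma> i p)\<^sup>2))"
    if \<theta>: "\<theta> > \<theta>k" and ell: "ell > 0" for \<theta> ell u \<gamma>
  proof -
    define g where "g = (\<lambda>(i, p). \<gamma> i p)"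
    define b where "b = (\<Sum>i\<in>UNIV. \<Sum>y\<in>UNIV. u i * (case y of (k, p) \<Rightarrow> B1 M i k p) * g y)"
    define r where "r = (\<Sum>x\<in>UNIV. \<Sum>y\<in>UNIV. g x * (case x of (i, p) \<Rightarrow> case y of (k, m) \<Rightarrow> D i p k m) * g y)"
    have E: "(L2_set u UNIV)\<^sup>2 = (\<Sum>i\<in>UNIV. (u i)\<^sup>2)"
      by (simp add: L2_set_def sum_nonneg)
    have H: "(L2_set g UNIV)\<^sup>2 = (\<Sum>i\<in>UNIV. \<Sum>p\<in>UNIV. (\<gamma> i p)\<^sup>2)"
      by (simp add: L2_set_def sum_nonneg g_def sum_UNIV_prod)
    have "(\<Sum>(i,p,k,m)\<in>UNIV. \<gamma> i p * J2 M \<theta> i p k m * \<gamma> k m)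
        = (\<Sum>i\<in>UNIV. \<Sum>p\<in>UNIV. \<Sum>k\<in>UNIV. \<Sum>m\<in>UNIV.
            \<theta> * (\<gamma> i p * (of_bool (k = i) * (of_bool (m = p) * \<gamma> k m))) + \<gamma> i p * D i p k m * \<gamma> k m)"
      unfolding sum_UNIV_prod by (simp add: J2_def D_def algebra_simps eq_commute)
    also have "\<dots> = \<theta> * (L2_set g UNIV)\<^sup>2 + r"
      unfolding sum.distrib sum_distrib_left[symmetric] sum_of_bool_eq H
      by (simp add: r_def g_def sum_UNIV_prod power2_eq_square)
    finally have q: "(\<Sum>(i,p,k,m)\<in>UNIV. \<gamma> i p * J2 M \<theta> i p k m * \<gamma> k m) = \<theta> * (L2_set g UNIV)\<^sup>2 + r" .
    have k: "2 * k_form M ell \<theta> u \<gamma> = rho0 M * ((\<Sum>i\<in>UNIV. (u i)\<^sup>2) + ell * b + ell\<^sup>2 * (\<theta> * (L2_set g UNIV)\<^sup>2 + r))"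
      unfolding k_form_def q by (simp add: b_def g_def sum_UNIV_prod)
    have "r \<ge> - (K' * (L2_set g UNIV)\<^sup>2)"
      using bK'[of g g] by (simp add: r_def power2_eq_square)
    then have "\<theta> * (L2_set g UNIV)\<^sup>2 + r \<ge> (\<theta> * 1 - K') * (L2_set g UNIV)\<^sup>2"
      by (simp add: algebra_simps)
    moreover have "(\<Sum>i\<in>UNIV. (u i)\<^sup>2) \<ge> 1 * (L2_set u UNIV)\<^sup>2" unfolding E by simp
    moreover have "\<bar>b\<bar> \<le> K * (L2_set u UNIV * L2_set g UNIV)" unfolding b_def by (rule bK)
    ultimately have "(\<Sum>i\<in>UNIV. (u i)\<^sup>2) + ell * b + ell\<^sup>2 * (\<theta> * (L2_set g UNIV)\<^sup>2 + r)
        \<ge> 1 / 2 * ((L2_set u UNIV)\<^sup>2 + ell\<^sup>2 * (L2_set g UNIV)\<^sup>2)"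
      using weighted_form_lower_bound[of 1 K' K \<theta> ell] \<theta> ell unfolding \<theta>k_def by simp
    from mult_left_mono[OF this, of "rho0 M"]
    have "rho0 M * (1 / 2 * ((\<Sum>i\<in>UNIV. (u i)\<^sup>2) + ell\<^sup>2 * (\<Sum>i\<in>UNIV. \<Sum>p\<in>UNIV. (\<gamma> i p)\<^sup>2))) \<le> 2 * k_form M ell \<theta> u \<gamma>"
      using k rho0_pos unfolding E H by linarith
    then show ?thesis by (simp add: field_simps)
  qed
  with pos rho0_pos show ?thesis by (intro that[of \<theta>k "rho0 M / 4"]) auto
qed

end

section \<open>Fourier symbols\<close>

lemma sum_words_Suc:
  fixes F :: "('d::finite) list \<Rightarrow> 'b::comm_monoid_add"
  shows "(\<Sum>w | length w = Suc n. F w) = (\<Sum>j\<in>UNIV. \<Sum>w | length w = n. F (j # w))"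
proof -
  have "bij_betw (\<lambda>(j, w). j # w) (UNIV \<times> {w. length w = n}) {w::'d list. length w = Suc n}"
    by (auto simp: bij_betw_def inj_on_def image_iff length_Suc_conv)
  from sum.reindex_bij_betw[OF this, of F] show ?thesis
    by (simp add: sum.cartesian_product split_beta')
qed

lemma sum_words_0: "(\<Sum>w | length w = 0. F w) = F []"
  by (simp add: Collect_conv_if)

lemma finite_words: "finite {w :: ('d::finite) list. length w = n}"
  using finite_lists_length_eq[of "UNIV :: 'd set" n] by simp

lemma sum_words_numeral:
  fixes F :: "('d::finite) list \<Rightarrow> 'b::comm_monoid_add"
  shows "(\<Sum>w | length w = 1. F w) = (\<Sum>j\<in>UNIV. F [j])"
    "(\<Sum>w | length w = 2. F w) = (\<Sum>j\<in>UNIV. \<Sum>l\<in>UNIV. F [j, l])"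
    "(\<Sum>w | length w = 3. F w) = (\<Sum>j\<in>UNIV. \<Sum>l\<in>UNIV. \<Sum>m\<in>UNIV. F [j, l, m])"
    "(\<Sum>w | length w = 4. F w) = (\<Sum>j\<in>UNIV. \<Sum>n\<in>UNIV. \<Sum>l\<in>UNIV. \<Sum>m\<in>UNIV. F [j, n, l, m])"
proof -
  have n: "(1::nat) = Suc 0" "(2::nat) = Suc (Suc 0)" "(3::nat) = Suc (Suc (Suc 0))"
    "(4::nat) = Suc (Suc (Suc (Suc 0)))" by simp_all
  show "(\<Sum>w | length w = 1. F w) = (\<Sum>j\<in>UNIV. F [j])"
    unfolding n sum_words_Suc sum_words_0 ..
  show "(\<Sum>w | length w = 2. F w) = (\<Sum>j\<in>UNIV. \<Sum>l\<in>UNIV. F [j, l])"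
    unfolding n sum_words_Suc sum_words_0 ..
  show "(\<Sum>w | length w = 3. F w) = (\<Sum>j\<in>UNIV. \<Sum>l\<in>UNIV. \<Sum>m\<in>UNIV. F [j, l, m])"
    unfolding n sum_words_Suc sum_words_0 ..
  show "(\<Sum>w | length w = 4. F w) = (\<Sum>j\<in>UNIV. \<Sum>n\<in>UNIV. \<Sum>l\<in>UNIV. \<Sum>m\<in>UNIV. F [j, n, l, m])"
    unfolding n sum_words_Suc sum_words_0 ..
qed

text \<open>A sum over the support of a polynomial may be taken over all words of the lengths that
  occur in it.\<close>

lemma sum_support_words:
  fixes F :: "('d::finite) list \<Rightarrow> 'b::comm_monoid_add"
  assumes N: "finite N" "\<And>w. P w \<noteq> 0 \<Longrightarrow> length w \<in> N" and F: "\<And>w. P w = 0 \<Longrightarrow> F w = 0"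
  shows "(\<Sum>w | P w \<noteq> 0. F w) = (\<Sum>n\<in>N. \<Sum>w | length w = n. F w)"
proof -
  have eq: "(\<Union>n\<in>N. {w :: 'd list. length w = n}) = {w. length w \<in> N}" by auto
  have "finite {w :: 'd list. length w \<in> N}" unfolding eq[symmetric] using N(1) by (intro finite_UN_I finite_words)
  then have "(\<Sum>w | P w \<noteq> 0. F w) = (\<Sum>w | length w \<in> N. F w)"
    using N(2) F by (intro sum.mono_neutral_left) auto
  also have "\<dots> = (\<Sum>n\<in>N. \<Sum>w | length w = n. F w)"
    unfolding eq[symmetric] by (intro sum.UNION_disjoint) (auto simp: N(1) finite_words)
  finally show ?thesis .
qed

lemma Q_poly_support: "Q_poly M ell \<theta> w \<noteq> 0 \<Longrightarrow> length w \<in> {2, 3, 4}"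
  by (cases "(M, ell, \<theta>, w)" rule: Q_poly.cases) auto

lemma R_poly_support: "R_poly M ell \<theta> w \<noteq> 0 \<Longrightarrow> length w \<in> {0, 1, 2}"
  by (cases "(M, ell, \<theta>, w)" rule: R_poly.cases) auto

lemma sum_Q_poly:
  fixes F :: "('d::finite) list \<Rightarrow> 'b::comm_monoid_add"
  assumes "\<And>w. Q_poly M ell \<theta> w = 0 \<Longrightarrow> F w = 0"
  shows "(\<Sum>w | Q_poly M ell \<theta> w \<noteq> 0. F w) = (\<Sum>j\<in>UNIV. \<Sum>l\<in>UNIV. F [j, l])
    + ((\<Sum>j\<in>UNIV. \<Sum>l\<in>UNIV. \<Sum>m\<in>UNIV. F [j, l, m]) + (\<Sum>j\<in>UNIV. \<Sum>n\<in>UNIV. \<Sum>l\<in>UNIV. \<Sum>m\<in>UNIV. F [j, n, l, m]))"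
  by (subst sum_support_words[of "{2, 3, 4}", OF _ Q_poly_support assms]) (simp_all add: sum_words_numeral)

lemma sum_R_poly:
  fixes F :: "('d::finite) list \<Rightarrow> 'b::comm_monoid_add"
  assumes "\<And>w. R_poly M ell \<theta> w = 0 \<Longrightarrow> F w = 0"
  shows "(\<Sum>w | R_poly M ell \<theta> w \<noteq> 0. F w) = F [] + ((\<Sum>l\<in>UNIV. F [l]) + (\<Sum>l\<in>UNIV. \<Sum>m\<in>UNIV. F [l, m]))"
  by (subst sum_support_words[of "{0, 1, 2}", OF _ R_poly_support assms])
    (simp_all add: sum_words_numeral sum_words_numeral(1)[unfolded One_nat_def] sum_words_0[unfolded length_0_conv])

lemma sum_cycle3:
  "(\<Sum>i\<in>A. \<Sum>j\<in>B. \<Sum>n\<in>C. X i j n) = (\<Sum>n\<in>C. \<Sum>i\<in>A. \<Sum>j\<in>B. X i j n)"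
proof -
  have "(\<Sum>i\<in>A. \<Sum>j\<in>B. \<Sum>n\<in>C. X i j n) = (\<Sum>i\<in>A. \<Sum>n\<in>C. \<Sum>j\<in>B. X i j n)"
    by (intro sum.cong refl sum.swap)
  also have "\<dots> = (\<Sum>n\<in>C. \<Sum>i\<in>A. \<Sum>j\<in>B. X i j n)" by (rule sum.swap)
  finally show ?thesis .
qed

lemma Q_op_eq_mpoly_op: "Q_op M ell \<theta> U = mpoly_op (Q_poly M ell \<theta>) U"
proof (intro ext iffD2[OF vec_eq_iff] allI)
  fix x i
  have "mpoly_op (Q_poly M ell \<theta>) U x $ i
      = (\<Sum>w | Q_poly M ell \<theta> w \<noteq> 0. \<Sum>k\<in>UNIV. Q_poly M ell \<theta> w $ i $ k * foldr pd w (\<lambda>x. U x $ k) x)"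
    by (simp add: mpoly_op_def matrix_vector_mult_def)
  also have "\<dots> = (\<Sum>j\<in>UNIV. \<Sum>l\<in>UNIV. \<Sum>k\<in>UNIV. - C0 M i j k l * pd j (pd l (\<lambda>x. U x $ k)) x)
      + ((\<Sum>j\<in>UNIV. \<Sum>l\<in>UNIV. \<Sum>m\<in>UNIV. \<Sum>k\<in>UNIV. - ell * C1 M i j k l m * pd j (pd l (pd m (\<lambda>x. U x $ k))) x)
      + (\<Sum>j\<in>UNIV. \<Sum>n\<in>UNIV. \<Sum>l\<in>UNIV. \<Sum>m\<in>UNIV. \<Sum>k\<in>UNIV.
           ell\<^sup>2 * A2 M \<theta> i j n k l m * pd j (pd n (pd l (pd m (\<lambda>x. U x $ k)))) x))"
    by (subst sum_Q_poly) (simp_all add: o_def)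
  also have "\<dots> = (\<Sum>j\<in>UNIV. \<Sum>k\<in>UNIV. \<Sum>l\<in>UNIV. - C0 M i j k l * pd j (pd l (\<lambda>x. U x $ k)) x)
      + ((\<Sum>j\<in>UNIV. \<Sum>k\<in>UNIV. \<Sum>l\<in>UNIV. \<Sum>m\<in>UNIV. - ell * C1 M i j k l m * pd j (pd l (pd m (\<lambda>x. U x $ k))) x)
      + (\<Sum>j\<in>UNIV. \<Sum>n\<in>UNIV. \<Sum>k\<in>UNIV. \<Sum>l\<in>UNIV. \<Sum>m\<in>UNIV.
           ell\<^sup>2 * A2 M \<theta> i j n k l m * pd j (pd n (pd l (pd m (\<lambda>x. U x $ k)))) x))"
    by (intro arg_cong2[where f = "(+)"] sum.cong refl sum.swap sum_cycle3)
  also have "\<dots> = Q_op M ell \<theta> U x $ i"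
    by (simp add: Q_op_def sum_UNIV_prod sum_negf sum_distrib_left mult.assoc)
  finally show "Q_op M ell \<theta> U x $ i = mpoly_op (Q_poly M ell \<theta>) U x $ i" ..
qed

lemma R_op_eq_mpoly_op: "R_op M ell \<theta> U = mpoly_op (R_poly M ell \<theta>) U"
proof (intro ext iffD2[OF vec_eq_iff] allI)
  fix x i
  have "mpoly_op (R_poly M ell \<theta>) U x $ i
      = (\<Sum>w | R_poly M ell \<theta> w \<noteq> 0. \<Sum>k\<in>UNIV. R_poly M ell \<theta> w $ i $ k * foldr pd w (\<lambda>x. U x $ k) x)"
    by (simp add: mpoly_op_def matrix_vector_mult_def)
  also have "\<dots> = (\<Sum>k\<in>UNIV. rho0 M * (of_bool (k = i) * U x $ k))
      + ((\<Sum>l\<in>UNIV. \<Sum>k\<in>UNIV. rho0 M * ell * B1 M i k l * pd l (\<lambda>x. U x $ k) x)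
      + (\<Sum>l\<in>UNIV. \<Sum>m\<in>UNIV. \<Sum>k\<in>UNIV. - rho0 M * ell\<^sup>2 * J2 M \<theta> i l k m * pd l (pd m (\<lambda>x. U x $ k)) x))"
    by (subst sum_R_poly) (simp_all add: o_def eq_commute[of i] mult.assoc)
  also have "\<dots> = rho0 M * U x $ i
      + ((\<Sum>k\<in>UNIV. \<Sum>l\<in>UNIV. rho0 M * ell * B1 M i k l * pd l (\<lambda>x. U x $ k) x)
      + (\<Sum>k\<in>UNIV. \<Sum>l\<in>UNIV. \<Sum>m\<in>UNIV. - rho0 M * ell\<^sup>2 * J2 M \<theta> i l k m * pd l (pd m (\<lambda>x. U x $ k)) x))"
    unfolding sum_distrib_left[symmetric] sum_of_bool_eq
    by (intro arg_cong2[where f = "(+)"] refl sum.swap sum_cycle3)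
  also have "\<dots> = R_op M ell \<theta> U x $ i"
    by (simp add: R_op_def sum_UNIV_prod sum_negf sum_distrib_left distrib_left right_diff_distrib mult.assoc)
  finally show "R_op M ell \<theta> U x $ i = mpoly_op (R_poly M ell \<theta>) U x $ i" ..
qed

text \<open>The real part of \<open>z\<^sup>* (P + \<i> N) z\<close> for \<open>z = a + \<i> b\<close>.\<close>

lemma hermitian_pos_def_Complex:
  assumes H: "\<And>i k. H $ i $ k = Complex (P i k) (N i k)"
    and P: "\<And>i k. P i k = P k i" and N: "\<And>i k. N i k = - N k i"
    and pos: "\<And>a b. (\<exists>i. a i \<noteq> 0 \<or> b i \<noteq> 0) \<Longrightarrow>
      (\<Sum>i\<in>UNIV. \<Sum>k\<in>UNIV. P i k * (a i * a k + b i * b k) - N i k * (a i * b k - b i * a k)) > 0"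
  shows "hermitian_pos_def H"
  unfolding hermitian_pos_def_def
proof (intro conjI allI impI)
  fix i k show "H $ i $ k = cnj (H $ k $ i)"
    using P[of i k] N[of i k] by (simp add: H complex_eq_iff)
next
  fix z :: "complex^'a" assume "z \<noteq> 0"
  then obtain i where "z $ i \<noteq> 0" by (auto simp: vec_eq_iff)
  then have "\<exists>i. Re (z $ i) \<noteq> 0 \<or> Im (z $ i) \<noteq> 0" by (auto simp: complex_eq_iff)
  from pos[OF this] show "0 < Re (\<Sum>(i,k)\<in>UNIV. cnj (z $ i) * H $ i $ k * z $ k)"
    by (simp add: sum_UNIV_prod H algebra_simps)
qed

lemma symmetric_contraction:
  fixes X :: "'a::finite \<Rightarrow> 'a \<Rightarrow> real"
  assumes "\<And>i j. X i j = X j i"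
  shows "(\<Sum>i\<in>UNIV. \<Sum>j\<in>UNIV. (p i * q j + p j * q i) / 2 * X i j) = (\<Sum>i\<in>UNIV. \<Sum>j\<in>UNIV. p i * q j * X i j)"
proof -
  have "(\<Sum>i\<in>UNIV. \<Sum>j\<in>UNIV. p j * q i * X i j) = (\<Sum>i\<in>UNIV. \<Sum>j\<in>UNIV. p i * q j * X j i)"
    by (rule sum.swap)
  also have "\<dots> = (\<Sum>i\<in>UNIV. \<Sum>j\<in>UNIV. p i * q j * X i j)" using assms by simp
  finally have "(\<Sum>i\<in>UNIV. \<Sum>j\<in>UNIV. p i * q j * X i j + p j * q i * X i j) = 2 * (\<Sum>i\<in>UNIV. \<Sum>j\<in>UNIV. p i * q j * X i j)"
    by (simp add: sum.distrib)
  then have "(\<Sum>i\<in>UNIV. \<Sum>j\<in>UNIV. (p i * q j * X i j + p j * q i * X i j) / 2) = (\<Sum>i\<in>UNIV. \<Sum>j\<in>UNIV. p i * q j * X i j)"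
    by (simp add: sum_divide_distrib[symmetric])
  then show ?thesis by (simp add: algebra_simps)
qed

context periodic_medium
begin

lemma C0_minor_right: "C0 M i j k l = C0 M i j l k"
  using C0_major C0_minor by metis

lemma C1_minor_right: "C1 M i j k l m = C1 M i j l k m"
  using C1_antisymmetric[of i j k l m] C1_antisymmetric[of i j l k m] C1_minor[of k l i j m] by simp


lemma A2_major: "A2 M \<theta> i j n k l m = A2 M \<theta> k l m i j n"
proof -
  have "(\<Sum>a\<in>UNIV. \<Sum>b\<in>UNIV. beta2 M b a * C0 M a n i j * C0 M b m k l)
      = (\<Sum>a\<in>UNIV. \<Sum>b\<in>UNIV. beta2 M a b * C0 M b n i j * C0 M a m k l)"
    by (rule sum.swap)
  also have "\<dots> = (\<Sum>a\<in>UNIV. \<Sum>b\<in>UNIV. beta2 M b a * C0 M a m k l * C0 M b n i j)"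
    by (intro sum.cong refl) (simp only: beta2_symmetric mult.assoc mult.left_commute mult.commute)
  finally show ?thesis
    by (simp add: A2_def sum_UNIV_prod C0_major[of i j k l] C2_major[of i j n k l m] eq_commute)
qed

lemma A2_minor: "A2 M \<theta> i j n k l m = A2 M \<theta> j i n k l m"
  using C0_minor[of i j k l] C2_minor[of i j n k l m] C0_minor_right[of _ n i j] by (simp add: A2_def)

lemma A2_minor_right: "A2 M \<theta> i j n k l m = A2 M \<theta> i j n l k m"
  using A2_major A2_minor by metis

lemma J2_major: "J2 M \<theta> i l k m = J2 M \<theta> k m i l"
  using B2_symmetric[of i l k m] by (simp add: J2_def eq_commute)

text \<open>On the plane wave with wave vector \<open>\<xi>\<close> the strain is a symmetrized dyad; by the minor
  symmetries the symmetrization may be dropped.\<close>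

lemma e_form_dyad:
  "2 * e_form M ell \<theta> (\<lambda>i j. (p i * \<xi> j + p j * \<xi> i) / 2) (\<lambda>i j n. (q i * \<xi> j + q j * \<xi> i) / 2 * \<xi> n)
   = (\<Sum>i\<in>UNIV. \<Sum>k\<in>UNIV. p i * p k * (\<Sum>j\<in>UNIV. \<Sum>l\<in>UNIV. C0 M i j k l * \<xi> j * \<xi> l))
     + ell * (\<Sum>i\<in>UNIV. \<Sum>k\<in>UNIV. p i * q k * (\<Sum>j\<in>UNIV. \<Sum>l\<in>UNIV. \<Sum>m\<in>UNIV. C1 M i j k l m * \<xi> j * \<xi> l * \<xi> m))
     + ell\<^sup>2 * (\<Sum>i\<in>UNIV. \<Sum>k\<in>UNIV. q i * q k *
         (\<Sum>j\<in>UNIV. \<Sum>n\<in>UNIV. \<Sum>l\<in>UNIV. \<Sum>m\<in>UNIV. A2 M \<theta> i j n k l m * \<xi> j * \<xi> n * \<xi> l * \<xi> m))"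
proof -
  define s where "s p i j = (p i * \<xi> j + p j * \<xi> i) / 2" for p :: "'d \<Rightarrow> real" and i j
  have contract: "(\<Sum>i\<in>UNIV. \<Sum>j\<in>UNIV. s p i j * X i j) = (\<Sum>i\<in>UNIV. \<Sum>j\<in>UNIV. p i * \<xi> j * X i j)"
    if "\<And>i j. X i j = X j i" for X p
    unfolding s_def by (rule symmetric_contraction[OF that])

  have 0: "(\<Sum>(i,j,k,l)\<in>UNIV. s p i j * C0 M i j k l * s p k l)
      = (\<Sum>i\<in>UNIV. \<Sum>k\<in>UNIV. p i * p k * (\<Sum>j\<in>UNIV. \<Sum>l\<in>UNIV. C0 M i j k l * \<xi> j * \<xi> l))"
  proof -
    have "(\<Sum>(i,j,k,l)\<in>UNIV. s p i j * C0 M i j k l * s p k l)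
        = (\<Sum>i\<in>UNIV. \<Sum>j\<in>UNIV. s p i j * (\<Sum>k\<in>UNIV. \<Sum>l\<in>UNIV. s p k l * C0 M i j k l))"
      by (simp add: sum_UNIV_prod sum_distrib_left mult_ac)
    also have "\<dots> = (\<Sum>i\<in>UNIV. \<Sum>j\<in>UNIV. p i * \<xi> j * (\<Sum>k\<in>UNIV. \<Sum>l\<in>UNIV. s p k l * C0 M i j k l))"
      by (rule contract) (simp add: C0_minor)
    also have "\<dots> = (\<Sum>i\<in>UNIV. \<Sum>j\<in>UNIV. p i * \<xi> j * (\<Sum>k\<in>UNIV. \<Sum>l\<in>UNIV. p k * \<xi> l * C0 M i j k l))"
      by (subst contract[OF C0_minor_right]) (rule refl)
    also have "\<dots> = (\<Sum>i\<in>UNIV. \<Sum>j\<in>UNIV. \<Sum>k\<in>UNIV. \<Sum>l\<in>UNIV. p i * p k * (C0 M i j k l * \<xi> j * \<xi> l))"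
      by (simp add: sum_distrib_left mult_ac)
    also have "\<dots> = (\<Sum>i\<in>UNIV. \<Sum>k\<in>UNIV. \<Sum>j\<in>UNIV. \<Sum>l\<in>UNIV. p i * p k * (C0 M i j k l * \<xi> j * \<xi> l))"
      by (intro sum.cong refl sum.swap)
    finally show ?thesis by (simp add: sum_distrib_left)
  qed
  have 1: "(\<Sum>(i,j,k,l,m)\<in>UNIV. s p i j * C1 M i j k l m * (s q k l * \<xi> m))
      = (\<Sum>i\<in>UNIV. \<Sum>k\<in>UNIV. p i * q k * (\<Sum>j\<in>UNIV. \<Sum>l\<in>UNIV. \<Sum>m\<in>UNIV. C1 M i j k l m * \<xi> j * \<xi> l * \<xi> m))"
  proof -
    have "(\<Sum>(i,j,k,l,m)\<in>UNIV. s p i j * C1 M i j k l m * (s q k l * \<xi> m))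
        = (\<Sum>i\<in>UNIV. \<Sum>j\<in>UNIV. s p i j * (\<Sum>k\<in>UNIV. \<Sum>l\<in>UNIV. s q k l * (\<Sum>m\<in>UNIV. C1 M i j k l m * \<xi> m)))"
      by (simp add: sum_UNIV_prod sum_distrib_left mult_ac)
    also have "\<dots> = (\<Sum>i\<in>UNIV. \<Sum>j\<in>UNIV. p i * \<xi> j * (\<Sum>k\<in>UNIV. \<Sum>l\<in>UNIV. s q k l * (\<Sum>m\<in>UNIV. C1 M i j k l m * \<xi> m)))"
      by (rule contract) (simp add: C1_minor)
    also have "\<dots> = (\<Sum>i\<in>UNIV. \<Sum>j\<in>UNIV. p i * \<xi> j * (\<Sum>k\<in>UNIV. \<Sum>l\<in>UNIV. q k * \<xi> l * (\<Sum>m\<in>UNIV. C1 M i j k l m * \<xi> m)))"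
      by (subst contract, subst C1_minor_right) (rule refl)+
    also have "\<dots> = (\<Sum>i\<in>UNIV. \<Sum>j\<in>UNIV. \<Sum>k\<in>UNIV. \<Sum>l\<in>UNIV. \<Sum>m\<in>UNIV. p i * q k * (C1 M i j k l m * \<xi> j * \<xi> l * \<xi> m))"
      by (simp add: sum_distrib_left mult_ac)
    also have "\<dots> = (\<Sum>i\<in>UNIV. \<Sum>k\<in>UNIV. \<Sum>j\<in>UNIV. \<Sum>l\<in>UNIV. \<Sum>m\<in>UNIV. p i * q k * (C1 M i j k l m * \<xi> j * \<xi> l * \<xi> m))"
      by (intro sum.cong refl sum.swap)
    finally show ?thesis by (simp add: sum_distrib_left)
  qed
  have 2: "(\<Sum>(i,j,n,k,l,m)\<in>UNIV. (s q i j * \<xi> n) * A2 M \<theta> i j n k l m * (s q k l * \<xi> m))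
      = (\<Sum>i\<in>UNIV. \<Sum>k\<in>UNIV. q i * q k * (\<Sum>j\<in>UNIV. \<Sum>n\<in>UNIV. \<Sum>l\<in>UNIV. \<Sum>m\<in>UNIV. A2 M \<theta> i j n k l m * \<xi> j * \<xi> n * \<xi> l * \<xi> m))"
  proof -
    have "(\<Sum>(i,j,n,k,l,m)\<in>UNIV. (s q i j * \<xi> n) * A2 M \<theta> i j n k l m * (s q k l * \<xi> m))
        = (\<Sum>i\<in>UNIV. \<Sum>j\<in>UNIV. s q i j * (\<Sum>n\<in>UNIV. \<xi> n * (\<Sum>k\<in>UNIV. \<Sum>l\<in>UNIV. s q k l * (\<Sum>m\<in>UNIV. A2 M \<theta> i j n k l m * \<xi> m))))"
      by (simp add: sum_UNIV_prod sum_distrib_left mult_ac)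
    also have "\<dots> = (\<Sum>i\<in>UNIV. \<Sum>j\<in>UNIV. q i * \<xi> j * (\<Sum>n\<in>UNIV. \<xi> n * (\<Sum>k\<in>UNIV. \<Sum>l\<in>UNIV. s q k l * (\<Sum>m\<in>UNIV. A2 M \<theta> i j n k l m * \<xi> m))))"
      by (rule contract) (simp add: A2_minor)
    also have "\<dots> = (\<Sum>i\<in>UNIV. \<Sum>j\<in>UNIV. q i * \<xi> j * (\<Sum>n\<in>UNIV. \<xi> n * (\<Sum>k\<in>UNIV. \<Sum>l\<in>UNIV. q k * \<xi> l * (\<Sum>m\<in>UNIV. A2 M \<theta> i j n k l m * \<xi> m))))"
      by (subst contract, subst A2_minor_right) (rule refl)+
    also have "\<dots> = (\<Sum>i\<in>UNIV. \<Sum>j\<in>UNIV. \<Sum>n\<in>UNIV. \<Sum>k\<in>UNIV. \<Sum>l\<in>UNIV. \<Sum>m\<in>UNIV. q i * q k * (A2 M \<theta> i j n k l m * \<xi> j * \<xi> n * \<xi> l * \<xi> m))"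
      by (simp add: sum_distrib_left mult_ac)
    also have "\<dots> = (\<Sum>i\<in>UNIV. \<Sum>k\<in>UNIV. \<Sum>j\<in>UNIV. \<Sum>n\<in>UNIV. \<Sum>l\<in>UNIV. \<Sum>m\<in>UNIV. q i * q k * (A2 M \<theta> i j n k l m * \<xi> j * \<xi> n * \<xi> l * \<xi> m))"
      by (intro sum.cong refl sum_cycle3)
    finally show ?thesis by (simp add: sum_distrib_left)
  qed
  show ?thesis
    unfolding e_form_def s_def[symmetric] 0 1 2 by simp
qed

text \<open>The strain of the plane wave with amplitude \<open>a + \<i> b\<close> has real part \<open>- b \<odot> \<xi>\<close> and
  imaginary part \<open>a \<odot> \<xi>\<close>, where \<open>\<odot>\<close> is the symmetrized product; a further derivative
  multiplies by \<open>\<i> \<xi>\<close> and thereby exchanges the two amplitudes. Hence the Hermitian form of the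
  symbol is the sum of the values of the real quadratic form on the two parts.\<close>

lemma Q_symbol_pos_def:
  assumes pos: "\<And>\<epsilon> \<eta>. (\<And>i j. \<epsilon> i j = \<epsilon> j i) \<Longrightarrow> (\<And>i j n. \<eta> i j n = \<eta> j i n) \<Longrightarrow> e_form M ell \<theta> \<epsilon> \<eta> \<ge> 0"
      "\<And>\<epsilon> \<eta>. (\<And>i j. \<epsilon> i j = \<epsilon> j i) \<Longrightarrow> (\<And>i j n. \<eta> i j n = \<eta> j i n) \<Longrightarrow> \<exists>i j. \<epsilon> i j \<noteq> 0 \<Longrightarrow> e_form M ell \<theta> \<epsilon> \<eta> > 0"
    and \<xi>: "\<xi> \<noteq> 0"
  shows "hermitian_pos_def (fourier_symbol (Q_poly M ell \<theta>) \<xi>)"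
proof -
  define x where "x j = \<xi> $ j" for j
  define C where "C i k = (\<Sum>j\<in>UNIV. \<Sum>l\<in>UNIV. C0 M i j k l * x j * x l)" for i k
  define N where "N i k = (\<Sum>j\<in>UNIV. \<Sum>l\<in>UNIV. \<Sum>m\<in>UNIV. C1 M i j k l m * x j * x l * x m)" for i k
  define A where "A i k = (\<Sum>j\<in>UNIV. \<Sum>n\<in>UNIV. \<Sum>l\<in>UNIV. \<Sum>m\<in>UNIV. A2 M \<theta> i j n k l m * x j * x n * x l * x m)" for i k
  show ?thesis
  proof (rule hermitian_pos_def_Complex[where P = "\<lambda>i k. C i k + ell\<^sup>2 * A i k" and N = "\<lambda>i k. ell * N i k"])
    fix i k
    have "fourier_symbol (Q_poly M ell \<theta>) \<xi> $ i $ k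
        = (\<Sum>j\<in>UNIV. \<Sum>l\<in>UNIV. of_real (C0 M i j k l * x j * x l))
        + ((\<Sum>j\<in>UNIV. \<Sum>l\<in>UNIV. \<Sum>m\<in>UNIV. \<i> * of_real (ell * (C1 M i j k l m * x j * x l * x m)))
        + (\<Sum>j\<in>UNIV. \<Sum>n\<in>UNIV. \<Sum>l\<in>UNIV. \<Sum>m\<in>UNIV. of_real (ell\<^sup>2 * (A2 M \<theta> i j n k l m * x j * x n * x l * x m))))"
      unfolding fourier_symbol_def mpoly_eval_def vec_lambda_beta
      by (subst sum_Q_poly) (simp_all add: x_def complex_eq_iff power2_eq_square mult_ac)
    also have "\<dots> = of_real (C i k) + (\<i> * of_real (ell * N i k) + of_real (ell\<^sup>2 * A i k))"
      by (simp add: C_def N_def A_def sum_distrib_left)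
    finally show "fourier_symbol (Q_poly M ell \<theta>) \<xi> $ i $ k = Complex (C i k + ell\<^sup>2 * A i k) (ell * N i k)"
      by (simp add: complex_eq_iff)
    have "C i k = C k i"
      unfolding C_def by (subst sum.swap) (simp add: C0_major[of i _ k] mult_ac)
    moreover have "A i k = A k i"
    proof -
      have "A i k = (\<Sum>u\<in>UNIV. \<Sum>v\<in>UNIV. A2 M \<theta> i (fst u) (snd u) k (fst v) (snd v) * x (fst u) * x (snd u) * x (fst v) * x (snd v))"
        by (simp add: A_def sum_UNIV_prod)
      also have "\<dots> = (\<Sum>v\<in>UNIV. \<Sum>u\<in>UNIV. A2 M \<theta> i (fst u) (snd u) k (fst v) (snd v) * x (fst u) * x (snd u) * x (fst v) * x (snd v))"
        by (rule sum.swap)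
      also have "\<dots> = A k i"
        by (simp add: A_def sum_UNIV_prod A2_major[of \<theta> i _ _ k] mult_ac)
      finally show ?thesis .
    qed
    ultimately show "C i k + ell\<^sup>2 * A i k = C k i + ell\<^sup>2 * A k i" by simp
    have "N i k = (\<Sum>l\<in>UNIV. \<Sum>j\<in>UNIV. \<Sum>m\<in>UNIV. C1 M i j k l m * x j * x l * x m)"
      unfolding N_def by (rule sum.swap)
    also have "\<dots> = - N k i"
      unfolding N_def by (simp add: C1_antisymmetric[of i _ k] sum_negf mult_ac)
    finally show "ell * N i k = - (ell * N k i)" by simp
  next
    fix a b :: "'d \<Rightarrow> real" assume ab: "\<exists>i. a i \<noteq> 0 \<or> b i \<noteq> 0"
    define e where "e p i j = (p i * x j + p j * x i) / 2" for p :: "'d \<Rightarrow> real" and i j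
    have sym: "e p i j = e p j i" for p i j by (simp add: e_def add.commute)
    have val: "2 * e_form M ell \<theta> (e p) (\<lambda>i j n. e q i j * x n)
        = (\<Sum>i\<in>UNIV. \<Sum>k\<in>UNIV. p i * p k * C i k + ell * (p i * q k * N i k) + ell\<^sup>2 * (q i * q k * A i k))" for p q
      unfolding e_def e_form_dyad C_def[symmetric] N_def[symmetric] A_def[symmetric]
      by (simp add: sum.distrib sum_distrib_left)
    have nz: "\<exists>i j. e p i j \<noteq> 0" if "p i \<noteq> 0" for p i
    proof (rule ccontr)
      assume "\<not> (\<exists>i j. e p i j \<noteq> 0)"
      then have z: "p i * x j + p j * x i = 0" for i j by (simp add: e_def)
      obtain k where k: "x k \<noteq> 0" using \<xi> by (auto simp: x_def vec_eq_iff)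
      have "p k = 0" using z[of k k] k by simp
      then show False using z[of i k] k that by simp
    qed
    have "(\<Sum>i\<in>UNIV. \<Sum>k\<in>UNIV. (C i k + ell\<^sup>2 * A i k) * (a i * a k + b i * b k) - ell * N i k * (a i * b k - b i * a k))
        = 2 * e_form M ell \<theta> (e (\<lambda>i. - b i)) (\<lambda>i j n. e (\<lambda>i. - a i) i j * x n)
          + 2 * e_form M ell \<theta> (e a) (\<lambda>i j n. e (\<lambda>i. - b i) i j * x n)"
      unfolding val sum.distrib[symmetric] by (intro sum.cong refl) (simp add: algebra_simps)
    also have "\<dots> > 0"
    proof -
      from ab obtain i where "a i \<noteq> 0 \<or> - b i \<noteq> 0" by auto
      then have "(\<exists>i j. e a i j \<noteq> 0) \<or> (\<exists>i j. e (\<lambda>i. - b i) i j \<noteq> 0)"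
        using nz[of a i] nz[of "\<lambda>i. - b i" i] by blast
      moreover have e0: "e_form M ell \<theta> (e p) (\<lambda>i j n. e q i j * x n) \<ge> 0" for p q
        by (rule pos(1)) (rule sym, subst sym, rule refl)
      moreover have e1: "e_form M ell \<theta> (e p) (\<lambda>i j n. e q i j * x n) > 0" if "\<exists>i j. e p i j \<noteq> 0" for p q
        by (rule pos(2)[OF _ _ that]) (rule sym, subst sym, rule refl)
      ultimately show ?thesis
      proof (elim disjE)
        assume "\<exists>i j. e a i j \<noteq> 0"
        from e1[OF this, of "\<lambda>i. - b i"] e0[of "\<lambda>i. - b i" "\<lambda>i. - a i"] show ?thesis by linarith
      next
        assume "\<exists>i j. e (\<lambda>i. - b i) i j \<noteq> 0"
        from e1[OF this, of "\<lambda>i. - a i"] e0[of a "\<lambda>i. - b i"] show ?thesis by linarith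
      qed
    qed
    finally show "0 < (\<Sum>i\<in>UNIV. \<Sum>k\<in>UNIV. (C i k + ell\<^sup>2 * A i k) * (a i * a k + b i * b k) - ell * N i k * (a i * b k - b i * a k))" .
  qed
qed

lemma R_symbol_pos_def:
  assumes pos: "\<And>u \<gamma>. k_form M ell \<theta> u \<gamma> \<ge> 0" "\<And>u \<gamma>. \<exists>i. u i \<noteq> 0 \<Longrightarrow> k_form M ell \<theta> u \<gamma> > 0"
  shows "hermitian_pos_def (fourier_symbol (R_poly M ell \<theta>) \<xi>)"
proof -
  define x where "x j = \<xi> $ j" for j
  define N where "N i k = (\<Sum>l\<in>UNIV. B1 M i k l * x l)" for i k
  define J where "J i k = (\<Sum>l\<in>UNIV. \<Sum>m\<in>UNIV. J2 M \<theta> i l k m * x l * x m)" for i k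
  show ?thesis
  proof (rule hermitian_pos_def_Complex[where P = "\<lambda>i k. rho0 M * (of_bool (i = k) + ell\<^sup>2 * J i k)" and N = "\<lambda>i k. rho0 M * (ell * N i k)"])
    fix i k
    have "fourier_symbol (R_poly M ell \<theta>) \<xi> $ i $ k
        = of_real (rho0 M * of_bool (i = k))
        + ((\<Sum>l\<in>UNIV. \<i> * of_real (rho0 M * (ell * (B1 M i k l * x l))))
        + (\<Sum>l\<in>UNIV. \<Sum>m\<in>UNIV. of_real (rho0 M * (ell\<^sup>2 * (J2 M \<theta> i l k m * x l * x m)))))"
      unfolding fourier_symbol_def mpoly_eval_def vec_lambda_beta
      by (subst sum_R_poly) (simp_all add: x_def complex_eq_iff power2_eq_square mult_ac)
    also have "\<dots> = of_real (rho0 M * of_bool (i = k)) + (\<i> * of_real (rho0 M * (ell * N i k)) + of_real (rho0 M * (ell\<^sup>2 * J i k)))"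
      by (simp add: N_def J_def sum_distrib_left)
    finally show "fourier_symbol (R_poly M ell \<theta>) \<xi> $ i $ k = Complex (rho0 M * (of_bool (i = k) + ell\<^sup>2 * J i k)) (rho0 M * (ell * N i k))"
      by (simp add: complex_eq_iff distrib_left)
    have "J i k = J k i"
      unfolding J_def by (subst sum.swap) (simp add: J2_major[of \<theta> i _ k] mult_ac)
    then show "rho0 M * (of_bool (i = k) + ell\<^sup>2 * J i k) = rho0 M * (of_bool (k = i) + ell\<^sup>2 * J k i)"
      by (simp add: eq_commute)
    show "rho0 M * (ell * N i k) = - (rho0 M * (ell * N k i))"
      unfolding N_def by (simp add: B1_antisymmetric[of i k] sum_negf)
  next
    fix a b :: "'d \<Rightarrow> real" assume ab: "\<exists>i. a i \<noteq> 0 \<or> b i \<noteq> 0"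
    have val: "2 * k_form M ell \<theta> p (\<lambda>i l. q i * x l)
        = (\<Sum>i\<in>UNIV. \<Sum>k\<in>UNIV. rho0 M * (of_bool (i = k) * (p i * p k) + ell * (p i * q k * N i k) + ell\<^sup>2 * (q i * q k * J i k)))" for p q
    proof -
      have "(\<Sum>i\<in>UNIV. (p i)\<^sup>2) = (\<Sum>i\<in>UNIV. \<Sum>k\<in>UNIV. of_bool (k = i) * (p i * p k))"
        unfolding sum_of_bool_eq by (simp add: power2_eq_square)
      also have "\<dots> = (\<Sum>i\<in>UNIV. \<Sum>k\<in>UNIV. of_bool (i = k) * (p i * p k))" by (simp add: eq_commute)
      finally have 0: "(\<Sum>i\<in>UNIV. (p i)\<^sup>2) = (\<Sum>i\<in>UNIV. \<Sum>k\<in>UNIV. of_bool (i = k) * (p i * p k))" .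
      have 1: "(\<Sum>(i,k,l)\<in>UNIV. p i * B1 M i k l * (q k * x l)) = (\<Sum>i\<in>UNIV. \<Sum>k\<in>UNIV. p i * q k * N i k)"
        by (simp add: sum_UNIV_prod N_def sum_distrib_left mult_ac)
      have "(\<Sum>(i,l,k,m)\<in>UNIV. (q i * x l) * J2 M \<theta> i l k m * (q k * x m))
          = (\<Sum>i\<in>UNIV. \<Sum>l\<in>UNIV. \<Sum>k\<in>UNIV. \<Sum>m\<in>UNIV. q i * q k * (J2 M \<theta> i l k m * x l * x m))"
        by (simp add: sum_UNIV_prod mult_ac)
      also have "\<dots> = (\<Sum>i\<in>UNIV. \<Sum>k\<in>UNIV. \<Sum>l\<in>UNIV. \<Sum>m\<in>UNIV. q i * q k * (J2 M \<theta> i l k m * x l * x m))"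
        by (intro sum.cong refl sum.swap)
      finally have 2: "(\<Sum>(i,l,k,m)\<in>UNIV. (q i * x l) * J2 M \<theta> i l k m * (q k * x m)) = (\<Sum>i\<in>UNIV. \<Sum>k\<in>UNIV. q i * q k * J i k)"
        by (simp add: J_def sum_distrib_left)
      show ?thesis unfolding k_form_def 0 1 2 by (simp add: sum.distrib sum_distrib_left distrib_left mult_ac)
    qed
    have "(\<Sum>i\<in>UNIV. \<Sum>k\<in>UNIV. rho0 M * (of_bool (i = k) + ell\<^sup>2 * J i k) * (a i * a k + b i * b k) - rho0 M * (ell * N i k) * (a i * b k - b i * a k))
        = 2 * k_form M ell \<theta> a (\<lambda>i l. - b i * x l) + 2 * k_form M ell \<theta> b (\<lambda>i l. a i * x l)"
      unfolding val sum.distrib[symmetric] by (intro sum.cong refl) (simp add: algebra_simps)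
    also have "\<dots> > 0"
    proof -
      from ab have "(\<exists>i. a i \<noteq> 0) \<or> (\<exists>i. b i \<noteq> 0)" by blast
      then show ?thesis
      proof
        assume "\<exists>i. a i \<noteq> 0"
        from pos(2)[OF this, of "\<lambda>i l. - b i * x l"] pos(1)[of b "\<lambda>i l. a i * x l"] show ?thesis by linarith
      next
        assume "\<exists>i. b i \<noteq> 0"
        from pos(2)[OF this, of "\<lambda>i l. a i * x l"] pos(1)[of a "\<lambda>i l. - b i * x l"] show ?thesis by linarith
      qed
    qed
    finally show "0 < (\<Sum>i\<in>UNIV. \<Sum>k\<in>UNIV. rho0 M * (of_bool (i = k) + ell\<^sup>2 * J i k) * (a i * a k + b i * b k) - rho0 M * (ell * N i k) * (a i * b k - b i * a k))" .
  qed
qed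

end

section \<open>Coercivity of the bilinear forms\<close>

lemma L2_integrable_form: "L2 \<Omega> f \<Longrightarrow> L2 \<Omega> g \<Longrightarrow> integrable (lebesgue_on \<Omega>) (\<lambda>x. f x * c * g x)"
  using L2_integrable_mult[of \<Omega> "\<lambda>x. c * f x" g] L2_cmult[of \<Omega> f c] by (simp add: mult_ac)

lemma H1_weak_pd: "H1 UNIV f \<Longrightarrow> has_weak_pd UNIV j f (wpd UNIV j f)"
  unfolding H1_def using has_weak_pd_wpd by blast

lemma vH1_weak_pd: "vH1 UNIV U \<Longrightarrow> has_weak_pd UNIV j (\<lambda>x. U x $ i) (grad UNIV U i j)"
  unfolding vH1_def grad_def using H1_weak_pd by blast

lemma vH2_imp_vH1: "vH2 UNIV U \<Longrightarrow> vH1 UNIV U"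
  by (simp add: vH2_def vH1_def H2_def)

lemma vH2_weak_pd: "vH2 UNIV U \<Longrightarrow> has_weak_pd UNIV n (grad UNIV U i j) (wpd UNIV n (grad UNIV U i j))"
  unfolding vH2_def H2_def grad_def using H1_weak_pd by blast

lemma strain_commute: "strain U i j = strain U j i"
  by (simp add: strain_def add.commute)

lemma strain_grad_commute: "strain_grad U i j n = strain_grad U j i n"
  by (simp add: strain_grad_def strain_commute[of U i j])

lemma strain_L2: "vH1 UNIV U \<Longrightarrow> L2 UNIV (strain U i j)"
  unfolding strain_def by (intro L2_divide L2_add has_weak_pd_L2(2)[OF vH1_weak_pd])

lemma strain_weak_pd:
  assumes "vH2 UNIV U"
  shows "has_weak_pd UNIV n (strain U i j)
    (\<lambda>x. (wpd UNIV n (grad UNIV U i j) x + wpd UNIV n (grad UNIV U j i) x) / 2)"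
  using has_weak_pd_cmult[OF has_weak_pd_add[OF _ vH2_weak_pd[OF assms, of n i j] vH2_weak_pd[OF assms, of n j i]], of "1/2"]
  by (simp add: strain_def)

lemma strain_grad_L2: "vH2 UNIV U \<Longrightarrow> L2 UNIV (strain_grad U i j n)"
  unfolding strain_grad_def by (rule has_weak_pd_L2(2)[OF has_weak_pd_wpd[OF strain_weak_pd]])

lemma Korn_UNIV:
  fixes U :: "real^'d \<Rightarrow> real^'d::finite"
  assumes U: "vH1 UNIV U"
  shows "(\<Sum>i\<in>UNIV. \<Sum>j\<in>UNIV. LINT x|lebesgue. (grad UNIV U i j x)\<^sup>2)
    \<le> 4 * (\<Sum>i\<in>UNIV. \<Sum>j\<in>UNIV. LINT x|lebesgue. (strain U i j x)\<^sup>2)"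
proof -
  have "(\<Sum>i\<in>UNIV. \<Sum>j\<in>UNIV. LINT x|lebesgue_on UNIV. (grad UNIV U i j x)\<^sup>2)
    \<le> (\<Sum>i\<in>UNIV. \<Sum>j\<in>UNIV. LINT x|lebesgue_on UNIV. (grad UNIV U i j x + grad UNIV U j i x)\<^sup>2)"
  proof (rule Korn_if_exchange)
    show "L2 UNIV (grad UNIV U i j)" for i j by (rule has_weak_pd_L2(2)[OF vH1_weak_pd[OF U]])
    show "(LINT x|lebesgue_on UNIV. grad UNIV U i j x * grad UNIV U j i x)
        = (LINT x|lebesgue_on UNIV. grad UNIV U i i x * grad UNIV U j j x)" for i j
      unfolding lebesgue_on_UNIV_eq by (rule LINT_weak_pd_exchange[OF vH1_weak_pd[OF U] vH1_weak_pd[OF U] vH1_weak_pd[OF U] vH1_weak_pd[OF U]])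
  qed
  also have "(\<lambda>i j. LINT x|lebesgue_on UNIV. (grad UNIV U i j x + grad UNIV U j i x)\<^sup>2) = (\<lambda>i j. 4 * (LINT x|lebesgue. (strain U i j x)\<^sup>2))"
    unfolding lebesgue_on_UNIV_eq integral_mult_right_zero[symmetric] by (intro ext) (simp add: strain_def power_divide)
  finally show ?thesis by (simp add: lebesgue_on_UNIV_eq sum_distrib_left)
qed

text \<open>All second derivatives of a displacement are combinations of strain gradients.\<close>

lemma second_pd_from_strain_grad:
  fixes U :: "real^'d \<Rightarrow> real^'d::finite"
  assumes U: "vH2 UNIV U"
  shows "AE x in lebesgue. wpd UNIV n (grad UNIV U i j) x = strain_grad U i j n x + strain_grad U i n j x - strain_grad U j n i x"
proof -
  let ?g = "\<lambda>i j n. wpd UNIV n (grad UNIV U i j)"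
  have s: "AE x in lebesgue. strain_grad U i j n x = (?g i j n x + ?g j i n x) / 2" for i j n
    using AE_wpd_eq[OF open_UNIV strain_weak_pd[OF U]] unfolding strain_grad_def lebesgue_on_UNIV_eq .
  have c: "AE x in lebesgue. ?g i j n x = ?g i n j x" for i j n
    by (rule weak_pd_commute[OF vH1_weak_pd[OF vH2_imp_vH1[OF U]] vH1_weak_pd[OF vH2_imp_vH1[OF U]]
          vH2_weak_pd[OF U] vH2_weak_pd[OF U]])
  show ?thesis
    using s[of i j n] s[of i n j] s[of j n i] c[of i j n] c[of j n i] c[of n i j]
  proof eventually_elim
    case (elim x)
    have "g1 = s1 + s2 - s3"
      if "s1 = (g1 + g2) / 2" "s2 = (g3 + g4) / 2" "s3 = (g5 + g6) / 2" "g5 = g2" "g4 = g6" "g1 = g3"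
      for g1 g2 g3 g4 g5 g6 s1 s2 s3 :: real
      using that by (simp add: field_simps)
    from this[OF elim] show ?case .
  qed
qed

lemma second_pd_bound:
  fixes U :: "real^'d \<Rightarrow> real^'d::finite"
  assumes U: "vH2 UNIV U"
  shows "(\<Sum>i\<in>UNIV. \<Sum>j\<in>UNIV. \<Sum>n\<in>UNIV. LINT x|lebesgue. (wpd UNIV n (grad UNIV U i j) x)\<^sup>2)
    \<le> 9 * (\<Sum>i\<in>UNIV. \<Sum>j\<in>UNIV. \<Sum>n\<in>UNIV. LINT x|lebesgue. (strain_grad U i j n x)\<^sup>2)"
proof -
  define h where "h i j n = (LINT x|lebesgue. (strain_grad U i j n x)\<^sup>2)" for i j n
  have I: "integrable lebesgue (\<lambda>x. (strain_grad U i j n x)\<^sup>2)" for i j n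
    using L2_integrable_square[OF strain_grad_L2[OF U]] unfolding lebesgue_on_UNIV_eq .
  have le: "(LINT x|lebesgue. (wpd UNIV n (grad UNIV U i j) x)\<^sup>2) \<le> 3 * h i j n + 3 * h i n j + 3 * h j n i" for i j n
  proof -
    have "(LINT x|lebesgue. (wpd UNIV n (grad UNIV U i j) x)\<^sup>2)
        \<le> (LINT x|lebesgue. 3 * (strain_grad U i j n x)\<^sup>2 + 3 * (strain_grad U i n j x)\<^sup>2 + 3 * (strain_grad U j n i x)\<^sup>2)"
    proof (rule integral_mono_AE)
      show "integrable lebesgue (\<lambda>x. (wpd UNIV n (grad UNIV U i j) x)\<^sup>2)"
        using L2_integrable_square[OF has_weak_pd_L2(2)[OF vH2_weak_pd[OF U]]] unfolding lebesgue_on_UNIV_eq .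
      show "integrable lebesgue (\<lambda>x. 3 * (strain_grad U i j n x)\<^sup>2 + 3 * (strain_grad U i n j x)\<^sup>2 + 3 * (strain_grad U j n i x)\<^sup>2)"
        using I by simp
      have "(a + b - c)\<^sup>2 \<le> 3 * a\<^sup>2 + 3 * b\<^sup>2 + 3 * c\<^sup>2" for a b c :: real
      proof -
        have "0 \<le> (a - b)\<^sup>2 + (a + c)\<^sup>2 + (b + c)\<^sup>2" by simp
        then show ?thesis by (simp add: power2_eq_square algebra_simps)
      qed
      then show "AE x in lebesgue. (wpd UNIV n (grad UNIV U i j) x)\<^sup>2
          \<le> 3 * (strain_grad U i j n x)\<^sup>2 + 3 * (strain_grad U i n j x)\<^sup>2 + 3 * (strain_grad U j n i x)\<^sup>2"
        using second_pd_from_strain_grad[OF U, of n i j] by (auto elim!: eventually_mono)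
    qed
    then show ?thesis using I by (simp add: h_def)
  qed
  have 1: "(\<Sum>i\<in>UNIV. \<Sum>j\<in>UNIV. \<Sum>n\<in>UNIV. h i n j) = (\<Sum>i\<in>UNIV. \<Sum>j\<in>UNIV. \<Sum>n\<in>UNIV. h i j n)"
    by (intro sum.cong refl sum.swap)
  have 2: "(\<Sum>i\<in>UNIV. \<Sum>j\<in>UNIV. \<Sum>n\<in>UNIV. h j n i) = (\<Sum>i\<in>UNIV. \<Sum>j\<in>UNIV. \<Sum>n\<in>UNIV. h i j n)"
    by (rule sum_cycle3[symmetric])
  have "(\<Sum>i\<in>UNIV. \<Sum>j\<in>UNIV. \<Sum>n\<in>UNIV. LINT x|lebesgue. (wpd UNIV n (grad UNIV U i j) x)\<^sup>2)
      \<le> (\<Sum>i\<in>UNIV. \<Sum>j\<in>UNIV. \<Sum>n\<in>UNIV. 3 * h i j n + 3 * h i n j + 3 * h j n i)"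
    by (intro sum_mono le)
  also have "\<dots> = 9 * (\<Sum>i\<in>UNIV. \<Sum>j\<in>UNIV. \<Sum>n\<in>UNIV. h i j n)"
    unfolding sum.distrib sum_distrib_left[symmetric] 1 2 by simp
  finally show ?thesis unfolding h_def .
qed

lemma H2_minus_L2_normsq:
  "H2_normsq UNIV U - L2_normsq UNIV U = (\<Sum>i\<in>UNIV. \<Sum>j\<in>UNIV. LINT x|lebesgue. (grad UNIV U i j x)\<^sup>2)
    + (\<Sum>i\<in>UNIV. \<Sum>j\<in>UNIV. \<Sum>n\<in>UNIV. LINT x|lebesgue. (wpd UNIV n (grad UNIV U i j) x)\<^sup>2)"
  by (simp add: H2_normsq_def H1_normsq_def sum_UNIV_prod lebesgue_on_UNIV_eq)

lemma Q_form_eq_e_form: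
  "Q_form M ell \<theta> U U = (LINT x|lebesgue. 2 * e_form M ell \<theta> (\<lambda>i j. strain U i j x) (\<lambda>i j n. strain_grad U i j n x))"
  by (simp only: Q_form_def e_form_def mult.assoc[symmetric]) simp

lemma R_form_eq_k_form:
  "R_form M ell \<theta> U U = (LINT x|lebesgue. 2 * k_form M ell \<theta> (\<lambda>i. U x $ i) (\<lambda>i j. grad UNIV U i j x))"
  by (simp add: R_form_def k_form_def power2_eq_square)

lemma e_form_integrable:
  assumes U: "vH2 UNIV U"
  shows "integrable lebesgue (\<lambda>x. e_form M ell \<theta> (\<lambda>i j. strain U i j x) (\<lambda>i j n. strain_grad U i j n x))"
proof -
  note I = L2_integrable_form[of UNIV, unfolded lebesgue_on_UNIV_eq]
    and L = strain_L2[OF vH2_imp_vH1[OF U]] strain_grad_L2[OF U]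
  show ?thesis
    unfolding e_form_def sum_UNIV_prod split_conv
    by (intro Bochner_Integration.integrable_mult_right Bochner_Integration.integrable_add
        Bochner_Integration.integrable_sum I L)
qed

lemma k_form_integrable:
  assumes U: "vH1 UNIV U"
  shows "integrable lebesgue (\<lambda>x. k_form M ell \<theta> (\<lambda>i. U x $ i) (\<lambda>i j. grad UNIV U i j x))"
proof -
  note I = L2_integrable_form[of UNIV, unfolded lebesgue_on_UNIV_eq]
    and L = has_weak_pd_L2[OF vH1_weak_pd[OF U]]
  have sq: "integrable lebesgue (\<lambda>x. (U x $ i)\<^sup>2)" for i
    using L2_integrable_square[OF L(1)] unfolding lebesgue_on_UNIV_eq .
  show ?thesis
    unfolding k_form_def sum_UNIV_prod split_conv
    by (intro Bochner_Integration.integrable_mult_right Bochner_Integration.integrable_add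
        Bochner_Integration.integrable_sum I L sq)
qed

lemma Q_form_coercive:
  fixes M :: "('d::finite) cell_data"
  assumes c: "c > 0" and ell: "ell > 0"
    and e: "\<And>\<epsilon> \<eta>. (\<And>i j. \<epsilon> i j = \<epsilon> j i) \<Longrightarrow> (\<And>i j n. \<eta> i j n = \<eta> j i n) \<Longrightarrow>
      e_form M ell \<theta> \<epsilon> \<eta> \<ge> c * ((\<Sum>i\<in>UNIV. \<Sum>j\<in>UNIV. (\<epsilon> i j)\<^sup>2) + ell\<^sup>2 * (\<Sum>i\<in>UNIV. \<Sum>j\<in>UNIV. \<Sum>n\<in>UNIV. (\<eta> i j n)\<^sup>2))"
  obtains C where "C > 0" "\<And>U. vH2 UNIV U \<Longrightarrow> Q_form M ell \<theta> U U \<ge> C * (H2_normsq UNIV U - L2_normsq UNIV U)"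
proof
  define C where "C = min (c / 2) (2 * c * ell\<^sup>2 / 9)"
  show "C > 0" using c ell by (simp add: C_def)
  fix U :: "real^'d \<Rightarrow> real^'d" assume U: "vH2 UNIV U"
  let ?G = "\<Sum>i\<in>UNIV. \<Sum>j\<in>UNIV. LINT x|lebesgue. (grad UNIV U i j x)\<^sup>2"
  let ?H = "\<Sum>i\<in>UNIV. \<Sum>j\<in>UNIV. \<Sum>n\<in>UNIV. LINT x|lebesgue. (wpd UNIV n (grad UNIV U i j) x)\<^sup>2"
  let ?S = "\<Sum>i\<in>UNIV. \<Sum>j\<in>UNIV. LINT x|lebesgue. (strain U i j x)\<^sup>2"
  let ?T = "\<Sum>i\<in>UNIV. \<Sum>j\<in>UNIV. \<Sum>n\<in>UNIV. LINT x|lebesgue. (strain_grad U i j n x)\<^sup>2"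
  have I: "integrable lebesgue (\<lambda>x. (strain U i j x)\<^sup>2)" "integrable lebesgue (\<lambda>x. (strain_grad U i j n x)\<^sup>2)" for i j n
    using L2_integrable_square[OF strain_L2[OF vH2_imp_vH1[OF U]]] L2_integrable_square[OF strain_grad_L2[OF U]]
    unfolding lebesgue_on_UNIV_eq by auto
  have "2 * (c * (?S + ell\<^sup>2 * ?T))
      = (LINT x|lebesgue. 2 * (c * ((\<Sum>i\<in>UNIV. \<Sum>j\<in>UNIV. (strain U i j x)\<^sup>2) + ell\<^sup>2 * (\<Sum>i\<in>UNIV. \<Sum>j\<in>UNIV. \<Sum>n\<in>UNIV. (strain_grad U i j n x)\<^sup>2))))"
    using I by simp
  also have "\<dots> \<le> Q_form M ell \<theta> U U"
    unfolding Q_form_eq_e_form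
  proof (intro integral_mono)
    show "integrable lebesgue (\<lambda>x. 2 * (c * ((\<Sum>i\<in>UNIV. \<Sum>j\<in>UNIV. (strain U i j x)\<^sup>2) + ell\<^sup>2 * (\<Sum>i\<in>UNIV. \<Sum>j\<in>UNIV. \<Sum>n\<in>UNIV. (strain_grad U i j n x)\<^sup>2))))"
      using I by simp
    show "integrable lebesgue (\<lambda>x. 2 * e_form M ell \<theta> (\<lambda>i j. strain U i j x) (\<lambda>i j n. strain_grad U i j n x))"
      using e_form_integrable[OF U] by simp
    show "2 * (c * ((\<Sum>i\<in>UNIV. \<Sum>j\<in>UNIV. (strain U i j x)\<^sup>2) + ell\<^sup>2 * (\<Sum>i\<in>UNIV. \<Sum>j\<in>UNIV. \<Sum>n\<in>UNIV. (strain_grad U i j n x)\<^sup>2)))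
        \<le> 2 * e_form M ell \<theta> (\<lambda>i j. strain U i j x) (\<lambda>i j n. strain_grad U i j n x)" for x
      using e[of "\<lambda>i j. strain U i j x" "\<lambda>i j n. strain_grad U i j n x"] strain_commute[of U] strain_grad_commute[of U] by simp
  qed
  finally have low: "2 * c * ?S + 2 * c * ell\<^sup>2 * ?T \<le> Q_form M ell \<theta> U U" by (simp add: algebra_simps)
  have pos: "0 \<le> ?G" "0 \<le> ?H" by (auto intro!: sum_nonneg)
  have "C * ?G \<le> c / 2 * ?G" using pos by (intro mult_right_mono) (auto simp: C_def)
  also have "\<dots> \<le> c / 2 * (4 * ?S)" using c Korn_UNIV[OF vH2_imp_vH1[OF U]] by (intro mult_left_mono) auto
  finally have 1: "C * ?G \<le> 2 * c * ?S" by simp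
  have "C * ?H \<le> 2 * c * ell\<^sup>2 / 9 * ?H" using pos by (intro mult_right_mono) (auto simp: C_def)
  also have "\<dots> \<le> 2 * c * ell\<^sup>2 / 9 * (9 * ?T)" using c second_pd_bound[OF U] by (intro mult_left_mono) auto
  finally have 2: "C * ?H \<le> 2 * c * ell\<^sup>2 * ?T" by simp
  show "Q_form M ell \<theta> U U \<ge> C * (H2_normsq UNIV U - L2_normsq UNIV U)"
    unfolding H2_minus_L2_normsq distrib_left using low 1 2 by linarith
qed

lemma R_form_elliptic:
  fixes M :: "('d::finite) cell_data"
  assumes c: "c > 0" and ell: "ell > 0"
    and k: "\<And>u \<gamma>. k_form M ell \<theta> u \<gamma> \<ge> c * ((\<Sum>i\<in>UNIV. (u i)\<^sup>2) + ell\<^sup>2 * (\<Sum>i\<in>UNIV. \<Sum>p\<in>UNIV. (\<gamma> i p)\<^sup>2))"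
  obtains C where "C > 0" "\<And>W. vH1 UNIV W \<Longrightarrow> R_form M ell \<theta> W W \<ge> C * H1_normsq UNIV W"
proof
  define C where "C = min (2 * c) (2 * c * ell\<^sup>2)"
  show "C > 0" using c ell by (simp add: C_def)
  fix W :: "real^'d \<Rightarrow> real^'d" assume W: "vH1 UNIV W"
  let ?S = "\<Sum>i\<in>UNIV. LINT x|lebesgue. (W x $ i)\<^sup>2"
  let ?G = "\<Sum>i\<in>UNIV. \<Sum>j\<in>UNIV. LINT x|lebesgue. (grad UNIV W i j x)\<^sup>2"
  have I: "integrable lebesgue (\<lambda>x. (W x $ i)\<^sup>2)" "integrable lebesgue (\<lambda>x. (grad UNIV W i j x)\<^sup>2)" for i j
    using has_weak_pd_L2[OF vH1_weak_pd[OF W], THEN L2_integrable_square] unfolding lebesgue_on_UNIV_eq by auto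
  have "2 * (c * (?S + ell\<^sup>2 * ?G))
      = (LINT x|lebesgue. 2 * (c * ((\<Sum>i\<in>UNIV. (W x $ i)\<^sup>2) + ell\<^sup>2 * (\<Sum>i\<in>UNIV. \<Sum>j\<in>UNIV. (grad UNIV W i j x)\<^sup>2))))"
    using I by simp
  also have "\<dots> \<le> R_form M ell \<theta> W W"
    unfolding R_form_eq_k_form
    by (intro integral_mono mult_left_mono k Bochner_Integration.integrable_mult_right k_form_integrable[OF W]) (use I in auto)
  finally have low: "2 * c * ?S + 2 * c * ell\<^sup>2 * ?G \<le> R_form M ell \<theta> W W" by (simp add: algebra_simps)
  have pos: "0 \<le> ?S" "0 \<le> ?G" by (auto intro!: sum_nonneg)
  have "C * ?S \<le> 2 * c * ?S" "C * ?G \<le> 2 * c * ell\<^sup>2 * ?G"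
    using pos by (auto intro!: mult_right_mono simp: C_def)
  then show "R_form M ell \<theta> W W \<ge> C * H1_normsq UNIV W"
    using low by (simp add: H1_normsq_def L2_normsq_def sum_UNIV_prod lebesgue_on_UNIV_eq distrib_left)
qed

theorem proposition4:
  fixes M :: "('d::finite) cell_data"
  assumes dim: "CARD('d) = 2 \<or> CARD('d) = 3"
    and cell: "periodicity_cell M"
    and medium: "elastic_medium M"
    and cell_functions: "cell_functions M"
  shows "\<exists>\<theta>e \<theta>k :: real. \<theta>e > 0 \<and> \<theta>k > 0 \<and> (\<forall>ell::real. ell > 0 \<longrightarrow>
    (\<forall>\<theta>>\<theta>e.
       (\<forall>\<epsilon> \<eta>. (\<forall>i j. \<epsilon> i j = \<epsilon> j i) \<longrightarrow> (\<forall>i j n. \<eta> i j n = \<eta> j i n) \<longrightarrow>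
          \<not> ((\<forall>i j. \<epsilon> i j = 0) \<and> (\<forall>i j n. \<eta> i j n = 0)) \<longrightarrow> e_form M ell \<theta> \<epsilon> \<eta> > 0) \<and>
       (\<forall>U. vH2 UNIV U \<longrightarrow> Q_form M ell \<theta> U U \<ge> 0)) \<and>
    (\<forall>\<theta>>\<theta>k.
       (\<forall>u \<gamma>. \<not> ((\<forall>i. u i = 0) \<and> (\<forall>i p. \<gamma> i p = 0)) \<longrightarrow> k_form M ell \<theta> u \<gamma> > 0) \<and>
       (\<forall>U. vH1 UNIV U \<longrightarrow> R_form M ell \<theta> U U \<ge> 0)) \<and>
    (\<forall>\<theta>>max \<theta>e \<theta>k.
       ((\<forall>U. vsmooth U \<longrightarrow> Q_op M ell \<theta> U = mpoly_op (Q_poly M ell \<theta>) U \<and>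
                          R_op M ell \<theta> U = mpoly_op (R_poly M ell \<theta>) U) \<and>
        (\<forall>\<xi>. \<xi> \<noteq> 0 \<longrightarrow> hermitian_pos_def (fourier_symbol (Q_poly M ell \<theta>) \<xi>) \<and>
                       hermitian_pos_def (fourier_symbol (R_poly M ell \<theta>) \<xi>))) \<and>
       (\<exists>C>0. \<forall>U. vH2 UNIV U \<longrightarrow>
          Q_form M ell \<theta> U U \<ge> C * (H2_normsq UNIV U - L2_normsq UNIV U) \<and>
          C * (H2_normsq UNIV U - L2_normsq UNIV U) \<ge> 0) \<and>
       (\<exists>C>0. \<forall>W. vH1 UNIV W \<longrightarrow>
          R_form M ell \<theta> W W \<ge> C * H1_normsq UNIV W)))"
proof -
  interpret periodic_medium M
    using cell medium cell_functions by unfold_locales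
  obtain \<theta>e ce where \<theta>e: "\<theta>e > 0" "ce > 0" and e: "\<And>\<theta> ell \<epsilon> \<eta>. \<theta> > \<theta>e \<Longrightarrow> ell > 0 \<Longrightarrow>
      (\<And>i j. \<epsilon> i j = \<epsilon> j i) \<Longrightarrow> (\<And>i j n. \<eta> i j n = \<eta> j i n) \<Longrightarrow>
      e_form M ell \<theta> \<epsilon> \<eta> \<ge> ce * ((\<Sum>i\<in>UNIV. \<Sum>j\<in>UNIV. (\<epsilon> i j)\<^sup>2) + ell\<^sup>2 * (\<Sum>i\<in>UNIV. \<Sum>j\<in>UNIV. \<Sum>n\<in>UNIV. (\<eta> i j n)\<^sup>2))"
    using e_form_coercive by blast
  obtain \<theta>k ck where \<theta>k: "\<theta>k > 0" "ck > 0" and k: "\<And>\<theta> ell u \<gamma>. \<theta> > \<theta>k \<Longrightarrow> ell > 0 \<Longrightarrow>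
      k_form M ell \<theta> u \<gamma> \<ge> ck * ((\<Sum>i\<in>UNIV. (u i)\<^sup>2) + ell\<^sup>2 * (\<Sum>i\<in>UNIV. \<Sum>p\<in>UNIV. (\<gamma> i p)\<^sup>2))"
    using k_form_coercive by blast
  have n2: "(\<Sum>i\<in>UNIV. \<Sum>j\<in>UNIV. (f i j)\<^sup>2) \<ge> 0" "(\<exists>i j. f i j \<noteq> 0) \<Longrightarrow> (\<Sum>i\<in>UNIV. \<Sum>j\<in>UNIV. (f i j)\<^sup>2) > 0"
    for f :: "'d \<Rightarrow> 'd \<Rightarrow> real"
    by (auto simp: less_le sum_nonneg sum_nonneg_eq_0_iff)
  have n3: "(\<Sum>i\<in>UNIV. \<Sum>j\<in>UNIV. \<Sum>n\<in>UNIV. (f i j n)\<^sup>2) \<ge> 0"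
    "(\<exists>i j n. f i j n \<noteq> 0) \<Longrightarrow> (\<Sum>i\<in>UNIV. \<Sum>j\<in>UNIV. \<Sum>n\<in>UNIV. (f i j n)\<^sup>2) > 0"
    for f :: "'d \<Rightarrow> 'd \<Rightarrow> 'd \<Rightarrow> real"
    by (auto simp: less_le sum_nonneg sum_nonneg_eq_0_iff)
  have n1: "(\<Sum>i\<in>UNIV. (f i)\<^sup>2) \<ge> 0" "(\<exists>i. f i \<noteq> 0) \<Longrightarrow> (\<Sum>i\<in>UNIV. (f i)\<^sup>2) > 0"
    for f :: "'d \<Rightarrow> real"
    by (auto simp: less_le sum_nonneg sum_nonneg_eq_0_iff)
  have e0: "e_form M ell \<theta> \<epsilon> \<eta> \<ge> 0"
    if "\<theta> > \<theta>e" "ell > 0" "\<And>i j. \<epsilon> i j = \<epsilon> j i" "\<And>i j n. \<eta> i j n = \<eta> j i n" for ell \<theta> \<epsilon> \<eta>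
    by (rule order_trans[OF _ e[OF that]]) (use \<theta>e n2(1) n3(1) in \<open>auto intro!: mult_nonneg_nonneg add_nonneg_nonneg\<close>)
  have e_pos: "e_form M ell \<theta> \<epsilon> \<eta> > 0"
    if "\<theta> > \<theta>e" "ell > 0" "\<And>i j. \<epsilon> i j = \<epsilon> j i" "\<And>i j n. \<eta> i j n = \<eta> j i n"
      "\<not> ((\<forall>i j. \<epsilon> i j = 0) \<and> (\<forall>i j n. \<eta> i j n = 0))" for ell \<theta> \<epsilon> \<eta>
  proof (rule less_le_trans[OF _ e[OF that(1-4)]])
    have "ell\<^sup>2 > 0" using that(2) by simp
    have "(\<exists>i j. \<epsilon> i j \<noteq> 0) \<or> (\<exists>i j n. \<eta> i j n \<noteq> 0)" using that(5) by blast
    then show "0 < ce * ((\<Sum>i\<in>UNIV. \<Sum>j\<in>UNIV. (\<epsilon> i j)\<^sup>2) + ell\<^sup>2 * (\<Sum>i\<in>UNIV. \<Sum>j\<in>UNIV. \<Sum>n\<in>UNIV. (\<eta> i j n)\<^sup>2))"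
    proof
      assume "\<exists>i j. \<epsilon> i j \<noteq> 0"
      from n2(2)[OF this] show ?thesis using \<theta>e n3(1)[of \<eta>] \<open>ell\<^sup>2 > 0\<close>
        by (intro mult_pos_pos add_pos_nonneg) auto
    next
      assume "\<exists>i j n. \<eta> i j n \<noteq> 0"
      from n3(2)[OF this] show ?thesis using \<theta>e n2(1)[of \<epsilon>] \<open>ell\<^sup>2 > 0\<close>
        by (intro mult_pos_pos add_nonneg_pos) auto
    qed
  qed
  have k0: "k_form M ell \<theta> u \<gamma> \<ge> 0" if "\<theta> > \<theta>k" "ell > 0" for ell \<theta> u \<gamma>
    by (rule order_trans[OF _ k[OF that]]) (use \<theta>k n1(1) n2(1) in \<open>auto intro!: mult_nonneg_nonneg add_nonneg_nonneg\<close>)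
  have k_pos: "k_form M ell \<theta> u \<gamma> > 0"
    if "\<theta> > \<theta>k" "ell > 0" "\<not> ((\<forall>i. u i = 0) \<and> (\<forall>i p. \<gamma> i p = 0))" for ell \<theta> u \<gamma>
  proof (rule less_le_trans[OF _ k[OF that(1,2)]])
    have "ell\<^sup>2 > 0" using that(2) by simp
    have "(\<exists>i. u i \<noteq> 0) \<or> (\<exists>i p. \<gamma> i p \<noteq> 0)" using that(3) by blast
    then show "0 < ck * ((\<Sum>i\<in>UNIV. (u i)\<^sup>2) + ell\<^sup>2 * (\<Sum>i\<in>UNIV. \<Sum>p\<in>UNIV. (\<gamma> i p)\<^sup>2))"
    proof
      assume "\<exists>i. u i \<noteq> 0"
      from n1(2)[OF this] show ?thesis using \<theta>k n2(1)[of \<gamma>] \<open>ell\<^sup>2 > 0\<close>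
        by (intro mult_pos_pos add_pos_nonneg) auto
    next
      assume "\<exists>i p. \<gamma> i p \<noteq> 0"
      from n2(2)[OF this] show ?thesis using \<theta>k n1(1)[of u] \<open>ell\<^sup>2 > 0\<close>
        by (intro mult_pos_pos add_nonneg_pos) auto
    qed
  qed
  show ?thesis
  proof (rule exI[of _ \<theta>e], rule exI[of _ \<theta>k], intro conjI allI impI \<theta>e(1) \<theta>k(1))
    fix ell \<theta> :: real and \<epsilon> :: "'d \<Rightarrow> 'd \<Rightarrow> real" and \<eta> :: "'d \<Rightarrow> 'd \<Rightarrow> 'd \<Rightarrow> real"
    assume "ell > 0" "\<theta> > \<theta>e" "\<forall>i j. \<epsilon> i j = \<epsilon> j i" "\<forall>i j n. \<eta> i j n = \<eta> j i n"
      "\<not> ((\<forall>i j. \<epsilon> i j = 0) \<and> (\<forall>i j n. \<eta> i j n = 0))"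
    then show "e_form M ell \<theta> \<epsilon> \<eta> > 0" by (intro e_pos) blast+
  next
    fix ell \<theta> :: real and U :: "real^'d \<Rightarrow> real^'d"
    assume "ell > 0" "\<theta> > \<theta>e"
    then show "Q_form M ell \<theta> U U \<ge> 0"
      unfolding Q_form_eq_e_form
      by (intro Bochner_Integration.integral_nonneg mult_nonneg_nonneg e0
          fun_cong[OF strain_commute] fun_cong[OF strain_grad_commute]) auto
  next
    fix ell \<theta> :: real and u :: "'d \<Rightarrow> real" and \<gamma> :: "'d \<Rightarrow> 'd \<Rightarrow> real"
    assume "ell > 0" "\<theta> > \<theta>k" "\<not> ((\<forall>i. u i = 0) \<and> (\<forall>i p. \<gamma> i p = 0))"
    then show "k_form M ell \<theta> u \<gamma> > 0" by (intro k_pos)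
  next
    fix ell \<theta> :: real and U :: "real^'d \<Rightarrow> real^'d"
    assume "ell > 0" "\<theta> > \<theta>k"
    then show "R_form M ell \<theta> U U \<ge> 0"
      unfolding R_form_eq_k_form
      by (intro Bochner_Integration.integral_nonneg mult_nonneg_nonneg k0) auto
  next
    fix ell \<theta> :: real and U :: "real^'d \<Rightarrow> real^'d"
    show "Q_op M ell \<theta> U = mpoly_op (Q_poly M ell \<theta>) U" by (rule Q_op_eq_mpoly_op)
    show "R_op M ell \<theta> U = mpoly_op (R_poly M ell \<theta>) U" by (rule R_op_eq_mpoly_op)
  next
    fix ell \<theta> :: real and \<xi> :: "real^'d"
    assume "ell > 0" "\<theta> > max \<theta>e \<theta>k" "\<xi> \<noteq> 0"
    then show "hermitian_pos_def (fourier_symbol (Q_poly M ell \<theta>) \<xi>)"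
      by (intro Q_symbol_pos_def e0 e_pos) auto
    show "hermitian_pos_def (fourier_symbol (R_poly M ell \<theta>) \<xi>)"
      using \<open>ell > 0\<close> \<open>\<theta> > max \<theta>e \<theta>k\<close> by (intro R_symbol_pos_def k0 k_pos) auto
  next
    fix ell \<theta> :: real
    assume ell: "ell > 0" and \<theta>: "\<theta> > max \<theta>e \<theta>k"
    then have \<theta>': "\<theta> > \<theta>e" "\<theta> > \<theta>k" by auto
    obtain C where C: "C > 0" "\<And>U. vH2 UNIV U \<Longrightarrow> Q_form M ell \<theta> U U \<ge> C * (H2_normsq UNIV U - L2_normsq UNIV U)"
      using Q_form_coercive[OF \<theta>e(2) ell e[OF \<theta>'(1) ell]] by blast
    have "0 \<le> C * (H2_normsq UNIV U - L2_normsq UNIV U)" for U :: "real^'d \<Rightarrow> real^'d"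
      unfolding H2_minus_L2_normsq using C(1) by (intro mult_nonneg_nonneg add_nonneg_nonneg sum_nonneg) auto
    with C show "\<exists>C>0. \<forall>U. vH2 UNIV U \<longrightarrow>
          Q_form M ell \<theta> U U \<ge> C * (H2_normsq UNIV U - L2_normsq UNIV U) \<and>
          C * (H2_normsq UNIV U - L2_normsq UNIV U) \<ge> 0" by blast
    obtain C' where "C' > 0" "\<And>W. vH1 UNIV W \<Longrightarrow> R_form M ell \<theta> W W \<ge> C' * H1_normsq UNIV W"
      using R_form_elliptic[OF \<theta>k(2) ell k[OF \<theta>'(2) ell]] by blast
    then show "\<exists>C>0. \<forall>W. vH1 UNIV W \<longrightarrow> R_form M ell \<theta> W W \<ge> C * H1_normsq UNIV W" by blast
  qed
qed

end
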